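(* Let $L$ be a finite-dimensional solvable restricted Lie algebra over a field $\mathbb{F}$ of prime characteristic $p$, and let $\chi$ be a linear form on $L$. If $S$ is a one-dimensional $L$-module with $p$-character $\chi$, then $P_L(S)\cong \mathrm{Ind}_T^L(S_{\vert T},\chi)$ as $L$-modules for every maximal torus $T$ of $L$.
   Context: Let $(L,{}^{[p]})$ be a finite-dimensional restricted Lie algebra over a field $\mathbb{F}$ of prime characteristic $p$. For a linear form $\chi:L\to\mathbb{F}$, the $\chi$-reduced universal enveloping algebra is $u(L,\chi):=U(L)/(x^p-x^{[p]}-\chi(x)^p\cdot 1\mid x\in L)$. An $L$-module $M$ has $p$-character $\chi$ if $x^p\cdot m-x^{[p]}\cdot m=\chi(x)^p m$ for all $x\in L$, $m\in M$, i.e. if it is a $u(L,\chi)$-module. For such $M$, $P_L(M)$ denotes the projective cover of $M$ as a $u(L,\chi)$-module. A $p$-subalgebra is a subalgebra closed under the $[p]$-map. For a $p$-subalgebra $H$ of $L$ and an $H$-module $V$ with $p$-character $\chi_{\vert H}$, $\mathrm{Ind}_H^L(V,\chi):=u(L,\chi)\otimes_{u(H,\chi_{\vert H})}V$. A torus of $L$ is an abelian $p$-subalgebra all of whose elements $x$ are semisimple, i.e. $x$ lies in the $p$-subalgebra generated by $x^{[p]}$; a maximal torus is a torus that is maximal with respect to inclusion. *)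

theory Defs
  imports "HOL-Algebra.Free_Abelian_Groups" "HOL-Algebra.QuotRing" "HOL-Algebra.Module" "HOL-Algebra.Generated_Groups" "HOL-Computational_Algebra.Primes"
begin

section \<open>Vector spaces\<close>

text \<open>Vector spaces over a field \<open>F\<close> are modules in the sense of \<^locale>\<open>module\<close>; the
  ring multiplication and the unit of the record \<^term>\<open>V\<close> carry no meaning.\<close>

definition fin_basis :: "('k, 'm) ring_scheme \<Rightarrow> ('k, 'v, 'n) module_scheme \<Rightarrow> 'v set \<Rightarrow> bool"
  where "fin_basis F V B \<longleftrightarrow> finite B \<and> B \<subseteq> carrier V \<and>
    (\<forall>v\<in>carrier V. \<exists>!c. c \<in> B \<rightarrow>\<^sub>E carrier F \<and> v = (\<Oplus>\<^bsub>V\<^esub>b\<in>B. c b \<odot>\<^bsub>V\<^esub> b))"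

definition has_dim :: "('k, 'm) ring_scheme \<Rightarrow> ('k, 'v, 'n) module_scheme \<Rightarrow> nat \<Rightarrow> bool"
  where "has_dim F V n \<longleftrightarrow> (\<exists>B. fin_basis F V B \<and> card B = n)"

definition finite_dim :: "('k, 'm) ring_scheme \<Rightarrow> ('k, 'v, 'n) module_scheme \<Rightarrow> bool"
  where "finite_dim F V \<longleftrightarrow> (\<exists>n. has_dim F V n)"

definition linear_form ::
    "('k, 'm) ring_scheme \<Rightarrow> ('k, 'v, 'n) module_scheme \<Rightarrow> ('v \<Rightarrow> 'k) \<Rightarrow> bool"
  where "linear_form F V \<chi> \<longleftrightarrow> \<chi> \<in> carrier V \<rightarrow> carrier F \<and>
    (\<forall>x\<in>carrier V. \<forall>y\<in>carrier V. \<chi> (x \<oplus>\<^bsub>V\<^esub> y) = \<chi> x \<oplus>\<^bsub>F\<^esub> \<chi> y) \<and>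
    (\<forall>a\<in>carrier F. \<forall>x\<in>carrier V. \<chi> (a \<odot>\<^bsub>V\<^esub> x) = a \<otimes>\<^bsub>F\<^esub> \<chi> x)"


section \<open>Restricted Lie algebras\<close>

record ('k, 'l) rlie = "('k, 'l) module" +
  lie_bracket :: "'l \<Rightarrow> 'l \<Rightarrow> 'l"
  pmap :: "'l \<Rightarrow> 'l"

locale lie_algebra = field F + module F L
  for F :: "('k, 'n) ring_scheme" (structure) and L :: "('k, 'l, 'm) rlie_scheme" (structure) +
  assumes bracket_closed:
      "\<lbrakk>x \<in> carrier L; y \<in> carrier L\<rbrakk> \<Longrightarrow> lie_bracket L x y \<in> carrier L"
    and bracket_add_left: "\<lbrakk>x \<in> carrier L; y \<in> carrier L; z \<in> carrier L\<rbrakk> \<Longrightarrow>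
      lie_bracket L (x \<oplus>\<^bsub>L\<^esub> y) z = lie_bracket L x z \<oplus>\<^bsub>L\<^esub> lie_bracket L y z"
    and bracket_add_right: "\<lbrakk>x \<in> carrier L; y \<in> carrier L; z \<in> carrier L\<rbrakk> \<Longrightarrow>
      lie_bracket L x (y \<oplus>\<^bsub>L\<^esub> z) = lie_bracket L x y \<oplus>\<^bsub>L\<^esub> lie_bracket L x z"
    and bracket_smult_left: "\<lbrakk>a \<in> carrier F; x \<in> carrier L; y \<in> carrier L\<rbrakk> \<Longrightarrow>
      lie_bracket L (a \<odot>\<^bsub>L\<^esub> x) y = a \<odot>\<^bsub>L\<^esub> lie_bracket L x y"
    and bracket_smult_right: "\<lbrakk>a \<in> carrier F; x \<in> carrier L; y \<in> carrier L\<rbrakk> \<Longrightarrow>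
      lie_bracket L x (a \<odot>\<^bsub>L\<^esub> y) = a \<odot>\<^bsub>L\<^esub> lie_bracket L x y"
    and bracket_self: "x \<in> carrier L \<Longrightarrow> lie_bracket L x x = \<zero>\<^bsub>L\<^esub>"
    and jacobi: "\<lbrakk>x \<in> carrier L; y \<in> carrier L; z \<in> carrier L\<rbrakk> \<Longrightarrow>
      lie_bracket L x (lie_bracket L y z) \<oplus>\<^bsub>L\<^esub> lie_bracket L y (lie_bracket L z x)
        \<oplus>\<^bsub>L\<^esub> lie_bracket L z (lie_bracket L x y) = \<zero>\<^bsub>L\<^esub>"

text \<open>\<open>ad_pow_coeff L x y n j\<close> is the coefficient of \<open>t\<^sup>j\<close> in \<open>(ad (t x + y))\<^sup>n (x)\<close>, computed
  in \<open>L[t]\<close>. Jacobson's elements \<open>s\<^sub>i(x,y)\<close>, for \<open>0 < i < p\<close>, are determined by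
  \<open>(ad (t x + y))\<^sup>p\<^sup>-\<^sup>1 (x) = \<Sum> i s\<^sub>i(x,y) t\<^sup>i\<^sup>-\<^sup>1\<close>.\<close>

primrec ad_pow_coeff ::
    "('k, 'l, 'm) rlie_scheme \<Rightarrow> 'l \<Rightarrow> 'l \<Rightarrow> nat \<Rightarrow> nat \<Rightarrow> 'l"
  where
    "ad_pow_coeff L x y 0 = (\<lambda>j. if j = 0 then x else \<zero>\<^bsub>L\<^esub>)"
  | "ad_pow_coeff L x y (Suc n) =
      (\<lambda>j. (if j = 0 then \<zero>\<^bsub>L\<^esub> else lie_bracket L x (ad_pow_coeff L x y n (j - 1)))
           \<oplus>\<^bsub>L\<^esub> lie_bracket L y (ad_pow_coeff L x y n j))"

definition jacobson_s :: "nat \<Rightarrow> ('k, 'n) ring_scheme \<Rightarrow> ('k, 'l, 'm) rlie_scheme \<Rightarrow>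
    nat \<Rightarrow> 'l \<Rightarrow> 'l \<Rightarrow> 'l"
  where "jacobson_s p F L i x y =
    inv\<^bsub>F\<^esub> (add_pow F i \<one>\<^bsub>F\<^esub>) \<odot>\<^bsub>L\<^esub> ad_pow_coeff L x y (p - 1) (i - 1)"

locale restricted_lie_algebra = lie_algebra F L
  for p :: nat and F :: "('k, 'n) ring_scheme" (structure)
    and L :: "('k, 'l, 'm) rlie_scheme" (structure) +
  assumes prime_p: "Factorial_Ring.prime p"
    and char_p: "add_pow F p \<one> = \<zero>"
    and pmap_closed: "x \<in> carrier L \<Longrightarrow> pmap L x \<in> carrier L"
    and ad_pmap: "\<lbrakk>x \<in> carrier L; y \<in> carrier L\<rbrakk> \<Longrightarrow>
      lie_bracket L (pmap L x) y = (lie_bracket L x ^^ p) y"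
    and pmap_smult: "\<lbrakk>a \<in> carrier F; x \<in> carrier L\<rbrakk> \<Longrightarrow>
      pmap L (a \<odot>\<^bsub>L\<^esub> x) = (a [^] p) \<odot>\<^bsub>L\<^esub> pmap L x"
    and pmap_add: "\<lbrakk>x \<in> carrier L; y \<in> carrier L\<rbrakk> \<Longrightarrow>
      pmap L (x \<oplus>\<^bsub>L\<^esub> y) =
        pmap L x \<oplus>\<^bsub>L\<^esub> pmap L y \<oplus>\<^bsub>L\<^esub> (\<Oplus>\<^bsub>L\<^esub>i\<in>{1..<p}. jacobson_s p F L i x y)"

definition lie_derived ::
    "('k, 'n) ring_scheme \<Rightarrow> ('k, 'l, 'm) rlie_scheme \<Rightarrow> 'l set \<Rightarrow> 'l set"
  where "lie_derived F L H =
    \<Inter>{N. submodule N F L \<and> (\<forall>x\<in>H. \<forall>y\<in>H. lie_bracket L x y \<in> N)}"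

definition lie_solvable :: "('k, 'n) ring_scheme \<Rightarrow> ('k, 'l, 'm) rlie_scheme \<Rightarrow> bool"
  where "lie_solvable F L \<longleftrightarrow> (\<exists>n. (lie_derived F L ^^ n) (carrier L) = {\<zero>\<^bsub>L\<^esub>})"

definition p_subalgebra ::
    "('k, 'n) ring_scheme \<Rightarrow> ('k, 'l, 'm) rlie_scheme \<Rightarrow> 'l set \<Rightarrow> bool"
  where "p_subalgebra F L H \<longleftrightarrow> submodule H F L \<and>
    (\<forall>x\<in>H. \<forall>y\<in>H. lie_bracket L x y \<in> H) \<and> (\<forall>x\<in>H. pmap L x \<in> H)"

definition p_subalgebra_generated ::
    "('k, 'n) ring_scheme \<Rightarrow> ('k, 'l, 'm) rlie_scheme \<Rightarrow> 'l set \<Rightarrow> 'l set"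
  where "p_subalgebra_generated F L X = \<Inter>{H. p_subalgebra F L H \<and> X \<subseteq> H}"

definition lie_semisimple ::
    "('k, 'n) ring_scheme \<Rightarrow> ('k, 'l, 'm) rlie_scheme \<Rightarrow> 'l \<Rightarrow> bool"
  where "lie_semisimple F L x \<longleftrightarrow> x \<in> p_subalgebra_generated F L {pmap L x}"

definition torus :: "('k, 'n) ring_scheme \<Rightarrow> ('k, 'l, 'm) rlie_scheme \<Rightarrow> 'l set \<Rightarrow> bool"
  where "torus F L T \<longleftrightarrow> p_subalgebra F L T \<and>
    (\<forall>x\<in>T. \<forall>y\<in>T. lie_bracket L x y = \<zero>\<^bsub>L\<^esub>) \<and> (\<forall>x\<in>T. lie_semisimple F L x)"

definition maximal_torus ::
    "('k, 'n) ring_scheme \<Rightarrow> ('k, 'l, 'm) rlie_scheme \<Rightarrow> 'l set \<Rightarrow> bool"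
  where "maximal_torus F L T \<longleftrightarrow>
    torus F L T \<and> (\<forall>T'. torus F L T' \<longrightarrow> T \<subseteq> T' \<longrightarrow> T' = T)"

text \<open>A \<open>p\<close>-subalgebra \<open>H\<close> as a restricted Lie algebra in its own right.\<close>

abbreviation sub_rlie :: "('k, 'l, 'm) rlie_scheme \<Rightarrow> 'l set \<Rightarrow> ('k, 'l, 'm) rlie_scheme"
  where "sub_rlie L H \<equiv> L\<lparr>carrier := H\<rparr>"


section \<open>Modules over Lie algebras\<close>

record ('k, 'l, 'v) lie_mod = "('k, 'v) module" +
  act :: "'l \<Rightarrow> 'v \<Rightarrow> 'v"

locale lie_module = lie_algebra F L + V: module F V
  for F :: "('k, 'n) ring_scheme" (structure) and L :: "('k, 'l, 'm) rlie_scheme" (structure)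
    and V :: "('k, 'l, 'v, 'w) lie_mod_scheme" (structure) +
  assumes act_closed: "\<lbrakk>x \<in> carrier L; v \<in> carrier V\<rbrakk> \<Longrightarrow> act V x v \<in> carrier V"
    and act_add_left: "\<lbrakk>x \<in> carrier L; y \<in> carrier L; v \<in> carrier V\<rbrakk> \<Longrightarrow>
      act V (x \<oplus>\<^bsub>L\<^esub> y) v = act V x v \<oplus>\<^bsub>V\<^esub> act V y v"
    and act_smult_left: "\<lbrakk>a \<in> carrier F; x \<in> carrier L; v \<in> carrier V\<rbrakk> \<Longrightarrow>
      act V (a \<odot>\<^bsub>L\<^esub> x) v = a \<odot>\<^bsub>V\<^esub> act V x v"
    and act_add_right: "\<lbrakk>x \<in> carrier L; v \<in> carrier V; w \<in> carrier V\<rbrakk> \<Longrightarrow>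
      act V x (v \<oplus>\<^bsub>V\<^esub> w) = act V x v \<oplus>\<^bsub>V\<^esub> act V x w"
    and act_smult_right: "\<lbrakk>a \<in> carrier F; x \<in> carrier L; v \<in> carrier V\<rbrakk> \<Longrightarrow>
      act V x (a \<odot>\<^bsub>V\<^esub> v) = a \<odot>\<^bsub>V\<^esub> act V x v"
    and act_bracket: "\<lbrakk>x \<in> carrier L; y \<in> carrier L; v \<in> carrier V\<rbrakk> \<Longrightarrow>
      act V (lie_bracket L x y) v = act V x (act V y v) \<ominus>\<^bsub>V\<^esub> act V y (act V x v)"

definition has_p_character :: "nat \<Rightarrow> ('k, 'n) ring_scheme \<Rightarrow> ('k, 'l, 'm) rlie_scheme \<Rightarrow>
    ('l \<Rightarrow> 'k) \<Rightarrow> ('k, 'l, 'v, 'w) lie_mod_scheme \<Rightarrow> bool"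
  where "has_p_character p F L \<chi> V \<longleftrightarrow> (\<forall>x\<in>carrier L. \<forall>v\<in>carrier V.
    (act V x ^^ p) v \<ominus>\<^bsub>V\<^esub> act V (pmap L x) v = (\<chi> x [^]\<^bsub>F\<^esub> p) \<odot>\<^bsub>V\<^esub> v)"

definition restrict_module ::
    "('k, 'l, 'v, 'w) lie_mod_scheme \<Rightarrow> 'l set \<Rightarrow> ('k, 'l, 'v, 'w) lie_mod_scheme"
  where "restrict_module V H = V\<lparr>act := restrict (act V) H\<rparr>"

definition lie_module_isomorphic :: "('k, 'n) ring_scheme \<Rightarrow> ('k, 'l, 'm) rlie_scheme \<Rightarrow>
    ('k, 'l, 'v, 'a) lie_mod_scheme \<Rightarrow> ('k, 'l, 'w, 'b) lie_mod_scheme \<Rightarrow> bool"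
  where "lie_module_isomorphic F L V W \<longleftrightarrow> (\<exists>h. bij_betw h (carrier V) (carrier W) \<and>
    (\<forall>v\<in>carrier V. \<forall>w\<in>carrier V. h (v \<oplus>\<^bsub>V\<^esub> w) = h v \<oplus>\<^bsub>W\<^esub> h w) \<and>
    (\<forall>a\<in>carrier F. \<forall>v\<in>carrier V. h (a \<odot>\<^bsub>V\<^esub> v) = a \<odot>\<^bsub>W\<^esub> h v) \<and>
    (\<forall>x\<in>carrier L. \<forall>v\<in>carrier V. h (act V x v) = act W x (h v)))"


section \<open>Left modules over noncommutative rings\<close>

text \<open>The library's \<^locale>\<open>module\<close> requires a commutative ring; its \<^locale>\<open>submodule\<close> does not
  and is used below for left modules as well.\<close>

locale left_module = R?: ring R + M?: abelian_group M
  for R :: "('r, 'n) ring_scheme" (structure) and M :: "('r, 'a, 'm) module_scheme" (structure) +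
  assumes smult_closed:
      "\<lbrakk>a \<in> carrier R; x \<in> carrier M\<rbrakk> \<Longrightarrow> a \<odot>\<^bsub>M\<^esub> x \<in> carrier M"
    and smult_l_distr: "\<lbrakk>a \<in> carrier R; b \<in> carrier R; x \<in> carrier M\<rbrakk> \<Longrightarrow>
      (a \<oplus> b) \<odot>\<^bsub>M\<^esub> x = a \<odot>\<^bsub>M\<^esub> x \<oplus>\<^bsub>M\<^esub> b \<odot>\<^bsub>M\<^esub> x"
    and smult_r_distr: "\<lbrakk>a \<in> carrier R; x \<in> carrier M; y \<in> carrier M\<rbrakk> \<Longrightarrow>
      a \<odot>\<^bsub>M\<^esub> (x \<oplus>\<^bsub>M\<^esub> y) = a \<odot>\<^bsub>M\<^esub> x \<oplus>\<^bsub>M\<^esub> a \<odot>\<^bsub>M\<^esub> y"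
    and smult_assoc1: "\<lbrakk>a \<in> carrier R; b \<in> carrier R; x \<in> carrier M\<rbrakk> \<Longrightarrow>
      (a \<otimes> b) \<odot>\<^bsub>M\<^esub> x = a \<odot>\<^bsub>M\<^esub> (b \<odot>\<^bsub>M\<^esub> x)"
    and smult_one: "x \<in> carrier M \<Longrightarrow> \<one> \<odot>\<^bsub>M\<^esub> x = x"

definition lmod_hom :: "('r, 'n) ring_scheme \<Rightarrow> ('r, 'a, 'm) module_scheme \<Rightarrow>
    ('r, 'b, 'o) module_scheme \<Rightarrow> ('a \<Rightarrow> 'b) set"
  where "lmod_hom R M N = {h \<in> carrier M \<rightarrow> carrier N.
    (\<forall>x\<in>carrier M. \<forall>y\<in>carrier M. h (x \<oplus>\<^bsub>M\<^esub> y) = h x \<oplus>\<^bsub>N\<^esub> h y) \<and>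
    (\<forall>r\<in>carrier R. \<forall>x\<in>carrier M. h (r \<odot>\<^bsub>M\<^esub> x) = r \<odot>\<^bsub>N\<^esub> h x)}"

text \<open>The usual lifting property. A definition cannot quantify over types, so the test modules
  \<open>M\<close> and \<open>N\<close> live on fixed types, chosen large enough to contain the free module on the carrier
  of \<open>P\<close> and \<open>P\<close> itself; \<open>projective_lift\<close> below shows that lifting against epimorphisms of
  modules on arbitrary types follows.\<close>

definition projective :: "('r, 'n) ring_scheme \<Rightarrow> ('r, 'p, 'm) module_scheme \<Rightarrow> bool"
  where "projective R P \<longleftrightarrow> left_module R P \<and>
    (\<forall>(M :: ('r, 'p \<Rightarrow> 'r) module) (N :: ('r, 'p) module) g f.
       left_module R M \<longrightarrow> left_module R N \<longrightarrow>
       g \<in> lmod_hom R M N \<longrightarrow> g ` carrier M = carrier N \<longrightarrow> f \<in> lmod_hom R P N \<longrightarrow>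
       (\<exists>h\<in>lmod_hom R P M. \<forall>x\<in>carrier P. g (h x) = f x))"

text \<open>The free left module on \<open>X\<close> serves only to prove \<open>projective_lift\<close>.\<close>

definition free_lmod :: "('r, 'n) ring_scheme \<Rightarrow> 'x set \<Rightarrow> ('r, 'x \<Rightarrow> 'r) module"
  where "free_lmod R X =
    \<lparr>carrier = {c. range c \<subseteq> carrier R \<and> finite {x. c x \<noteq> \<zero>\<^bsub>R\<^esub>} \<and> {x. c x \<noteq> \<zero>\<^bsub>R\<^esub>} \<subseteq> X},
     monoid.mult = undefined, one = undefined,
     zero = (\<lambda>x. \<zero>\<^bsub>R\<^esub>), add = (\<lambda>c d x. c x \<oplus>\<^bsub>R\<^esub> d x),
     smult = (\<lambda>r c x. r \<otimes>\<^bsub>R\<^esub> c x)\<rparr>"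

lemma free_lmod_left_module:
  fixes R (structure)
  assumes "ring R"
  shows "left_module R (free_lmod R X)"
proof -
  interpret ring R by fact
  let ?M = "free_lmod R X"
  have cl: "c x \<in> carrier R" if "c \<in> carrier ?M" for c x
    using that by (auto simp: free_lmod_def)
  have add: "c \<oplus>\<^bsub>?M\<^esub> d \<in> carrier ?M" if "c \<in> carrier ?M" "d \<in> carrier ?M" for c d
  proof -
    have "{x. c x \<oplus> d x \<noteq> \<zero>} \<subseteq> {x. c x \<noteq> \<zero>} \<union> {x. d x \<noteq> \<zero>}" by auto
    moreover have "finite ({x. c x \<noteq> \<zero>} \<union> {x. d x \<noteq> \<zero>})"
        "{x. c x \<noteq> \<zero>} \<union> {x. d x \<noteq> \<zero>} \<subseteq> X"
      using that by (auto simp: free_lmod_def)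
    ultimately show ?thesis
      using cl[OF that(1)] cl[OF that(2)]
      by (auto simp: free_lmod_def elim: finite_subset)
  qed
  have smul: "r \<odot>\<^bsub>?M\<^esub> c \<in> carrier ?M" if "r \<in> carrier R" "c \<in> carrier ?M" for r c
  proof -
    have "{x. r \<otimes> c x \<noteq> \<zero>} \<subseteq> {x. c x \<noteq> \<zero>}" using that by auto
    moreover have "finite {x. c x \<noteq> \<zero>}" "{x. c x \<noteq> \<zero>} \<subseteq> X"
      using that by (auto simp: free_lmod_def)
    ultimately show ?thesis
      using that(1) cl[OF that(2)]
      by (auto simp: free_lmod_def elim: finite_subset)
  qed
  have zero: "\<zero>\<^bsub>?M\<^esub> \<in> carrier ?M" by (auto simp: free_lmod_def)
  have "abelian_group ?M"
  proof (rule abelian_groupI)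
    fix c assume c: "c \<in> carrier ?M"
    have "\<ominus> \<one> \<odot>\<^bsub>?M\<^esub> c \<oplus>\<^bsub>?M\<^esub> c = \<zero>\<^bsub>?M\<^esub>"
      using cl[OF c] by (auto simp: free_lmod_def l_minus l_neg)
    then show "\<exists>d\<in>carrier ?M. d \<oplus>\<^bsub>?M\<^esub> c = \<zero>\<^bsub>?M\<^esub>"
      using smul[OF _ c, of "\<ominus> \<one>"] by auto
  next
    fix c d e assume c: "c \<in> carrier ?M" and d: "d \<in> carrier ?M" and e: "e \<in> carrier ?M"
    show "c \<oplus>\<^bsub>?M\<^esub> d \<oplus>\<^bsub>?M\<^esub> e = c \<oplus>\<^bsub>?M\<^esub> (d \<oplus>\<^bsub>?M\<^esub> e)"
      using cl[OF c] cl[OF d] cl[OF e] by (simp add: free_lmod_def a_assoc)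
  next
    fix c d assume c: "c \<in> carrier ?M" and d: "d \<in> carrier ?M"
    show "c \<oplus>\<^bsub>?M\<^esub> d = d \<oplus>\<^bsub>?M\<^esub> c"
      using cl[OF c] cl[OF d] by (simp add: free_lmod_def a_comm)
  next
    fix c assume c: "c \<in> carrier ?M"
    show "\<zero>\<^bsub>?M\<^esub> \<oplus>\<^bsub>?M\<^esub> c = c" using cl[OF c] by (simp add: free_lmod_def)
  qed (use add zero in auto)
  then show ?thesis
  proof (intro left_module.intro left_module_axioms.intro \<open>ring R\<close>)
    fix a b c assume a: "a \<in> carrier R" "b \<in> carrier R" and c: "c \<in> carrier ?M"
    show "(a \<oplus> b) \<odot>\<^bsub>?M\<^esub> c = a \<odot>\<^bsub>?M\<^esub> c \<oplus>\<^bsub>?M\<^esub> b \<odot>\<^bsub>?M\<^esub> c"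
      using a cl[OF c] by (simp add: free_lmod_def l_distr)
    show "(a \<otimes> b) \<odot>\<^bsub>?M\<^esub> c = a \<odot>\<^bsub>?M\<^esub> (b \<odot>\<^bsub>?M\<^esub> c)"
      using a cl[OF c] by (simp add: free_lmod_def m_assoc)
  next
    fix a c d assume a: "a \<in> carrier R" and c: "c \<in> carrier ?M" and d: "d \<in> carrier ?M"
    show "a \<odot>\<^bsub>?M\<^esub> (c \<oplus>\<^bsub>?M\<^esub> d) = a \<odot>\<^bsub>?M\<^esub> c \<oplus>\<^bsub>?M\<^esub> a \<odot>\<^bsub>?M\<^esub> d"
      using a cl[OF c] cl[OF d] by (simp add: free_lmod_def r_distr)
  next
    fix c assume c: "c \<in> carrier ?M"
    show "\<one> \<odot>\<^bsub>?M\<^esub> c = c" using cl[OF c] by (simp add: free_lmod_def)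
  qed (use smul in auto)
qed

definition lin_comb :: "('r, 'n) ring_scheme \<Rightarrow> ('r, 'a, 'm) module_scheme \<Rightarrow>
    ('x \<Rightarrow> 'a) \<Rightarrow> ('x \<Rightarrow> 'r) \<Rightarrow> 'a"
  where "lin_comb R M m c = (\<Oplus>\<^bsub>M\<^esub>x\<in>{x. c x \<noteq> \<zero>\<^bsub>R\<^esub>}. c x \<odot>\<^bsub>M\<^esub> m x)"

lemma (in left_module) smult_l_null: "x \<in> carrier M \<Longrightarrow> \<zero> \<odot>\<^bsub>M\<^esub> x = \<zero>\<^bsub>M\<^esub>"
  using smult_l_distr[of \<zero> \<zero> x] smult_closed[of \<zero> x] by (metis M.add.r_cancel_one' R.l_zero R.zero_closed)

lemma (in left_module) smult_r_null: "r \<in> carrier R \<Longrightarrow> r \<odot>\<^bsub>M\<^esub> \<zero>\<^bsub>M\<^esub> = \<zero>\<^bsub>M\<^esub>"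
  using smult_r_distr[of r "\<zero>\<^bsub>M\<^esub>" "\<zero>\<^bsub>M\<^esub>"] smult_closed[of r "\<zero>\<^bsub>M\<^esub>"]
  by (metis M.add.r_cancel_one' M.l_zero M.zero_closed)

lemma (in left_module) smult_finsum:
  assumes "finite A" "r \<in> carrier R" "f \<in> A \<rightarrow> carrier M"
  shows "r \<odot>\<^bsub>M\<^esub> (\<Oplus>\<^bsub>M\<^esub>x\<in>A. f x) = (\<Oplus>\<^bsub>M\<^esub>x\<in>A. r \<odot>\<^bsub>M\<^esub> f x)"
  using assms
proof (induction A rule: finite_induct)
  case empty
  then show ?case by (simp add: smult_r_null)
next
  case (insert a A)
  then have "f a \<in> carrier M" "f \<in> A \<rightarrow> carrier M" "(\<lambda>x. r \<odot>\<^bsub>M\<^esub> f x) \<in> A \<rightarrow> carrier M"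
    by (auto intro: smult_closed)
  with insert show ?case
    by (simp add: smult_r_distr smult_closed M.finsum_closed)
qed

context left_module
begin

lemma lin_comb_superset:
  assumes "finite A" "{x. c x \<noteq> \<zero>} \<subseteq> A" "A \<subseteq> X" "range c \<subseteq> carrier R" "m \<in> X \<rightarrow> carrier M"
  shows "lin_comb R M m c = (\<Oplus>\<^bsub>M\<^esub>x\<in>A. c x \<odot>\<^bsub>M\<^esub> m x)"
  unfolding lin_comb_def
proof (rule M.add.finprod_mono_neutral_cong_left)
  show "c i \<odot>\<^bsub>M\<^esub> m i = \<zero>\<^bsub>M\<^esub>" if "i \<in> A - {x. c x \<noteq> \<zero>}" for i
    using that assms by (auto intro!: smult_l_null)
  show "(\<lambda>x. c x \<odot>\<^bsub>M\<^esub> m x) \<in> A \<rightarrow> carrier M"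
    using assms by (auto intro!: smult_closed)
qed (use assms in auto)

lemma lin_comb_hom:
  assumes m: "m \<in> X \<rightarrow> carrier M"
  shows "lin_comb R M m \<in> lmod_hom R (free_lmod R X) M"
proof -
  let ?F = "free_lmod R X"
  interpret F: left_module R ?F by (rule free_lmod_left_module) (rule R.ring_axioms)
  have sup: "finite {x. c x \<noteq> \<zero>}" "{x. c x \<noteq> \<zero>} \<subseteq> X" "range c \<subseteq> carrier R"
    if "c \<in> carrier ?F" for c using that by (auto simp: free_lmod_def)
  have closed: "c x \<odot>\<^bsub>M\<^esub> m x \<in> carrier M" if "c \<in> carrier ?F" "x \<in> X" for c x
    using sup[OF that(1)] that(2) m by (auto intro!: smult_closed)
  show ?thesis
    unfolding lmod_hom_def
  proof (intro CollectI conjI ballI Pi_I)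
    fix c assume c: "c \<in> carrier ?F"
    show "lin_comb R M m c \<in> carrier M"
      unfolding lin_comb_def using closed[OF c] sup[OF c] by (intro M.finsum_closed) auto
  next
    fix c d assume c: "c \<in> carrier ?F" and d: "d \<in> carrier ?F"
    let ?A = "{x. c x \<noteq> \<zero>} \<union> {x. d x \<noteq> \<zero>}"
    have A: "finite ?A" "?A \<subseteq> X" using sup[OF c] sup[OF d] by auto
    have cd: "c \<oplus>\<^bsub>?F\<^esub> d \<in> carrier ?F" using c d by simp
    have eq: "(c \<oplus>\<^bsub>?F\<^esub> d) x = c x \<oplus> d x" for x by (simp add: free_lmod_def)
    have "lin_comb R M m (c \<oplus>\<^bsub>?F\<^esub> d) = (\<Oplus>\<^bsub>M\<^esub>x\<in>?A. (c \<oplus>\<^bsub>?F\<^esub> d) x \<odot>\<^bsub>M\<^esub> m x)"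
      by (rule lin_comb_superset[OF A(1) _ A(2) sup(3)[OF cd] m]) (auto simp: eq)
    also have "\<dots> = (\<Oplus>\<^bsub>M\<^esub>x\<in>?A. c x \<odot>\<^bsub>M\<^esub> m x \<oplus>\<^bsub>M\<^esub> d x \<odot>\<^bsub>M\<^esub> m x)"
    proof (rule M.finsum_cong')
      fix x assume "x \<in> ?A"
      with A have x: "x \<in> X" by auto
      have "c x \<in> carrier R" "d x \<in> carrier R" "m x \<in> carrier M"
        using sup(3)[OF c] sup(3)[OF d] m x by auto
      then show "(c \<oplus>\<^bsub>?F\<^esub> d) x \<odot>\<^bsub>M\<^esub> m x = c x \<odot>\<^bsub>M\<^esub> m x \<oplus>\<^bsub>M\<^esub> d x \<odot>\<^bsub>M\<^esub> m x"
        unfolding eq by (rule smult_l_distr)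
    qed (use A closed[OF c] closed[OF d] in auto)
    also have "\<dots> = (\<Oplus>\<^bsub>M\<^esub>x\<in>?A. c x \<odot>\<^bsub>M\<^esub> m x) \<oplus>\<^bsub>M\<^esub> (\<Oplus>\<^bsub>M\<^esub>x\<in>?A. d x \<odot>\<^bsub>M\<^esub> m x)"
      using A closed[OF c] closed[OF d] by (intro M.finsum_addf) auto
    also have "(\<Oplus>\<^bsub>M\<^esub>x\<in>?A. c x \<odot>\<^bsub>M\<^esub> m x) = lin_comb R M m c"
      by (rule lin_comb_superset[OF A(1) _ A(2) sup(3)[OF c] m, symmetric]) auto
    also have "(\<Oplus>\<^bsub>M\<^esub>x\<in>?A. d x \<odot>\<^bsub>M\<^esub> m x) = lin_comb R M m d"
      by (rule lin_comb_superset[OF A(1) _ A(2) sup(3)[OF d] m, symmetric]) auto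
    finally show "lin_comb R M m (c \<oplus>\<^bsub>?F\<^esub> d) = lin_comb R M m c \<oplus>\<^bsub>M\<^esub> lin_comb R M m d" .
  next
    fix r c assume r: "r \<in> carrier R" and c: "c \<in> carrier ?F"
    let ?A = "{x. c x \<noteq> \<zero>}"
    have A: "finite ?A" "?A \<subseteq> X" using sup[OF c] by auto
    have rc: "r \<odot>\<^bsub>?F\<^esub> c \<in> carrier ?F" using r c by (rule F.smult_closed)
    have eq: "(r \<odot>\<^bsub>?F\<^esub> c) x = r \<otimes> c x" for x by (simp add: free_lmod_def)
    have "lin_comb R M m (r \<odot>\<^bsub>?F\<^esub> c) = (\<Oplus>\<^bsub>M\<^esub>x\<in>?A. (r \<odot>\<^bsub>?F\<^esub> c) x \<odot>\<^bsub>M\<^esub> m x)"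
      by (rule lin_comb_superset[OF A(1) _ A(2) sup(3)[OF rc] m]) (auto simp: eq r)
    also have "\<dots> = (\<Oplus>\<^bsub>M\<^esub>x\<in>?A. r \<odot>\<^bsub>M\<^esub> (c x \<odot>\<^bsub>M\<^esub> m x))"
    proof (rule M.finsum_cong')
      fix x assume "x \<in> ?A"
      with A have x: "x \<in> X" by auto
      have "c x \<in> carrier R" "m x \<in> carrier M"
        using sup(3)[OF c] m x by auto
      then show "(r \<odot>\<^bsub>?F\<^esub> c) x \<odot>\<^bsub>M\<^esub> m x = r \<odot>\<^bsub>M\<^esub> (c x \<odot>\<^bsub>M\<^esub> m x)"
        unfolding eq using r by (intro smult_assoc1)
    qed (use A closed[OF c] r in \<open>auto intro!: smult_closed[OF r]\<close>)
    also have "\<dots> = r \<odot>\<^bsub>M\<^esub> lin_comb R M m c"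
      unfolding lin_comb_def using A closed[OF c] r by (intro smult_finsum[symmetric]) auto
    finally show "lin_comb R M m (r \<odot>\<^bsub>?F\<^esub> c) = r \<odot>\<^bsub>M\<^esub> lin_comb R M m c" .
  qed
qed

lemma hom_lin_comb:
  assumes N: "left_module R N" and h: "h \<in> lmod_hom R M N"
    and c: "c \<in> carrier (free_lmod R X)" and m: "m \<in> X \<rightarrow> carrier M"
  shows "h (lin_comb R M m c) = lin_comb R N (\<lambda>x. h (m x)) c"
proof -
  interpret N: left_module R N by fact
  have hc: "h x \<in> carrier N" if "x \<in> carrier M" for x using h that by (auto simp: lmod_hom_def)
  have ha: "h (x \<oplus>\<^bsub>M\<^esub> y) = h x \<oplus>\<^bsub>N\<^esub> h y" if "x \<in> carrier M" "y \<in> carrier M" for x y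
    using h that by (auto simp: lmod_hom_def)
  have hs: "h (r \<odot>\<^bsub>M\<^esub> x) = r \<odot>\<^bsub>N\<^esub> h x" if "r \<in> carrier R" "x \<in> carrier M" for r x
    using h that by (auto simp: lmod_hom_def)
  have h0: "h \<zero>\<^bsub>M\<^esub> = \<zero>\<^bsub>N\<^esub>"
    using hs[of \<zero> "\<zero>\<^bsub>M\<^esub>"] by (simp add: smult_l_null N.smult_l_null hc)
  have sup: "finite {x. c x \<noteq> \<zero>}" "{x. c x \<noteq> \<zero>} \<subseteq> X" "\<And>x. c x \<in> carrier R"
    using c by (auto simp: free_lmod_def)
  have *: "h (\<Oplus>\<^bsub>M\<^esub>x\<in>A. c x \<odot>\<^bsub>M\<^esub> m x) = (\<Oplus>\<^bsub>N\<^esub>x\<in>A. c x \<odot>\<^bsub>N\<^esub> h (m x))"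
    if "finite A" "A \<subseteq> X" for A
    using that
  proof (induction A rule: finite_induct)
    case empty
    then show ?case by (simp add: h0)
  next
    case (insert a A)
    then have "m a \<in> carrier M" "m \<in> A \<rightarrow> carrier M" using m by auto
    then have cl: "c a \<odot>\<^bsub>M\<^esub> m a \<in> carrier M" "(\<lambda>x. c x \<odot>\<^bsub>M\<^esub> m x) \<in> A \<rightarrow> carrier M"
      "c a \<odot>\<^bsub>N\<^esub> h (m a) \<in> carrier N" "(\<lambda>x. c x \<odot>\<^bsub>N\<^esub> h (m x)) \<in> A \<rightarrow> carrier N"
      using sup(3) by (auto intro!: smult_closed N.smult_closed hc)
    have "h (\<Oplus>\<^bsub>M\<^esub>x\<in>insert a A. c x \<odot>\<^bsub>M\<^esub> m x) =
        h (c a \<odot>\<^bsub>M\<^esub> m a \<oplus>\<^bsub>M\<^esub> (\<Oplus>\<^bsub>M\<^esub>x\<in>A. c x \<odot>\<^bsub>M\<^esub> m x))"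
      using insert cl by (simp add: M.finsum_insert)
    also have "\<dots> = c a \<odot>\<^bsub>N\<^esub> h (m a) \<oplus>\<^bsub>N\<^esub> (\<Oplus>\<^bsub>N\<^esub>x\<in>A. c x \<odot>\<^bsub>N\<^esub> h (m x))"
      using insert cl \<open>m a \<in> carrier M\<close> sup(3) by (simp add: ha hs M.finsum_closed)
    also have "\<dots> = (\<Oplus>\<^bsub>N\<^esub>x\<in>insert a A. c x \<odot>\<^bsub>N\<^esub> h (m x))"
      using insert cl by (simp add: N.finsum_insert)
    finally show ?case .
  qed
  show ?thesis unfolding lin_comb_def by (rule *[OF sup(1,2)])
qed

end

lemma projective_lift:
  assumes P: "projective R P" and M: "left_module R M" and N: "left_module R N"
    and g: "g \<in> lmod_hom R M N" and surj: "g ` carrier M = carrier N"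
    and f: "f \<in> lmod_hom R P N"
  shows "\<exists>h\<in>lmod_hom R P M. \<forall>x\<in>carrier P. g (h x) = f x"
proof -
  interpret P: left_module R P using P by (simp add: projective_def)
  interpret M: left_module R M by fact
  interpret N: left_module R N by fact
  let ?X = "carrier P"
  let ?F = "free_lmod R ?X"
  define P' :: "('a, 'c) module" where "P' = module.truncate P"
  have P'_sel [simp]: "carrier P' = carrier P" "add P' = add P" "zero P' = zero P"
      "smult P' = smult P"
    by (simp_all add: P'_def module.truncate_def)
  have ag: "abelian_group P'"
    by (rule abelian_groupI) (auto simp: P.M.a_ac intro: P.M.l_neg bexI[of _ "\<ominus>\<^bsub>P\<^esub> _"])
  have P': "left_module R P'"
    by (intro left_module.intro left_module_axioms.intro ag P.R.ring_axioms)
      (auto simp: P.smult_closed P.smult_l_distr P.smult_r_distr P.smult_assoc1 P.smult_one)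
  interpret P': left_module R P' by fact
  let ?e = "lin_comb R P' (\<lambda>x. x)"
  have e: "?e \<in> lmod_hom R ?F P'" by (rule P'.lin_comb_hom) auto
  have "?e ` carrier ?F = carrier P'"
  proof
    show "?e ` carrier ?F \<subseteq> carrier P'" using e by (auto simp: lmod_hom_def)
    show "carrier P' \<subseteq> ?e ` carrier ?F"
    proof
      fix y assume y: "y \<in> carrier P'"
      let ?d = "\<lambda>x. if x = y then \<one>\<^bsub>R\<^esub> else \<zero>\<^bsub>R\<^esub>"
      have d: "?d \<in> carrier ?F"
        using y by (auto simp: free_lmod_def intro: finite_subset[of _ "{y}"])
      have "?e ?d = (\<Oplus>\<^bsub>P'\<^esub>x\<in>{y}. ?d x \<odot>\<^bsub>P'\<^esub> x)"
        by (rule P'.lin_comb_superset[where X = ?X]) (use y in auto)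
      also have "\<dots> = y" using y P'.smult_one[OF y] by (simp add: P'.M.finsum_insert)
      finally show "y \<in> ?e ` carrier ?F" using d by (metis image_eqI)
    qed
  qed
  moreover have "(\<lambda>x. x) \<in> lmod_hom R P P'" by (auto simp: lmod_hom_def)
  ultimately obtain s where s: "s \<in> lmod_hom R P ?F" "\<And>y. y \<in> carrier P \<Longrightarrow> ?e (s y) = y"
    using P free_lmod_left_module[OF P.R.ring_axioms, of ?X] P' e
    unfolding projective_def by blast
  have "\<forall>x\<in>carrier P. \<exists>y\<in>carrier M. g y = f x"
    using f surj by (auto simp: lmod_hom_def image_iff) (metis PiE imageE)
  then obtain m where m: "\<And>x. x \<in> carrier P \<Longrightarrow> m x \<in> carrier M"
      "\<And>x. x \<in> carrier P \<Longrightarrow> g (m x) = f x" by metis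
  let ?k = "lin_comb R M m"
  have k: "?k \<in> lmod_hom R ?F M" by (rule M.lin_comb_hom) (use m in auto)
  have f': "f \<in> lmod_hom R P' N" using f by (simp add: lmod_hom_def)
  show ?thesis
  proof (intro bexI ballI)
    show "(\<lambda>x. ?k (s x)) \<in> lmod_hom R P M"
      using s(1) k by (auto simp: lmod_hom_def Pi_iff)
    fix y assume y: "y \<in> carrier P"
    then have sy: "s y \<in> carrier ?F" using s(1) by (auto simp: lmod_hom_def)
    have supp: "{x. s y x \<noteq> \<zero>\<^bsub>R\<^esub>} \<subseteq> ?X" "range (s y) \<subseteq> carrier R" using sy by (auto simp: free_lmod_def)
    have fc: "f x \<in> carrier N" if "x \<in> carrier P" for x using f that by (auto simp: lmod_hom_def)
    have "g (?k (s y)) = lin_comb R N (\<lambda>x. g (m x)) (s y)"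
      by (rule M.hom_lin_comb[OF N g sy]) (use m in auto)
    also have "\<dots> = lin_comb R N f (s y)"
      unfolding lin_comb_def using supp m(2) fc
      by (intro N.M.finsum_cong') (auto intro!: N.smult_closed simp: subset_iff)
    also have "\<dots> = f (?e (s y))"
      by (rule P'.hom_lin_comb[OF N f' sy, symmetric]) auto
    also have "\<dots> = f y" using s(2) y by simp
    finally show "g (?k (s y)) = f y" .
  qed
qed

definition superfluous ::
    "('r, 'n) ring_scheme \<Rightarrow> ('r, 'p, 'm) module_scheme \<Rightarrow> 'p set \<Rightarrow> bool"
  where "superfluous R P K \<longleftrightarrow> submodule K R P \<and>
    (\<forall>N. submodule N R P \<longrightarrow> K <+>\<^bsub>P\<^esub> N = carrier P \<longrightarrow> N = carrier P)"

definition projective_cover :: "('r, 'n) ring_scheme \<Rightarrow> ('r, 'a, 'm) module_scheme \<Rightarrow>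
    ('r, 'p, 'o) module_scheme \<Rightarrow> ('p \<Rightarrow> 'a) \<Rightarrow> bool"
  where "projective_cover R M P \<pi> \<longleftrightarrow> left_module R M \<and> projective R P \<and>
    \<pi> \<in> lmod_hom R P M \<and> \<pi> ` carrier P = carrier M \<and> superfluous R P (a_kernel P M \<pi>)"

text \<open>Extension of scalars \<open>A \<otimes>\<^sub>R N\<close> along a ring homomorphism \<open>\<iota> : R \<rightarrow> A\<close>, where \<open>R\<close> acts on \<open>A\<close>
  from the right through \<open>\<iota>\<close>: the free abelian group on \<open>A \<times> N\<close> modulo the usual relations, with
  \<open>a (b \<otimes> n) = (a b) \<otimes> n\<close>.\<close>

definition tensor_relations :: "('r, 'n) ring_scheme \<Rightarrow> ('a, 'm) ring_scheme \<Rightarrow> ('r \<Rightarrow> 'a) \<Rightarrow>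
    ('r, 'v, 'o) module_scheme \<Rightarrow> ('a \<times> 'v \<Rightarrow>\<^sub>0 int) set"
  where "tensor_relations R A \<iota> N =
    {frag_of (a \<oplus>\<^bsub>A\<^esub> b, n) - frag_of (a, n) - frag_of (b, n) | a b n.
       a \<in> carrier A \<and> b \<in> carrier A \<and> n \<in> carrier N} \<union>
    {frag_of (a, n \<oplus>\<^bsub>N\<^esub> m) - frag_of (a, n) - frag_of (a, m) | a n m.
       a \<in> carrier A \<and> n \<in> carrier N \<and> m \<in> carrier N} \<union>
    {frag_of (a \<otimes>\<^bsub>A\<^esub> \<iota> r, n) - frag_of (a, r \<odot>\<^bsub>N\<^esub> n) | a r n.
       a \<in> carrier A \<and> r \<in> carrier R \<and> n \<in> carrier N}"

definition extension_of_scalars :: "('r, 'n) ring_scheme \<Rightarrow> ('a, 'm) ring_scheme \<Rightarrow>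
    ('r \<Rightarrow> 'a) \<Rightarrow> ('r, 'v, 'o) module_scheme \<Rightarrow> ('a, ('a \<times> 'v \<Rightarrow>\<^sub>0 int) set) module"
  where "extension_of_scalars R A \<iota> N =
    (let G = free_Abelian_group (carrier A \<times> carrier N);
         K = generate G (tensor_relations R A \<iota> N);
         Q = G Mod K
     in \<lparr>carrier = carrier Q, monoid.mult = undefined, one = undefined,
         zero = \<one>\<^bsub>Q\<^esub>, add = (\<otimes>\<^bsub>Q\<^esub>),
         smult = (\<lambda>a X. THE Y. \<exists>c\<in>carrier G. X = K #>\<^bsub>G\<^esub> c \<and>
           Y = K #>\<^bsub>G\<^esub> frag_extend (\<lambda>(b, n). frag_of (a \<otimes>\<^bsub>A\<^esub> b, n)) c)\<rparr>)"


section \<open>Enveloping algebras\<close>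

text \<open>The free associative unital algebra on \<open>X\<close>: finitely supported functions on words in \<open>X\<close>
  with the convolution product.\<close>

definition free_algebra :: "('k, 'n) ring_scheme \<Rightarrow> 'l set \<Rightarrow> ('l list \<Rightarrow> 'k) ring"
  where "free_algebra F X =
    \<lparr>carrier = {f. range f \<subseteq> carrier F \<and> finite {w. f w \<noteq> \<zero>\<^bsub>F\<^esub>} \<and> {w. f w \<noteq> \<zero>\<^bsub>F\<^esub>} \<subseteq> lists X},
     monoid.mult = (\<lambda>f g w. \<Oplus>\<^bsub>F\<^esub>i\<in>{..length w}. f (take i w) \<otimes>\<^bsub>F\<^esub> g (drop i w)),
     one = (\<lambda>w. if w = [] then \<one>\<^bsub>F\<^esub> else \<zero>\<^bsub>F\<^esub>),
     zero = (\<lambda>w. \<zero>\<^bsub>F\<^esub>),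
     add = (\<lambda>f g w. f w \<oplus>\<^bsub>F\<^esub> g w)\<rparr>"

definition free_scalar :: "('k, 'n) ring_scheme \<Rightarrow> 'k \<Rightarrow> 'l list \<Rightarrow> 'k"
  where "free_scalar F c = (\<lambda>w. if w = [] then c else \<zero>\<^bsub>F\<^esub>)"

definition free_gen :: "('k, 'n) ring_scheme \<Rightarrow> 'l \<Rightarrow> 'l list \<Rightarrow> 'k"
  where "free_gen F x = (\<lambda>w. if w = [x] then \<one>\<^bsub>F\<^esub> else \<zero>\<^bsub>F\<^esub>)"

text \<open>The first two families of relations turn the free algebra on the set \<open>L\<close> into the tensor
  algebra of the vector space \<open>L\<close>.\<close>

definition env_ideal ::
    "('k, 'n) ring_scheme \<Rightarrow> ('k, 'l, 'm) rlie_scheme \<Rightarrow> ('l list \<Rightarrow> 'k) set"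
  where "env_ideal F L = (let A = free_algebra F (carrier L); e = free_gen F in genideal A
    ({e (x \<oplus>\<^bsub>L\<^esub> y) \<ominus>\<^bsub>A\<^esub> (e x \<oplus>\<^bsub>A\<^esub> e y) | x y. x \<in> carrier L \<and> y \<in> carrier L} \<union>
     {e (c \<odot>\<^bsub>L\<^esub> x) \<ominus>\<^bsub>A\<^esub> free_scalar F c \<otimes>\<^bsub>A\<^esub> e x | c x. c \<in> carrier F \<and> x \<in> carrier L} \<union>
     {(e x \<otimes>\<^bsub>A\<^esub> e y \<ominus>\<^bsub>A\<^esub> e y \<otimes>\<^bsub>A\<^esub> e x) \<ominus>\<^bsub>A\<^esub> e (lie_bracket L x y) | x y.
        x \<in> carrier L \<and> y \<in> carrier L}))"

definition univ_env ::
    "('k, 'n) ring_scheme \<Rightarrow> ('k, 'l, 'm) rlie_scheme \<Rightarrow> ('l list \<Rightarrow> 'k) set ring"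
  where "univ_env F L = free_algebra F (carrier L) Quot env_ideal F L"

definition env_class :: "('k, 'n) ring_scheme \<Rightarrow> ('k, 'l, 'm) rlie_scheme \<Rightarrow>
    ('l list \<Rightarrow> 'k) \<Rightarrow> ('l list \<Rightarrow> 'k) set"
  where "env_class F L f = env_ideal F L +>\<^bsub>free_algebra F (carrier L)\<^esub> f"

definition red_env_ideal :: "nat \<Rightarrow> ('k, 'n) ring_scheme \<Rightarrow> ('k, 'l, 'm) rlie_scheme \<Rightarrow>
    ('l \<Rightarrow> 'k) \<Rightarrow> ('l list \<Rightarrow> 'k) set set"
  where "red_env_ideal p F L \<chi> = (let U = univ_env F L; e = (\<lambda>x. env_class F L (free_gen F x))
    in genideal U
      {(e x [^]\<^bsub>U\<^esub> p \<ominus>\<^bsub>U\<^esub> e (pmap L x)) \<ominus>\<^bsub>U\<^esub> env_class F L (free_scalar F (\<chi> x [^]\<^bsub>F\<^esub> p)) | x.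
         x \<in> carrier L})"

definition red_env :: "nat \<Rightarrow> ('k, 'n) ring_scheme \<Rightarrow> ('k, 'l, 'm) rlie_scheme \<Rightarrow>
    ('l \<Rightarrow> 'k) \<Rightarrow> ('l list \<Rightarrow> 'k) set set ring"
  where "red_env p F L \<chi> = univ_env F L Quot red_env_ideal p F L \<chi>"

text \<open>The image in \<open>u(L,\<chi>)\<close> of an element of the free algebra. Maps out of \<open>u(L,\<chi>)\<close> are defined
  below on such representatives.\<close>

definition red_class :: "nat \<Rightarrow> ('k, 'n) ring_scheme \<Rightarrow> ('k, 'l, 'm) rlie_scheme \<Rightarrow>
    ('l \<Rightarrow> 'k) \<Rightarrow> ('l list \<Rightarrow> 'k) \<Rightarrow> ('l list \<Rightarrow> 'k) set set"
  where "red_class p F L \<chi> f = red_env_ideal p F L \<chi> +>\<^bsub>univ_env F L\<^esub> env_class F L f"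


section \<open>Modules with \<open>p\<close>-character \<open>\<chi>\<close> and \<open>u(L,\<chi>)\<close>-modules\<close>

definition word_action :: "('k, 'n) ring_scheme \<Rightarrow> ('k, 'l, 'v, 'w) lie_mod_scheme \<Rightarrow>
    ('l list \<Rightarrow> 'k) \<Rightarrow> 'v \<Rightarrow> 'v"
  where "word_action F V f v =
    (\<Oplus>\<^bsub>V\<^esub>w\<in>{w. f w \<noteq> \<zero>\<^bsub>F\<^esub>}. f w \<odot>\<^bsub>V\<^esub> foldr (act V) w v)"

text \<open>The \<open>u(L,\<chi>)\<close>-module given by an \<open>L\<close>-module with \<open>p\<close>-character \<open>\<chi>\<close>, and conversely the
  \<open>L\<close>-module underlying a \<open>u(L,\<chi>)\<close>-module.\<close>

definition to_red_env_module :: "nat \<Rightarrow> ('k, 'n) ring_scheme \<Rightarrow> ('k, 'l, 'm) rlie_scheme \<Rightarrow>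
    ('l \<Rightarrow> 'k) \<Rightarrow> ('k, 'l, 'v, 'w) lie_mod_scheme \<Rightarrow> (('l list \<Rightarrow> 'k) set set, 'v) module"
  where "to_red_env_module p F L \<chi> V =
    \<lparr>carrier = carrier V, monoid.mult = (\<otimes>\<^bsub>V\<^esub>), one = \<one>\<^bsub>V\<^esub>, zero = \<zero>\<^bsub>V\<^esub>, add = (\<oplus>\<^bsub>V\<^esub>),
     smult = (\<lambda>a v. THE w. \<exists>f\<in>carrier (free_algebra F (carrier L)).
       a = red_class p F L \<chi> f \<and> w = word_action F V f v)\<rparr>"

definition to_lie_module :: "nat \<Rightarrow> ('k, 'n) ring_scheme \<Rightarrow> ('k, 'l, 'm) rlie_scheme \<Rightarrow>
    ('l \<Rightarrow> 'k) \<Rightarrow> (('l list \<Rightarrow> 'k) set set, 'v, 'w) module_scheme \<Rightarrow> ('k, 'l, 'v) lie_mod"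
  where "to_lie_module p F L \<chi> M =
    \<lparr>carrier = carrier M, monoid.mult = (\<otimes>\<^bsub>M\<^esub>), one = \<one>\<^bsub>M\<^esub>, zero = \<zero>\<^bsub>M\<^esub>, add = (\<oplus>\<^bsub>M\<^esub>),
     smult = (\<lambda>c m. red_class p F L \<chi> (free_scalar F c) \<odot>\<^bsub>M\<^esub> m),
     act = (\<lambda>x m. red_class p F L \<chi> (free_gen F x) \<odot>\<^bsub>M\<^esub> m)\<rparr>"

text \<open>The canonical homomorphism \<open>u(H,\<chi>|\<^sub>H) \<rightarrow> u(L,\<chi>)\<close>.\<close>

definition red_env_map :: "nat \<Rightarrow> ('k, 'n) ring_scheme \<Rightarrow> ('k, 'l, 'm) rlie_scheme \<Rightarrow>
    ('l \<Rightarrow> 'k) \<Rightarrow> 'l set \<Rightarrow> ('l list \<Rightarrow> 'k) set set \<Rightarrow> ('l list \<Rightarrow> 'k) set set"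
  where "red_env_map p F L \<chi> H a = (THE b. \<exists>f\<in>carrier (free_algebra F H).
    a = red_class p F (sub_rlie L H) (restrict \<chi> H) f \<and> b = red_class p F L \<chi> f)"

definition induced :: "nat \<Rightarrow> ('k, 'n) ring_scheme \<Rightarrow> ('k, 'l, 'm) rlie_scheme \<Rightarrow>
    ('l \<Rightarrow> 'k) \<Rightarrow> 'l set \<Rightarrow> ('k, 'l, 'v, 'w) lie_mod_scheme \<Rightarrow>
    (('l list \<Rightarrow> 'k) set set, (('l list \<Rightarrow> 'k) set set \<times> 'v \<Rightarrow>\<^sub>0 int) set) module"
  where "induced p F L \<chi> H V =
    extension_of_scalars (red_env p F (sub_rlie L H) (restrict \<chi> H)) (red_env p F L \<chi>)
      (red_env_map p F L \<chi> H) (to_red_env_module p F (sub_rlie L H) (restrict \<chi> H) V)"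

end

theory Submission
  imports Defs
begin

text \<open>Twisting by \<open>S\<close> reduces the matter to trivial \<open>p\<close>-character and trivial \<open>S\<close>. Write
  \<open>I = Ind\<^sub>T\<^sup>L(S)\<close>, with generator \<open>i\<close> and projection \<open>\<epsilon> : I \<rightarrow> S\<close>. Maps \<open>I \<rightarrow> M\<close> are vectors of
  \<open>M\<close> fixed by \<open>T\<close>, and since elements of \<open>T\<close> are semisimple, fixed vectors lift along
  epimorphisms; so every epimorphism \<open>P \<rightarrow> I\<close> splits. It remains to see that \<open>ker \<epsilon>\<close> is superfluous, and
  then \<open>I\<close> is a projective cover of \<open>S\<close> as well. As \<open>I\<close> is generated by a vector fixed by \<open>T\<close>, so is each
  of its simple quotients, and for solvable \<open>L\<close> and maximal \<open>T\<close> a simple module of trivial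
  \<open>p\<close>-character with a nonzero vector fixed by \<open>T\<close> is trivial. A quotient of \<open>I\<close> on which \<open>L\<close> acts
  trivially is spanned by the image of \<open>i\<close>, so \<open>ker \<epsilon>\<close> is the only maximal submodule.\<close>

section \<open>Subspaces of finite-dimensional spaces\<close>

text \<open>The field is an arbitrary one of characteristic p, so the elements of \<open>T\<close>
  cannot be diagonalized. Semisimplicity is used as a linear relation: t is a combination of the
  iterates t^[p]^j with j >= 1. In trivial p-character t^[p] acts as the p-th power of t, and the
  relation becomes a polynomial identity for the operator t; this is why the twist is needed before
  fixed vectors can be lifted. The twist takes place inside u(L,\<chi>): each generator x is
  replaced by x - lam(x), where lam is the character of \<open>S\<close>. Scalars are central and
  the Frobenius identity holds, so the shifted generators satisfy the relations for p-character 0.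

  No basis of u(L,\<chi>) is computed. The induced module is known through its generator and its
  universal property, and that it is nonzero is seen from the map onto \<open>S\<close>. Neither it
  nor \<open>P\<close> is known to be of finite dimension; a maximal submodule therefore comes from
  Zorn's lemma, and simple quotients are replaced by statements modulo a submodule.\<close>

definition lin_span :: "('k, 'n) ring_scheme \<Rightarrow> ('k, 'v, 'm) module_scheme \<Rightarrow> 'v set \<Rightarrow> 'v set"
  where "lin_span F V X = \<Inter>{N. submodule N F V \<and> X \<subseteq> N}"

locale vspace = field F + module F V
  for F :: "('k, 'n) ring_scheme" (structure) and V :: "('k, 'v, 'm) module_scheme" (structure)
begin

lemma submodule_zero: "submodule N F V \<Longrightarrow> \<zero>\<^bsub>V\<^esub> \<in> N"
  using subgroup.one_closed[OF submodule.axioms(1)] by force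

lemma submodule_minus: "\<lbrakk>submodule N F V; x \<in> N; y \<in> N\<rbrakk> \<Longrightarrow> x \<ominus>\<^bsub>V\<^esub> y \<in> N"
  using submoduleE(3,5) by (simp add: a_minus_def)

lemma submodule_carrier: "\<lbrakk>submodule N F V; x \<in> N\<rbrakk> \<Longrightarrow> x \<in> carrier V"
  using submoduleE(1) by blast

lemma submodule_finsum:
  assumes N: "submodule N F V" and f: "\<And>i. i \<in> I \<Longrightarrow> f i \<in> N"
  shows "(\<Oplus>\<^bsub>V\<^esub>i\<in>I. f i) \<in> N"
proof (cases "finite I")
  case True
  then show ?thesis using f
  proof (induction I rule: finite_induct)
    case empty then show ?case by (simp add: submodule_zero[OF N])
  next
    case (insert a I)
    then have "(\<lambda>i. f i) \<in> I \<rightarrow> carrier V" "f a \<in> carrier V"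
      using submodule_carrier[OF N] by auto
    with insert show ?case using submoduleE(5)[OF N] by simp
  qed
qed (simp add: submodule_zero[OF N] finsum_infinite)

lemma diff_eq_zero_iff:
  assumes "x \<in> carrier V" "y \<in> carrier V"
  shows "x \<ominus>\<^bsub>V\<^esub> y = \<zero>\<^bsub>V\<^esub> \<longleftrightarrow> x = y"
proof
  assume "x \<ominus>\<^bsub>V\<^esub> y = \<zero>\<^bsub>V\<^esub>"
  then have "x \<ominus>\<^bsub>V\<^esub> y \<oplus>\<^bsub>V\<^esub> y = y" using assms by simp
  then show "x = y" using assms by (simp add: a_minus_def M.a_assoc M.l_neg)
qed (use assms in \<open>simp add: a_minus_def M.r_neg\<close>)

lemma submodule_lin_span:
  assumes X: "X \<subseteq> carrier V"
  shows "submodule (lin_span F V X) F V"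
proof (rule submoduleI)
  show "lin_span F V X \<subseteq> carrier V" using X carrier_is_submodule by (auto simp: lin_span_def)
qed (auto simp: lin_span_def submodule_zero submoduleE)

lemma lin_span_superset: "X \<subseteq> lin_span F V X"
  by (auto simp: lin_span_def)

lemma lin_span_least: "\<lbrakk>submodule N F V; X \<subseteq> N\<rbrakk> \<Longrightarrow> lin_span F V X \<subseteq> N"
  by (auto simp: lin_span_def)

lemma lin_span_mono: "X \<subseteq> Y \<Longrightarrow> lin_span F V X \<subseteq> lin_span F V Y"
  by (auto simp: lin_span_def)

lemma lin_span_subset: "\<lbrakk>Y \<subseteq> carrier V; X \<subseteq> lin_span F V Y\<rbrakk> \<Longrightarrow> lin_span F V X \<subseteq> lin_span F V Y"
  by (simp add: lin_span_least submodule_lin_span)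

text \<open>The sums of this form make up a submodule containing \<open>insert x X\<close>, so the
  decomposition follows from the span being the least one.\<close>

lemma lin_span_insert:
  assumes X: "X \<subseteq> carrier V" and x: "x \<in> carrier V" and y: "y \<in> lin_span F V (insert x X)"
  obtains a z where "a \<in> carrier F" "z \<in> lin_span F V X" "y = a \<odot>\<^bsub>V\<^esub> x \<oplus>\<^bsub>V\<^esub> z"
proof -
  note S = submodule_lin_span[OF X]
  let ?N = "{a \<odot>\<^bsub>V\<^esub> x \<oplus>\<^bsub>V\<^esub> z | a z. a \<in> carrier F \<and> z \<in> lin_span F V X}"
  note c = submodule_carrier[OF S]
  have "submodule ?N F V"
  proof (rule submoduleI)
    show "?N \<subseteq> carrier V" using x c by auto
    show "\<zero>\<^bsub>V\<^esub> \<in> ?N" using x submodule_zero[OF S] c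
      by (auto intro!: exI[of _ "\<zero>"] exI[of _ "\<zero>\<^bsub>V\<^esub>"])
  next
    fix y assume "y \<in> ?N"
    then obtain a z where a: "a \<in> carrier F" and z: "z \<in> lin_span F V X"
      and y: "y = a \<odot>\<^bsub>V\<^esub> x \<oplus>\<^bsub>V\<^esub> z" by blast
    have "\<ominus>\<^bsub>V\<^esub> y = (\<ominus> a) \<odot>\<^bsub>V\<^esub> x \<oplus>\<^bsub>V\<^esub> (\<ominus>\<^bsub>V\<^esub> z)"
      using a x c[OF z] by (simp add: y smult_l_minus M.minus_add)
    then show "\<ominus>\<^bsub>V\<^esub> y \<in> ?N" using a submoduleE(3)[OF S z] by blast
  next
    fix y y' assume "y \<in> ?N" "y' \<in> ?N"
    then obtain a z a' z' where a: "a \<in> carrier F" "a' \<in> carrier F"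
      and z: "z \<in> lin_span F V X" "z' \<in> lin_span F V X"
      and y: "y = a \<odot>\<^bsub>V\<^esub> x \<oplus>\<^bsub>V\<^esub> z" "y' = a' \<odot>\<^bsub>V\<^esub> x \<oplus>\<^bsub>V\<^esub> z'" by blast
    have "y \<oplus>\<^bsub>V\<^esub> y' = (a \<oplus> a') \<odot>\<^bsub>V\<^esub> x \<oplus>\<^bsub>V\<^esub> (z \<oplus>\<^bsub>V\<^esub> z')"
      using a x c[OF z(1)] c[OF z(2)] by (simp add: y smult_l_distr M.a_ac)
    then show "y \<oplus>\<^bsub>V\<^esub> y' \<in> ?N" using a submoduleE(5)[OF S z] by blast
  next
    fix b y assume b: "b \<in> carrier F" and "y \<in> ?N"
    then obtain a z where a: "a \<in> carrier F" and z: "z \<in> lin_span F V X"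
      and y: "y = a \<odot>\<^bsub>V\<^esub> x \<oplus>\<^bsub>V\<^esub> z" by blast
    have "b \<odot>\<^bsub>V\<^esub> y = (b \<otimes> a) \<odot>\<^bsub>V\<^esub> x \<oplus>\<^bsub>V\<^esub> (b \<odot>\<^bsub>V\<^esub> z)"
      using a b x c[OF z] by (simp add: y smult_r_distr smult_assoc1)
    then show "b \<odot>\<^bsub>V\<^esub> y \<in> ?N" using a b submoduleE(4)[OF S b z] by blast
  qed
  moreover have "insert x X \<subseteq> ?N"
  proof -
    have "x = \<one> \<odot>\<^bsub>V\<^esub> x \<oplus>\<^bsub>V\<^esub> \<zero>\<^bsub>V\<^esub>" using x by simp
    then have "x \<in> ?N" using submodule_zero[OF S] by blast
    moreover have "z \<in> ?N" if "z \<in> X" for z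
    proof -
      have "z = \<zero> \<odot>\<^bsub>V\<^esub> x \<oplus>\<^bsub>V\<^esub> z" using x that X by auto
      then show ?thesis using that lin_span_superset by blast
    qed
    ultimately show ?thesis by blast
  qed
  ultimately have "y \<in> ?N" using y lin_span_least by blast
  then show ?thesis using that by blast
qed

text \<open>In y = a x + z the scalar a cannot vanish, since y = z would then lie in the span of
  \<open>X\<close>; dividing by a solves for x.\<close>

lemma lin_span_exchange:
  assumes X: "X \<subseteq> carrier V" and x: "x \<in> carrier V"
    and y: "y \<in> lin_span F V (insert x X)" "y \<notin> lin_span F V X"
  shows "x \<in> lin_span F V (insert y X)"
proof -
  obtain a z where a: "a \<in> carrier F" and z: "z \<in> lin_span F V X" and eq: "y = a \<odot>\<^bsub>V\<^esub> x \<oplus>\<^bsub>V\<^esub> z"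
    using lin_span_insert[OF X x y(1)] .
  have zc: "z \<in> carrier V" using submodule_carrier[OF submodule_lin_span[OF X] z] .
  have yc: "y \<in> carrier V" using eq a x zc by simp
  have "a \<noteq> \<zero>" using eq y(2) z x zc by auto
  then have u: "a \<in> Units F" using a field_Units by auto
  have S: "submodule (lin_span F V (insert y X)) F V" using X yc by (simp add: submodule_lin_span)
  have "inv a \<odot>\<^bsub>V\<^esub> (y \<ominus>\<^bsub>V\<^esub> z) = inv a \<odot>\<^bsub>V\<^esub> (a \<odot>\<^bsub>V\<^esub> x)"
    using a x zc by (simp add: eq a_minus_def M.a_assoc M.r_neg)
  also have "\<dots> = x" using u a x by (simp flip: smult_assoc1)
  finally have "x = inv a \<odot>\<^bsub>V\<^esub> (y \<ominus>\<^bsub>V\<^esub> z)" ..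
  moreover have "y \<in> lin_span F V (insert y X)" "z \<in> lin_span F V (insert y X)"
    using lin_span_superset[of "insert y X"] lin_span_mono[of X "insert y X"] z by auto
  ultimately show ?thesis
    using submoduleE(4)[OF S] submodule_minus[OF S] u by (metis Units_inv_closed)
qed

text \<open>Independence is read along the sequence: each \<open>y i\<close> avoids the span of its
  predecessors. \<open>Z\<close> is the part of \<open>X\<close> that survives k exchanges, so k
  independent vectors use up k elements of \<open>X\<close>.\<close>

lemma steinitz_exchange:
  assumes X: "finite X" "X \<subseteq> carrier V"
    and y: "\<And>i. i < k \<Longrightarrow> y i \<in> lin_span F V X"
      "\<And>i. i < k \<Longrightarrow> y i \<notin> lin_span F V (y ` {..<i})"
  shows "\<exists>Z\<subseteq>X. card Z + k \<le> card X \<and> X \<subseteq> lin_span F V (y ` {..<k} \<union> Z)"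
  using y
proof (induction k)
  case 0
  then show ?case using lin_span_superset[of X] by (intro exI[of _ X]) auto
next
  case (Suc k)
  then obtain Z where Z: "Z \<subseteq> X" "card Z + k \<le> card X" "X \<subseteq> lin_span F V (y ` {..<k} \<union> Z)"
    by (metis less_SucI)
  have yc: "y i \<in> carrier V" if "i < Suc k" for i
    using Suc.prems(1)[OF that] submodule_carrier[OF submodule_lin_span[OF X(2)]] by blast
  let ?Y = "y ` {..<k}"
  have Yc: "?Y \<subseteq> carrier V" using yc by auto
  have YW: "?Y \<union> W \<subseteq> carrier V" if "W \<subseteq> Z" for W using Yc that Z(1) X(2) by auto
  have "y k \<in> lin_span F V (?Y \<union> Z)"
    using Suc.prems(1)[of k] lin_span_subset[OF YW[OF order_refl] Z(3)] by auto
  then have ex: "\<exists>W. W \<subseteq> Z \<and> y k \<in> lin_span F V (?Y \<union> W)" by blast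
  have finZ: "finite Z" using Z(1) X(1) finite_subset by blast
  \<comment> \<open>\<open>W\<close> has least cardinality among the subsets of \<open>Z\<close>
    that span \<open>y k\<close> together with the earlier terms. It is nonempty by independence,
    and by minimality any of its elements can be traded for \<open>y k\<close>.\<close>
  obtain W where W: "W \<subseteq> Z" "y k \<in> lin_span F V (?Y \<union> W)"
    and min: "\<And>W'. W' \<subseteq> Z \<Longrightarrow> y k \<in> lin_span F V (?Y \<union> W') \<Longrightarrow> card W \<le> card W'"
    using ex_has_least_nat[where P = "\<lambda>W. W \<subseteq> Z \<and> y k \<in> lin_span F V (?Y \<union> W)" and m = card] ex by metis
  have "W \<noteq> {}" using W(2) Suc.prems(2)[of k] by auto
  then obtain w where w: "w \<in> W" by blast
  have "card (W - {w}) < card W" using w finZ W(1) by (meson card_Diff1_less finite_subset)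
  then have notin: "y k \<notin> lin_span F V (?Y \<union> (W - {w}))" using min[of "W - {w}"] W(1) by auto
  have eq: "insert w (?Y \<union> (W - {w})) = ?Y \<union> W" using w by auto
  have "w \<in> lin_span F V (insert (y k) (?Y \<union> (W - {w})))"
    by (rule lin_span_exchange) (use YW[OF W(1)] w notin W(2) eq in auto)
  moreover have "insert (y k) (?Y \<union> (W - {w})) \<subseteq> y ` {..<Suc k} \<union> (Z - {w})"
    using W(1) by (auto simp: lessThan_Suc)
  ultimately have w': "w \<in> lin_span F V (y ` {..<Suc k} \<union> (Z - {w}))"
    using lin_span_mono by blast
  have c: "y ` {..<Suc k} \<union> (Z - {w}) \<subseteq> carrier V" using yc Z(1) X(2) by auto
  have "?Y \<union> Z \<subseteq> lin_span F V (y ` {..<Suc k} \<union> (Z - {w}))"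
    using w' lin_span_superset[of "y ` {..<Suc k} \<union> (Z - {w})"] by auto
  then have "X \<subseteq> lin_span F V (y ` {..<Suc k} \<union> (Z - {w}))"
    using Z(3) lin_span_subset[OF c] by blast
  moreover have "card (Z - {w}) + Suc k \<le> card X"
    using Z(2) w W(1) finZ by (metis add_Suc_shift card_Suc_Diff1 subsetD)
  ultimately show ?case using Z(1) by (intro exI[of _ "Z - {w}"]) auto
qed

text \<open>Otherwise card X + 1 elements of \<open>X\<close> could be exchanged. Applied to the
  iterates of the p-map, this supplies a linear relation among them.\<close>

lemma sequence_dependent:
  assumes X: "finite X" "X \<subseteq> carrier V" and y: "\<And>i :: nat. y i \<in> lin_span F V X"
  shows "\<exists>n. y n \<in> lin_span F V (y ` {..<n})"
proof (rule ccontr)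
  assume "\<not> ?thesis"
  then have "\<exists>Z\<subseteq>X. card Z + Suc (card X) \<le> card X \<and> X \<subseteq> lin_span F V (y ` {..<Suc (card X)} \<union> Z)"
    by (intro steinitz_exchange X y) auto
  then show False by auto
qed

text \<open>An independent sequence of maximal length in \<open>N\<close> spans \<open>N\<close>;
  the exchange bound by card X makes a maximal length exist.\<close>

lemma submodule_finitely_spanned:
  assumes X: "finite X" "X \<subseteq> carrier V" and N: "submodule N F V" "N \<subseteq> lin_span F V X"
  obtains B where "finite B" "B \<subseteq> N" "N = lin_span F V B"
proof -
  define P where "P k \<longleftrightarrow> (\<exists>y. \<forall>i<k. y i \<in> N \<and> y i \<notin> lin_span F V (y ` {..<i}))" for k :: nat
  have bound: "k \<le> card X" if "P k" for k
  proof -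
    from that obtain y where "\<forall>i<k. y i \<in> N \<and> y i \<notin> lin_span F V (y ` {..<i})" unfolding P_def by blast
    then have "\<exists>Z\<subseteq>X. card Z + k \<le> card X \<and> X \<subseteq> lin_span F V (y ` {..<k} \<union> Z)"
      using N(2) by (intro steinitz_exchange X) auto
    then show ?thesis by auto
  qed
  have "P 0" by (simp add: P_def)
  then obtain k where k: "P k" "\<And>j. P j \<Longrightarrow> j \<le> k"
    using ex_has_greatest_nat[of P 0 id "Suc (card X)"] bound by (auto simp: less_Suc_eq_le)
  then obtain y where y: "\<And>i. i < k \<Longrightarrow> y i \<in> N" "\<And>i. i < k \<Longrightarrow> y i \<notin> lin_span F V (y ` {..<i})"
    unfolding P_def by blast
  have "N \<subseteq> lin_span F V (y ` {..<k})"
  proof (rule ccontr)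
    assume "\<not> ?thesis"
    then obtain z where z: "z \<in> N" "z \<notin> lin_span F V (y ` {..<k})" by blast
    let ?y = "y(k := z)"
    have im: "?y ` {..<i} = y ` {..<i}" if "i \<le> k" for i using that by (intro image_cong) auto
    have "?y i \<in> N \<and> ?y i \<notin> lin_span F V (?y ` {..<i})" if "i < Suc k" for i
      using y z im[of i] that by (cases "i = k") (auto simp del: fun_upd_image)
    then have "P (Suc k)" unfolding P_def by blast
    then show False using k(2) by fastforce
  qed
  moreover have "lin_span F V (y ` {..<k}) \<subseteq> N" using y(1) by (intro lin_span_least N) auto
  ultimately show ?thesis using that[of "y ` {..<k}"] y(1) by auto
qed

lemma finite_dim_spanned:
  assumes "finite_dim F V"
  obtains B where "finite B" "B \<subseteq> carrier V" "carrier V = lin_span F V B"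
proof -
  obtain B where B: "finite B" "B \<subseteq> carrier V"
    and ex: "\<And>v. v \<in> carrier V \<Longrightarrow> \<exists>c. c \<in> B \<rightarrow>\<^sub>E carrier F \<and> v = (\<Oplus>\<^bsub>V\<^esub>b\<in>B. c b \<odot>\<^bsub>V\<^esub> b)"
    using assms unfolding finite_dim_def has_dim_def fin_basis_def by (meson ex1_implies_ex)
  have "carrier V \<subseteq> lin_span F V B"
  proof
    fix v assume "v \<in> carrier V"
    then obtain c where c: "c \<in> B \<rightarrow>\<^sub>E carrier F" and v: "v = (\<Oplus>\<^bsub>V\<^esub>b\<in>B. c b \<odot>\<^bsub>V\<^esub> b)" using ex by blast
    have "c b \<odot>\<^bsub>V\<^esub> b \<in> lin_span F V B" if "b \<in> B" for b
      using submoduleE(4)[OF submodule_lin_span[OF B(2)]] lin_span_superset[of B] c that by auto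
    then show "v \<in> lin_span F V B"
      unfolding v by (intro submodule_finsum submodule_lin_span B)
  qed
  then show ?thesis using that B submoduleE(1)[OF submodule_lin_span[OF B(2)]] by blast
qed

end

section \<open>Tori\<close>

sublocale lie_algebra \<subseteq> vspace F L ..

context lie_algebra
begin

lemma bracket_zero_left [simp]: "x \<in> carrier L \<Longrightarrow> lie_bracket L \<zero>\<^bsub>L\<^esub> x = \<zero>\<^bsub>L\<^esub>"
  using bracket_smult_left[of \<zero> x x] bracket_closed by simp

lemma bracket_zero_right [simp]: "x \<in> carrier L \<Longrightarrow> lie_bracket L x \<zero>\<^bsub>L\<^esub> = \<zero>\<^bsub>L\<^esub>"
  using bracket_smult_right[of \<zero> x x] bracket_closed by simp

lemma bracket_antisym:
  assumes "x \<in> carrier L" "y \<in> carrier L"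
  shows "lie_bracket L x y = \<ominus>\<^bsub>L\<^esub> lie_bracket L y x"
proof -
  have "\<zero>\<^bsub>L\<^esub> = lie_bracket L (x \<oplus>\<^bsub>L\<^esub> y) (x \<oplus>\<^bsub>L\<^esub> y)" using assms by (simp add: bracket_self)
  also have "\<dots> = lie_bracket L x y \<oplus>\<^bsub>L\<^esub> lie_bracket L y x"
  proof -
    have "lie_bracket L (x \<oplus>\<^bsub>L\<^esub> y) (x \<oplus>\<^bsub>L\<^esub> y) = lie_bracket L x (x \<oplus>\<^bsub>L\<^esub> y) \<oplus>\<^bsub>L\<^esub> lie_bracket L y (x \<oplus>\<^bsub>L\<^esub> y)"
      using assms by (intro bracket_add_left) auto
    then show ?thesis using assms by (simp add: bracket_add_right bracket_self bracket_closed)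
  qed
  finally show ?thesis using assms by (metis M.add.inv_comm M.minus_equality bracket_closed M.minus_minus)
qed

lemma bracket_minus_right:
  assumes "x \<in> carrier L" "y \<in> carrier L"
  shows "lie_bracket L x (\<ominus>\<^bsub>L\<^esub> y) = \<ominus>\<^bsub>L\<^esub> lie_bracket L x y"
proof -
  have "lie_bracket L x ((\<ominus> \<one>) \<odot>\<^bsub>L\<^esub> y) = (\<ominus> \<one>) \<odot>\<^bsub>L\<^esub> lie_bracket L x y"
    using assms by (intro bracket_smult_right) auto
  then show ?thesis using assms by (simp add: smult_l_minus bracket_closed)
qed

text \<open>The Jacobi identity in its derivation form for ad x.\<close>

lemma bracket_jacobi_left:
  assumes "x \<in> carrier L" "y \<in> carrier L" "z \<in> carrier L"
  shows "lie_bracket L x (lie_bracket L y z) =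
    lie_bracket L (lie_bracket L x y) z \<oplus>\<^bsub>L\<^esub> lie_bracket L y (lie_bracket L x z)"
proof -
  have 1: "lie_bracket L z (lie_bracket L x y) = \<ominus>\<^bsub>L\<^esub> lie_bracket L (lie_bracket L x y) z"
    using assms bracket_closed by (metis bracket_antisym)
  have 2: "lie_bracket L y (lie_bracket L z x) = \<ominus>\<^bsub>L\<^esub> lie_bracket L y (lie_bracket L x z)"
    using assms bracket_closed by (metis bracket_antisym bracket_minus_right)
  let ?a = "lie_bracket L x (lie_bracket L y z)"
  let ?b = "lie_bracket L (lie_bracket L x y) z" and ?c = "lie_bracket L y (lie_bracket L x z)"
  have cl: "?a \<in> carrier L" "?b \<in> carrier L" "?c \<in> carrier L" using assms bracket_closed by auto
  have "?a \<oplus>\<^bsub>L\<^esub> \<ominus>\<^bsub>L\<^esub> (?b \<oplus>\<^bsub>L\<^esub> ?c) = \<zero>\<^bsub>L\<^esub>"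
    using jacobi[OF assms] cl by (simp add: 1 2 M.minus_add M.a_ac)
  then show ?thesis using cl by (metis M.minus_equality M.minus_minus M.a_inv_closed M.add.m_closed)
qed

lemma bracket_commute_zero:
  "\<lbrakk>x \<in> carrier L; y \<in> carrier L; lie_bracket L x y = \<zero>\<^bsub>L\<^esub>\<rbrakk> \<Longrightarrow> lie_bracket L y x = \<zero>\<^bsub>L\<^esub>"
  using bracket_antisym[of y x] by simp

lemma submodule_centralizer:
  assumes "X \<subseteq> carrier L"
  shows "submodule {y \<in> carrier L. \<forall>x\<in>X. lie_bracket L x y = \<zero>\<^bsub>L\<^esub>} F L"
  using assms
  by (intro submoduleI) (auto simp: bracket_minus_right bracket_add_right bracket_smult_right subset_iff)

lemma lin_span_commute:
  assumes X: "X \<subseteq> carrier L" and comm: "\<And>x y. \<lbrakk>x \<in> X; y \<in> X\<rbrakk> \<Longrightarrow> lie_bracket L x y = \<zero>\<^bsub>L\<^esub>"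
    and x: "x \<in> lin_span F L X" and y: "y \<in> lin_span F L X"
  shows "lie_bracket L x y = \<zero>\<^bsub>L\<^esub>"
proof -
  have c: "lin_span F L X \<subseteq> carrier L" using submoduleE(1)[OF submodule_lin_span[OF X]] .
  \<comment> \<open>Commutation passes from \<open>X\<close> to its span one argument at a time: on
    the right here, and on the left after the arguments are exchanged.\<close>
  have 1: "lin_span F L X \<subseteq> {y \<in> carrier L. \<forall>x\<in>X. lie_bracket L x y = \<zero>\<^bsub>L\<^esub>}"
    using X comm by (intro lin_span_least submodule_centralizer) auto
  have "lin_span F L X \<subseteq> {y \<in> carrier L. \<forall>x\<in>lin_span F L X. lie_bracket L x y = \<zero>\<^bsub>L\<^esub>}"
  proof (rule lin_span_least[OF submodule_centralizer[OF c]], intro subsetI CollectI conjI ballI)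
    show "x \<in> carrier L" if "x \<in> X" for x using that X by blast
    fix x y assume x: "x \<in> X" and y: "y \<in> lin_span F L X"
    show "lie_bracket L y x = \<zero>\<^bsub>L\<^esub>"
      by (rule bracket_commute_zero) (use x y 1 X in blast)+
  qed
  then show ?thesis using x y by blast
qed

end

section \<open>The p-map on commuting elements\<close>

context restricted_lie_algebra
begin

lemma p_gt_0: "0 < p" and p_ge_2: "2 \<le> p"
  using prime_p by (simp_all add: prime_gt_0_nat prime_ge_2_nat)

text \<open>A Bezout relation i a = p b + 1 turns i = 0 in the field into 1 = 0. Thus the inverse in
  \<open>jacobson_s\<close> is the inverse of a unit.\<close>

lemma of_nat_nonzero:
  assumes "0 < i" "i < p"
  shows "add_pow F i \<one> \<noteq> \<zero>"
proof
  assume z: "add_pow F i \<one> = \<zero>"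
  have "coprime i p" using assms prime_p
    by (metis coprime_commute nat_dvd_not_less prime_imp_coprime)
  then obtain a b where ab: "i * a = p * b + 1"
    using bezout_nat[of i p] assms by auto
  note A = group.is_monoid[OF abelian_group.a_group[OF ring.is_abelian_group[OF ring_axioms]]]
  have "add_pow F (i * a) \<one> = \<zero>" "add_pow F (p * b) \<one> = \<zero>"
    using z char_p monoid.nat_pow_pow[OF A, of \<one> i a] monoid.nat_pow_pow[OF A, of \<one> p b]
      monoid.nat_pow_one[OF A]
    by (simp_all add: add_pow_def)
  then show False using ab by (simp add: add_pow_def)
qed

text \<open>All brackets among x and y vanish, so every coefficient is zero once ad (t x + y) has
  been applied at all; it is applied p - 1 >= 1 times.\<close>

lemma jacobson_s_commute:
  assumes "x \<in> carrier L" "y \<in> carrier L" "lie_bracket L x y = \<zero>\<^bsub>L\<^esub>" "i \<in> {1..<p}"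
  shows "jacobson_s p F L i x y = \<zero>\<^bsub>L\<^esub>"
proof -
  have yx: "lie_bracket L y x = \<zero>\<^bsub>L\<^esub>" using assms bracket_commute_zero by blast
  have "ad_pow_coeff L x y (Suc n) j = \<zero>\<^bsub>L\<^esub>" for n j
    by (induction n arbitrary: j) (auto simp: assms bracket_self yx)
  then have "ad_pow_coeff L x y (p - 1) (i - 1) = \<zero>\<^bsub>L\<^esub>"
    using p_ge_2 by (metis Suc_diff_Suc Suc_le_lessD numeral_2_eq_2 One_nat_def)
  moreover have "inv (add_pow F i \<one>) \<in> carrier F"
    using assms(4) of_nat_nonzero[of i] by (simp add: field_Units)
  ultimately show ?thesis by (simp add: jacobson_s_def)
qed

lemma pmap_add_commute:
  assumes "x \<in> carrier L" "y \<in> carrier L" "lie_bracket L x y = \<zero>\<^bsub>L\<^esub>"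
  shows "pmap L (x \<oplus>\<^bsub>L\<^esub> y) = pmap L x \<oplus>\<^bsub>L\<^esub> pmap L y"
proof -
  have "(\<Oplus>\<^bsub>L\<^esub>i\<in>{1..<p}. jacobson_s p F L i x y) = \<zero>\<^bsub>L\<^esub>"
    using jacobson_s_commute[OF assms] by (intro M.add.finprod_one_eqI) auto
  then show ?thesis using assms by (simp add: pmap_add pmap_closed)
qed

lemma pmap_zero [simp]: "pmap L \<zero>\<^bsub>L\<^esub> = \<zero>\<^bsub>L\<^esub>"
  using pmap_smult[of \<zero> "\<zero>\<^bsub>L\<^esub>"] p_gt_0 by (simp add: pmap_closed nat_pow_zero)

lemma pmap_minus:
  assumes "x \<in> carrier L"
  shows "pmap L (\<ominus>\<^bsub>L\<^esub> x) = \<ominus>\<^bsub>L\<^esub> pmap L x"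
proof -
  have "lie_bracket L x (\<ominus>\<^bsub>L\<^esub> x) = \<zero>\<^bsub>L\<^esub>" using assms by (simp add: bracket_minus_right bracket_self)
  then have "pmap L x \<oplus>\<^bsub>L\<^esub> pmap L (\<ominus>\<^bsub>L\<^esub> x) = \<zero>\<^bsub>L\<^esub>"
    using pmap_add_commute[of x "\<ominus>\<^bsub>L\<^esub> x"] assms by (simp add: M.r_neg)
  then show ?thesis using assms by (metis M.add.inv_equality M.a_comm M.a_inv_closed pmap_closed)
qed

lemma pmap_iter_closed: "x \<in> carrier L \<Longrightarrow> (pmap L ^^ n) x \<in> carrier L"
  by (induction n) (auto simp: pmap_closed)

lemma bracket_iter_zero:
  "\<lbrakk>x \<in> carrier L; y \<in> carrier L; lie_bracket L x y = \<zero>\<^bsub>L\<^esub>; 0 < n\<rbrakk> \<Longrightarrow> (lie_bracket L x ^^ n) y = \<zero>\<^bsub>L\<^esub>"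
proof (induction n)
  case (Suc n) then show ?case by (cases n) auto
qed simp

lemma pmap_commute:
  assumes "x \<in> carrier L" "y \<in> carrier L" "lie_bracket L x y = \<zero>\<^bsub>L\<^esub>"
  shows "lie_bracket L ((pmap L ^^ n) x) y = \<zero>\<^bsub>L\<^esub>"
proof (induction n)
  case (Suc n)
  then show ?case using assms bracket_iter_zero[of "(pmap L ^^ n) x" y p] p_gt_0
    by (simp add: ad_pmap pmap_iter_closed)
qed (simp add: assms)

lemma pmap_iter_commute:
  assumes "x \<in> carrier L"
  shows "lie_bracket L ((pmap L ^^ i) x) ((pmap L ^^ j) x) = \<zero>\<^bsub>L\<^esub>"
  using assms by (intro pmap_commute pmap_iter_closed bracket_commute_zero[OF _ _ pmap_commute])
    (auto simp: bracket_self)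

text \<open>On the span of commuting elements the p-map is additive and semilinear with respect to a
  -> a^p. Hence the elements that it sends into the subspace \<open>N\<close> form a subspace, and
  checking \<open>X\<close> suffices.\<close>

lemma pmap_lin_span:
  assumes X: "X \<subseteq> carrier L" and comm: "\<And>x y. \<lbrakk>x \<in> X; y \<in> X\<rbrakk> \<Longrightarrow> lie_bracket L x y = \<zero>\<^bsub>L\<^esub>"
    and N: "submodule N F L" "pmap L ` X \<subseteq> N"
    and z: "z \<in> lin_span F L X"
  shows "pmap L z \<in> N"
proof -
  let ?S = "lin_span F L X"
  note S = submodule_lin_span[OF X]
  note c = submodule_carrier[OF S]
  have "submodule {z \<in> ?S. pmap L z \<in> N} F L"
  proof (rule submoduleI)
    fix a b assume "a \<in> {z \<in> ?S. pmap L z \<in> N}" "b \<in> {z \<in> ?S. pmap L z \<in> N}"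
    then show "a \<oplus>\<^bsub>L\<^esub> b \<in> {z \<in> ?S. pmap L z \<in> N}"
      using pmap_add_commute[of a b] lin_span_commute[OF X comm, of a b] c
        submoduleE(5)[OF S] submoduleE(5)[OF N(1)] by auto
  qed (use c submoduleE(3,4)[OF S] submodule_zero[OF S] submoduleE(3,4)[OF N(1)] submodule_zero[OF N(1)]
        in \<open>auto simp: pmap_minus pmap_smult\<close>)
  moreover have "X \<subseteq> {z \<in> ?S. pmap L z \<in> N}" using N(2) lin_span_superset by auto
  ultimately show ?thesis using z lin_span_least by blast
qed

lemma p_subalgebra_lin_span:
  assumes "X \<subseteq> carrier L" "\<And>x y. \<lbrakk>x \<in> X; y \<in> X\<rbrakk> \<Longrightarrow> lie_bracket L x y = \<zero>\<^bsub>L\<^esub>"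
    and "pmap L ` X \<subseteq> lin_span F L X"
  shows "p_subalgebra F L (lin_span F L X)"
  unfolding p_subalgebra_def
  using assms lin_span_commute[OF assms(1,2)] pmap_lin_span[OF assms(1,2) submodule_lin_span[OF assms(1)] assms(3)]
    submodule_zero[OF submodule_lin_span[OF assms(1)]] submodule_lin_span
  by simp

section \<open>Semisimple elements and maximal tori\<close>

lemma p_subalgebra_pmap_iter: "\<lbrakk>p_subalgebra F L H; x \<in> H\<rbrakk> \<Longrightarrow> (pmap L ^^ n) x \<in> H"
  by (induction n) (auto simp: p_subalgebra_def)

text \<open>The span of the iterates from j = 1 on is commutative and closed under the p-map, so it
  is the p-subalgebra generated by x^[p]. Semisimplicity thereby becomes a linear relation
  expressing x through its own p-powers, the form in which it is used below.\<close>

lemma semisimple_iff: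
  assumes x: "x \<in> carrier L"
  shows "lie_semisimple F L x \<longleftrightarrow> x \<in> lin_span F L ((\<lambda>j. (pmap L ^^ j) x) ` {1..})"
proof -
  let ?X = "(\<lambda>j. (pmap L ^^ j) x) ` {1..}"
  have X: "?X \<subseteq> carrier L" using pmap_iter_closed[OF x] by auto
  have "p_subalgebra F L (lin_span F L ?X)"
  proof (rule p_subalgebra_lin_span[OF X])
    have "pmap L ((pmap L ^^ j) x) \<in> ?X" for j
      using image_eqI[of _ "\<lambda>j. (pmap L ^^ j) x" "Suc j" "{1..}"] by auto
    then show "pmap L ` ?X \<subseteq> lin_span F L ?X" using lin_span_superset[of ?X] by blast
  qed (use pmap_iter_commute[OF x] in auto)
  moreover have "pmap L x \<in> lin_span F L ?X"
    using lin_span_superset[of ?X] image_eqI[of "pmap L x" "\<lambda>j. (pmap L ^^ j) x" 1 "{1..}"] by auto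
  moreover have XH: "?X \<subseteq> H" if H: "p_subalgebra F L H" "pmap L x \<in> H" for H
  proof
    fix y assume "y \<in> ?X"
    then obtain k where "y = (pmap L ^^ Suc k) x" by (auto simp del: funpow.simps dest!: Suc_le_D)
    then have "y = (pmap L ^^ k) (pmap L x)" by (simp add: funpow_swap1)
    then show "y \<in> H" using p_subalgebra_pmap_iter[OF H] by simp
  qed
  moreover have "lin_span F L ?X \<subseteq> H" if "p_subalgebra F L H" "pmap L x \<in> H" for H
    using that XH[OF that] by (intro lin_span_least) (simp_all add: p_subalgebra_def)
  ultimately have "p_subalgebra_generated F L {pmap L x} = lin_span F L ?X"
    unfolding p_subalgebra_generated_def by (intro equalityI Inter_lower Inter_greatest) auto
  then show ?thesis by (simp add: lie_semisimple_def)
qed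

text \<open>Since \<open>pmap\<close> is semilinear on \<open>A\<close>, a spanning image forces it to be injective on spans,
  so the first linear relation among the iterates of an element has a nonzero lowest coefficient.\<close>

lemma torus_if_spanned_by_pmap:
  assumes fd: "finite B" "B \<subseteq> carrier L" "carrier L = lin_span F L B"
    and A: "p_subalgebra F L A" and comm: "\<And>x y. \<lbrakk>x \<in> A; y \<in> A\<rbrakk> \<Longrightarrow> lie_bracket L x y = \<zero>\<^bsub>L\<^esub>"
    and span: "A \<subseteq> lin_span F L (pmap L ` A)"
  shows "torus F L A"
proof -
  have Asub: "submodule A F L" using A by (simp add: p_subalgebra_def)
  note Ac = submoduleE(1)[OF Asub]
  have "lie_semisimple F L u" if u: "u \<in> A" for u
  proof -
    let ?u = "\<lambda>j. (pmap L ^^ j) u"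
    have uc: "?u j \<in> carrier L" for j using pmap_iter_closed u Ac by blast
    have uA: "?u j \<in> A" for j using p_subalgebra_pmap_iter[OF A u] .
    have "\<exists>n. ?u n \<in> lin_span F L (?u ` {..<n})"
      using uc fd(3) by (intro sequence_dependent[OF fd(1,2)]) auto
    \<comment> \<open>The first linear relation: \<open>?u n\<close> depends on its predecessors,
      which are independent.\<close>
    then obtain n where n: "?u n \<in> lin_span F L (?u ` {..<n})"
      and min: "\<And>i. i < n \<Longrightarrow> ?u i \<notin> lin_span F L (?u ` {..<i})"
      using exists_least_iff[of "\<lambda>n. ?u n \<in> lin_span F L (?u ` {..<n})"] by auto
    have sp: "u \<in> lin_span F L (?u ` {1..})"
    proof (cases "n = 0")
      case True
      then have "u \<in> lin_span F L {}" using n by simp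
      then show ?thesis using lin_span_mono by blast
    next
      case False
      \<comment> \<open>If the coefficient of u in this relation were zero, the p-map would send
        \<open>?W\<close>, which spans \<open>A\<close>, into the span of \<open>?Y\<close>. Then
        \<open>?Y\<close> would span \<open>A\<close> with fewer elements than the smallest spanning
        set \<open>X\<close>.\<close>
      have "?u n \<notin> lin_span F L (?u ` {1..<n})"
      proof
        assume un: "?u n \<in> lin_span F L (?u ` {1..<n})"
        obtain X0 where X0: "finite X0" "X0 \<subseteq> A" "A = lin_span F L X0"
          using submodule_finitely_spanned[OF fd(1,2) Asub] Ac fd(3) by blast
        obtain X where X: "finite X" "X \<subseteq> A" "A = lin_span F L X"
          and Xmin: "\<And>Y. finite Y \<Longrightarrow> Y \<subseteq> A \<Longrightarrow> A = lin_span F L Y \<Longrightarrow> card X \<le> card Y"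
          using ex_has_least_nat[of "\<lambda>X. finite X \<and> X \<subseteq> A \<and> A = lin_span F L X" X0 card] X0 by auto
        have Xc: "X \<subseteq> carrier L" using X Ac by auto
        \<comment> \<open>The n independent iterates take the place of n elements of
          \<open>X\<close>; with the remaining \<open>Z\<close> they still span
          \<open>A\<close>.\<close>
        obtain Z where Z: "Z \<subseteq> X" "card Z + n \<le> card X" "X \<subseteq> lin_span F L (?u ` {..<n} \<union> Z)"
          using steinitz_exchange[OF X(1) Xc, of n ?u] uA X(3) min by auto
        let ?W = "?u ` {..<n} \<union> Z" and ?Y = "?u ` {1..<n} \<union> pmap L ` Z"
        have W: "?W \<subseteq> carrier L" "?W \<subseteq> A" using uc uA Z(1) X(2) Xc by auto
        have Y: "?Y \<subseteq> A" using uA Z(1) X(2) A by (auto simp: p_subalgebra_def)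
        have Yc: "?Y \<subseteq> carrier L" using Y Ac by auto
        note YS = submodule_lin_span[OF Yc]
        have pW: "pmap L ` ?W \<subseteq> lin_span F L ?Y"
        proof -
          have "pmap L (?u i) \<in> lin_span F L ?Y" if "i < n" for i
          proof (cases "Suc i = n")
            case True
            then show ?thesis using un lin_span_mono[of "?u ` {1..<n}" ?Y] by auto
          next
            case False
            then have "?u (Suc i) \<in> ?Y" using that by (intro UnI1 imageI) auto
            then show ?thesis using lin_span_superset[of ?Y] by auto
          qed
          then show ?thesis using lin_span_superset[of ?Y] by auto
        qed
        have "pmap L z \<in> lin_span F L ?Y" if "z \<in> lin_span F L ?W" for z
          by (rule pmap_lin_span[OF W(1) _ YS pW]) (use that W(2) comm in blast)+
        moreover have "A \<subseteq> lin_span F L ?W"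
          using X(3) Z(3) lin_span_subset[OF W(1)] by blast
        ultimately have "pmap L ` A \<subseteq> lin_span F L ?Y" by auto
        \<comment> \<open>Here the assumption that the image of the p-map spans \<open>A\<close>
          enters.\<close>
        then have "A \<subseteq> lin_span F L ?Y" using span lin_span_subset[OF Yc] by blast
        then have "A = lin_span F L ?Y" using lin_span_least[OF Asub Y] by auto
        then have "card X \<le> card ?Y" using Y Z(1) X(1) finite_subset by (intro Xmin) auto
        also have "card ?Y \<le> card (?u ` {1..<n}) + card (pmap L ` Z)" by (rule card_Un_le)
        also have "\<dots> \<le> card {1..<n} + card Z"
          using Z(1) X(1) finite_subset by (intro add_mono card_image_le) auto
        finally show False using Z(2) False by simp
      qed
      moreover have "?u n \<in> lin_span F L (insert u (?u ` {1..<n}))"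
      proof -
        have "{..<n} = insert 0 {1..<n}" using False by auto
        then have "?u ` {..<n} = insert (?u 0) (?u ` {1..<n})" by (simp only: image_insert)
        then show ?thesis using n by simp
      qed
      moreover have "?u ` {1..<n} \<subseteq> carrier L" "u \<in> carrier L" using uc u Ac by blast+
      \<comment> \<open>The relation contains u with a nonzero coefficient and is solved for
        it.\<close>
      ultimately have "u \<in> lin_span F L (insert (?u n) (?u ` {1..<n}))"
        by - (rule lin_span_exchange)
      moreover have "?u ` insert n {1..<n} \<subseteq> ?u ` {1..}" using False by (intro image_mono) auto
      then have "insert (?u n) (?u ` {1..<n}) \<subseteq> ?u ` {1..}" by (simp only: image_insert)
      ultimately show ?thesis using lin_span_mono by blast
    qed
    then show ?thesis using semisimple_iff u Ac by blast
  qed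
  then show ?thesis using A comm by (simp add: torus_def)
qed

text \<open>Each t is a combination of the t^[p]^j with j >= 1, and each of these is the p-map of an
  earlier iterate in \<open>T\<close>. This is the converse of the preceding criterion.\<close>

lemma torus_subset_span_pmap:
  assumes T: "torus F L T"
  shows "T \<subseteq> lin_span F L (pmap L ` T)"
proof
  fix t assume t: "t \<in> T"
  have pT: "p_subalgebra F L T" using T by (simp add: torus_def)
  have tc: "t \<in> carrier L" using pT t submodule_carrier by (auto simp: p_subalgebra_def)
  have "(\<lambda>j. (pmap L ^^ j) t) ` {1..} \<subseteq> pmap L ` T"
  proof
    fix y assume "y \<in> (\<lambda>j. (pmap L ^^ j) t) ` {1..}"
    then obtain j where "y = (pmap L ^^ Suc j) t" by (auto simp del: funpow.simps dest!: Suc_le_D)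
    then show "y \<in> pmap L ` T" using p_subalgebra_pmap_iter[OF pT t, of j] by auto
  qed
  moreover have "t \<in> lin_span F L ((\<lambda>j. (pmap L ^^ j) t) ` {1..})"
    using T t semisimple_iff[OF tc] by (simp add: torus_def)
  ultimately show "t \<in> lin_span F L (pmap L ` T)" using lin_span_mono by blast
qed

text \<open>A Fitting argument for the p-map: from some m on, the span of the iterates c^[p]^j with
  j >= m is spanned by p-th powers of its own elements. Together with \<open>T\<close> these
  iterates span a torus, which by maximality is \<open>T\<close>, so c^[p]^m lies in
  \<open>T\<close>.\<close>

lemma centralizer_maximal_torus:
  assumes fd: "finite B" "B \<subseteq> carrier L" "carrier L = lin_span F L B"
    and T: "maximal_torus F L T" and c: "c \<in> carrier L"
    and comm: "\<And>t. t \<in> T \<Longrightarrow> lie_bracket L t c = \<zero>\<^bsub>L\<^esub>"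
  shows "\<exists>n. (pmap L ^^ n) c \<in> T"
proof -
  let ?c = "\<lambda>j. (pmap L ^^ j) c"
  have tT: "torus F L T" using T by (simp add: maximal_torus_def)
  then have pT: "p_subalgebra F L T" by (simp add: torus_def)
  then have sT: "submodule T F L" by (simp add: p_subalgebra_def)
  note Tc = submoduleE(1)[OF sT]
  have cc: "?c j \<in> carrier L" for j using pmap_iter_closed[OF c] .
  have "\<exists>n. ?c n \<in> lin_span F L (?c ` {..<n})"
    using cc fd(3) by (intro sequence_dependent[OF fd(1,2)]) auto
  then obtain n where n: "?c n \<in> lin_span F L (?c ` {0..<n})" by (auto simp: lessThan_atLeast0)
  \<comment> \<open>The relation for c^[p]^n is shortened from below as far as possible. For m < n
    the coefficient of c^[p]^m is then nonzero and the relation can be solved for it; for m = n the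
    relation says that c^[p]^m is zero.\<close>
  define m where "m = (GREATEST m. m \<le> n \<and> ?c n \<in> lin_span F L (?c ` {m..<n}))"
  have m: "m \<le> n \<and> ?c n \<in> lin_span F L (?c ` {m..<n})"
    unfolding m_def by (rule GreatestI_nat[where b = n]) (use n in auto)
  have greatest: "k \<le> m" if "k \<le> n" "?c n \<in> lin_span F L (?c ` {k..<n})" for k
    unfolding m_def by (rule Greatest_le_nat[where b = n]) (use that in auto)
  let ?D = "?c ` {Suc m..}"
  have cm: "?c m \<in> lin_span F L ?D"
  proof (cases "m = n")
    case True
    then have "?c m \<in> lin_span F L {}" using m by simp
    then show ?thesis using lin_span_mono by blast
  next
    case False
    have mn: "m < n" using conjunct1[OF m] False by simp
    have eq: "?c ` {m..<n} = insert (?c m) (?c ` {Suc m..<n})"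
    proof -
      have "{m..<n} = insert m {Suc m..<n}" using mn by auto
      then show ?thesis by (simp only: image_insert)
    qed
    have "?c n \<notin> lin_span F L (?c ` {Suc m..<n})" using greatest[of "Suc m"] mn by auto
    moreover have "?c n \<in> lin_span F L (insert (?c m) (?c ` {Suc m..<n}))"
      using conjunct2[OF m] by (simp only: eq)
    moreover have "?c ` {Suc m..<n} \<subseteq> carrier L" using cc by blast
    ultimately have "?c m \<in> lin_span F L (insert (?c n) (?c ` {Suc m..<n}))"
      by - (rule lin_span_exchange[OF _ cc])
    moreover have "?c ` insert n {Suc m..<n} \<subseteq> ?D" using mn by (intro image_mono) auto
    then have "insert (?c n) (?c ` {Suc m..<n}) \<subseteq> ?D" by (simp only: image_insert)
    ultimately show ?thesis using lin_span_mono by blast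
  qed
  let ?X = "T \<union> ?c ` {m..}"
  let ?A = "lin_span F L ?X"
  have X: "?X \<subseteq> carrier L" using Tc cc by auto
  have tc: "lie_bracket L (?c j) t = \<zero>\<^bsub>L\<^esub>" "lie_bracket L t (?c j) = \<zero>\<^bsub>L\<^esub>" if "t \<in> T" for t j
  proof -
    have "lie_bracket L c t = \<zero>\<^bsub>L\<^esub>" using that comm Tc c by (intro bracket_commute_zero[of t c]) auto
    then show 1: "lie_bracket L (?c j) t = \<zero>\<^bsub>L\<^esub>" using that Tc c by (intro pmap_commute) auto
    show "lie_bracket L t (?c j) = \<zero>\<^bsub>L\<^esub>"
      using that Tc cc 1 by (intro bracket_commute_zero[of _ t]) auto
  qed
  have commX: "lie_bracket L x y = \<zero>\<^bsub>L\<^esub>" if "x \<in> ?X" "y \<in> ?X" for x y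
    using that tT tc pmap_iter_commute[OF c] by (auto simp: torus_def)
  have Xsub: "?X \<subseteq> ?A" by (rule lin_span_superset)
  have pX: "pmap L x \<in> ?X" if "x \<in> ?X" for x
  proof -
    have "pmap L (?c j) \<in> ?c ` {m..}" if "m \<le> j" for j
      using that image_eqI[of _ ?c "Suc j" "{m..}"] by auto
    then show ?thesis using that pT by (auto simp: p_subalgebra_def)
  qed
  have pA: "p_subalgebra F L ?A"
    using pX Xsub by (intro p_subalgebra_lin_span[OF X commX]) auto
  have pAc: "pmap L ` ?A \<subseteq> carrier L"
    using pA submodule_lin_span[OF X] submodule_carrier unfolding p_subalgebra_def by blast
  have "torus F L ?A"
  proof (rule torus_if_spanned_by_pmap[OF fd pA])
    show "lie_bracket L x y = \<zero>\<^bsub>L\<^esub>" if "x \<in> ?A" "y \<in> ?A" for x y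
      using lin_span_commute[OF X commX that] .
    have "T \<subseteq> lin_span F L (pmap L ` ?A)"
      using torus_subset_span_pmap[OF tT] lin_span_mono[of "pmap L ` T" "pmap L ` ?A"] Xsub by auto
    moreover have D: "?D \<subseteq> pmap L ` ?A"
    proof
      fix y assume "y \<in> ?D"
      then obtain i where i: "Suc m \<le> i" "y = ?c i" by blast
      then obtain j where j: "m \<le> j" "y = ?c (Suc j)" by (cases i) auto
      then have "?c j \<in> ?A" using Xsub by auto
      then show "y \<in> pmap L ` ?A" using j by auto
    qed
    moreover have "?c j \<in> lin_span F L (pmap L ` ?A)" if "m \<le> j" for j
    proof (cases "j = m")
      case True
      then show ?thesis using cm lin_span_mono[OF D] by auto
    next
      case False
      then have "?c j \<in> ?D" using that by auto
      then show ?thesis using D lin_span_superset by blast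
    qed
    ultimately show "?A \<subseteq> lin_span F L (pmap L ` ?A)"
      using pAc by (intro lin_span_subset) auto
  qed
  then have "?A = T" using T Xsub by (auto simp: maximal_torus_def)
  then show ?thesis using Xsub by auto
qed

text \<open>Each application of the p-map multiplies the exponent by p. The domain \<open>S\<close>
  is left open because this serves both for a torus and for all of \<open>L\<close>.\<close>

lemma pmap_iter_action:
  assumes closed: "\<And>s. s \<in> S \<Longrightarrow> pmap L s \<in> S" "\<And>s v. \<lbrakk>s \<in> S; v \<in> X\<rbrakk> \<Longrightarrow> \<tau> s v \<in> X"
    and pow: "\<And>s v. \<lbrakk>s \<in> S; v \<in> X\<rbrakk> \<Longrightarrow> \<tau> (pmap L s) v = (\<tau> s ^^ p) v"
    and t: "t \<in> S" and v: "v \<in> X"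
  shows "\<tau> ((pmap L ^^ j) t) v = (\<tau> t ^^ (p ^ j)) v"
  using v
proof (induction j arbitrary: v)
  case (Suc j)
  let ?s = "(pmap L ^^ j) t"
  note IH = Suc.IH
  have s: "?s \<in> S" by (induction j) (auto simp: t closed)
  have X: "(\<tau> t ^^ k) v \<in> X" for k by (induction k) (auto simp: Suc.prems t closed)
  have "(\<tau> ?s ^^ k) v = (\<tau> t ^^ (p ^ j * k)) v" for k
  proof (induction k)
    case (Suc k)
    then show ?case by (simp add: IH[OF X] funpow_add)
  qed simp
  then show ?case using pow[OF s Suc.prems] by (simp add: mult.commute)
qed simp

text \<open>For semisimple \<open>t\<close>, writing \<open>t\<close> as a combination of the \<open>t\<^bsup>[p]^j\<^esup>\<close>, \<open>j \<ge> 1\<close>, gives an operator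
  \<open>e\<close>, a polynomial in \<open>\<tau> t\<close> without constant term, such that \<open>\<tau> t (e v) = \<tau> t v\<close>.\<close>

lemma torus_fixed_lift:
  fixes V :: "('k, 'v, 'w) module_scheme" (structure)
  assumes fd: "finite B" "B \<subseteq> carrier L" "carrier L = lin_span F L B"
    and T: "torus F L T" and V: "module F V"
    and closed: "\<And>t v. \<lbrakk>t \<in> T; v \<in> carrier V\<rbrakk> \<Longrightarrow> \<tau> t v \<in> carrier V"
    and add_r: "\<And>t v w. \<lbrakk>t \<in> T; v \<in> carrier V; w \<in> carrier V\<rbrakk> \<Longrightarrow> \<tau> t (v \<oplus>\<^bsub>V\<^esub> w) = \<tau> t v \<oplus>\<^bsub>V\<^esub> \<tau> t w"
    and smult_r: "\<And>t a v. \<lbrakk>t \<in> T; a \<in> carrier F; v \<in> carrier V\<rbrakk> \<Longrightarrow> \<tau> t (a \<odot>\<^bsub>V\<^esub> v) = a \<odot>\<^bsub>V\<^esub> \<tau> t v"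
    and add_l: "\<And>t s v. \<lbrakk>t \<in> T; s \<in> T; v \<in> carrier V\<rbrakk> \<Longrightarrow> \<tau> (t \<oplus>\<^bsub>L\<^esub> s) v = \<tau> t v \<oplus>\<^bsub>V\<^esub> \<tau> s v"
    and smult_l: "\<And>t a v. \<lbrakk>t \<in> T; a \<in> carrier F; v \<in> carrier V\<rbrakk> \<Longrightarrow> \<tau> (a \<odot>\<^bsub>L\<^esub> t) v = a \<odot>\<^bsub>V\<^esub> \<tau> t v"
    and comm: "\<And>t s v. \<lbrakk>t \<in> T; s \<in> T; v \<in> carrier V\<rbrakk> \<Longrightarrow> \<tau> t (\<tau> s v) = \<tau> s (\<tau> t v)"
    and pow: "\<And>t v. \<lbrakk>t \<in> T; v \<in> carrier V\<rbrakk> \<Longrightarrow> \<tau> (pmap L t) v = (\<tau> t ^^ p) v"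
    and N: "submodule N F V" "\<And>t v. \<lbrakk>t \<in> T; v \<in> N\<rbrakk> \<Longrightarrow> \<tau> t v \<in> N"
    and m: "m \<in> carrier V" "\<And>t. t \<in> T \<Longrightarrow> \<tau> t m \<in> N"
  shows "\<exists>n\<in>N. \<forall>t\<in>T. \<tau> t (m \<ominus>\<^bsub>V\<^esub> n) = \<zero>\<^bsub>V\<^esub>"
proof -
  interpret V: vspace F V using V field_axioms by (simp add: vspace_def)
  have pT: "p_subalgebra F L T" using T by (simp add: torus_def)
  then have sT: "submodule T F L" by (simp add: p_subalgebra_def)
  note Tc = submoduleE(1)[OF sT]
  note Nc = V.submodule_carrier[OF N(1)]
  have zero: "\<tau> t \<zero>\<^bsub>V\<^esub> = \<zero>\<^bsub>V\<^esub>" if "t \<in> T" for t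
    using smult_r[OF that, of \<zero> "\<zero>\<^bsub>V\<^esub>"] closed[OF that] by simp
  have minus_r: "\<tau> t (\<ominus>\<^bsub>V\<^esub> v) = \<ominus>\<^bsub>V\<^esub> \<tau> t v" if "t \<in> T" "v \<in> carrier V" for t v
    using smult_r[OF that(1), of "\<ominus> \<one>" v] closed that by (simp add: V.smult_l_minus)
  have diff_r: "\<tau> t (v \<ominus>\<^bsub>V\<^esub> w) = \<tau> t v \<ominus>\<^bsub>V\<^esub> \<tau> t w" if "t \<in> T" "v \<in> carrier V" "w \<in> carrier V" for t v w
    using that by (simp add: a_minus_def add_r minus_r)
  have pown: "(\<tau> t ^^ k) v \<in> carrier V" if "t \<in> T" "v \<in> carrier V" for t v k
    using that closed by (induction k) auto
  have pow_iter: "\<tau> ((pmap L ^^ j) t) v = (\<tau> t ^^ (p ^ j)) v" if "t \<in> T" "v \<in> carrier V" for t v j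
    using that pT closed pow by (intro pmap_iter_action) (auto simp: p_subalgebra_def)
  have pow_comm: "\<tau> s ((\<tau> t ^^ k) v) = (\<tau> t ^^ k) (\<tau> s v)" if "t \<in> T" "s \<in> T" "v \<in> carrier V" for s t k v
    using that by (induction k) (auto simp: comm[of s t] pown)
  have pow_N: "(\<tau> t ^^ k) v \<in> N" if "t \<in> T" "v \<in> N" for t k v
    using that N(2) by (induction k) auto
  have local_unit: "\<exists>e. (\<forall>v\<in>carrier V. e v \<in> carrier V \<and> (\<tau> t v \<in> N \<longrightarrow> e v \<in> N) \<and> \<tau> t (e v) = \<tau> t v \<and>
      (\<forall>s\<in>T. \<tau> s (e v) = e (\<tau> s v))) \<and> e \<zero>\<^bsub>V\<^esub> = \<zero>\<^bsub>V\<^esub>" if t: "t \<in> T" for t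
  proof -
    \<comment> \<open>For fixed t, \<open>Q u e\<close> says that t e and u agree as operators, that
      e commutes with \<open>T\<close>, and that e v lies in \<open>N\<close> whenever t v does. The
      u admitting such an e form a subspace of \<open>T\<close>. It contains t^[p]^j for j >= 1 and
      therefore t, and an e for u = t is what is wanted.\<close>
    define Q where "Q u e \<longleftrightarrow> (\<forall>v\<in>carrier V. e v \<in> carrier V \<and> (\<tau> t v \<in> N \<longrightarrow> e v \<in> N) \<and>
      \<tau> t (e v) = \<tau> u v \<and> (\<forall>s\<in>T. \<tau> s (e v) = e (\<tau> s v))) \<and> e \<zero>\<^bsub>V\<^esub> = \<zero>\<^bsub>V\<^esub>" for u e
    have zero_l: "\<tau> \<zero>\<^bsub>L\<^esub> v = \<zero>\<^bsub>V\<^esub>" if "v \<in> carrier V" for v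
      using smult_l[OF t, of \<zero> v] t Tc that closed[OF t] by auto
    have smul: "\<exists>e. Q (a \<odot>\<^bsub>L\<^esub> u) e" if "a \<in> carrier F" "u \<in> T" "Q u e" for a u e
      using that t closed V.submoduleE(4)[OF N(1)]
      by (intro exI[of _ "\<lambda>v. a \<odot>\<^bsub>V\<^esub> e v"]) (auto simp: Q_def smult_r smult_l)
    let ?U = "{u \<in> T. \<exists>e. Q u e}"
    have "submodule ?U F L"
    proof (rule submoduleI)
      show "?U \<subseteq> carrier L" using Tc by auto
      show "\<zero>\<^bsub>L\<^esub> \<in> ?U"
        using submodule_zero[OF sT] zero t V.submodule_zero[OF N(1)]
        by (auto simp: Q_def zero_l intro!: exI[of _ "\<lambda>v. \<zero>\<^bsub>V\<^esub>"])
      show sm: "a \<odot>\<^bsub>L\<^esub> u \<in> ?U" if "a \<in> carrier F" "u \<in> ?U" for a u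
        using that smul submoduleE(4)[OF sT] by blast
      show "\<ominus>\<^bsub>L\<^esub> u \<in> ?U" if "u \<in> ?U" for u
      proof -
        have "u \<in> carrier L" using that Tc by auto
        then have "\<ominus>\<^bsub>L\<^esub> u = (\<ominus> \<one>) \<odot>\<^bsub>L\<^esub> u" by (simp add: smult_l_minus)
        then show ?thesis using sm[of "\<ominus> \<one>" u] that by simp
      qed
      fix u u' assume "u \<in> ?U" "u' \<in> ?U"
      then obtain e e' where u: "u \<in> T" "u' \<in> T" "Q u e" "Q u' e'" by blast
      have "Q (u \<oplus>\<^bsub>L\<^esub> u') (\<lambda>v. e v \<oplus>\<^bsub>V\<^esub> e' v)"
        unfolding Q_def
      proof (intro conjI ballI impI)
        fix v assume v: "v \<in> carrier V"
        have c: "e v \<in> carrier V" "e' v \<in> carrier V" using u v by (auto simp: Q_def)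
        then show "e v \<oplus>\<^bsub>V\<^esub> e' v \<in> carrier V" by simp
        show "e v \<oplus>\<^bsub>V\<^esub> e' v \<in> N" if "\<tau> t v \<in> N"
          using that u v V.submoduleE(5)[OF N(1)] by (auto simp: Q_def)
        show "\<tau> t (e v \<oplus>\<^bsub>V\<^esub> e' v) = \<tau> (u \<oplus>\<^bsub>L\<^esub> u') v"
          using u v unfolding add_r[OF t c] add_l[OF u(1,2) v] by (simp add: Q_def)
        show "\<tau> s (e v \<oplus>\<^bsub>V\<^esub> e' v) = e (\<tau> s v) \<oplus>\<^bsub>V\<^esub> e' (\<tau> s v)" if "s \<in> T" for s
          using u v that unfolding add_r[OF that c] by (simp add: Q_def)
      qed (use u in \<open>simp add: Q_def\<close>)
      then show "u \<oplus>\<^bsub>L\<^esub> u' \<in> ?U" using u submoduleE(5)[OF sT] by blast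
    qed
    moreover have "(\<lambda>j. (pmap L ^^ j) t) ` {1..} \<subseteq> ?U"
    proof
      fix y assume "y \<in> (\<lambda>j. (pmap L ^^ j) t) ` {1..}"
      then obtain j where j: "1 \<le> j" and y: "y = (pmap L ^^ j) t" by auto
      have "p ^ 1 \<le> p ^ j" using j p_gt_0 by (intro power_increasing) auto
      then have "2 \<le> p ^ j" using p_ge_2 by simp
      \<comment> \<open>The operator for t^[p]^j is the power p^j - 1 = \<open>Suc k\<close> of t.
        Since p^j >= 2, at least one factor t remains, and it is this factor that brings v into
        \<open>N\<close> when t v lies in \<open>N\<close>.\<close>
      then obtain k where k: "p ^ j = Suc (Suc k)" by (metis add_2_eq_Suc le_Suc_ex)
      have "Q y (\<tau> t ^^ Suc k)"
        unfolding Q_def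
      proof (intro conjI ballI impI)
        fix v assume v: "v \<in> carrier V"
        show "(\<tau> t ^^ Suc k) v \<in> carrier V" using pown t v by blast
        show "(\<tau> t ^^ Suc k) v \<in> N" if "\<tau> t v \<in> N"
          using pow_N[OF t that, of k] by (simp add: funpow_swap1)
        show "\<tau> t ((\<tau> t ^^ Suc k) v) = \<tau> y v" unfolding y using pow_iter[OF t v, of j] k by simp
        show "\<tau> s ((\<tau> t ^^ Suc k) v) = (\<tau> t ^^ Suc k) (\<tau> s v)" if "s \<in> T" for s
          using pow_comm[OF t that v] .
      next
        show "(\<tau> t ^^ Suc k) \<zero>\<^bsub>V\<^esub> = \<zero>\<^bsub>V\<^esub>" by (induction k) (auto simp: zero t)
      qed
      then show "y \<in> ?U" using y p_subalgebra_pmap_iter[OF pT t] by auto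
    qed
    moreover have "t \<in> lin_span F L ((\<lambda>j. (pmap L ^^ j) t) ` {1..})"
      using semisimple_iff[of t] T t Tc by (auto simp: torus_def)
    ultimately have "t \<in> ?U" using lin_span_least by blast
    then show ?thesis unfolding Q_def by blast
  qed
  obtain X where X: "finite X" "X \<subseteq> T" "T = lin_span F L X"
    using submodule_finitely_spanned[OF fd(1,2) sT] Tc fd(3) by blast
  have "\<exists>n\<in>N. \<forall>t\<in>X. \<tau> t (m \<ominus>\<^bsub>V\<^esub> n) = \<zero>\<^bsub>V\<^esub>"
    using X(1,2)
  proof (induction X rule: finite_induct)
    case empty
    then show ?case using V.submodule_zero[OF N(1)] by blast
  next
    case (insert t X)
    then obtain n where n: "n \<in> N" "\<And>s. s \<in> X \<Longrightarrow> \<tau> s (m \<ominus>\<^bsub>V\<^esub> n) = \<zero>\<^bsub>V\<^esub>" by auto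
    have t: "t \<in> T" using insert by auto
    obtain e where e: "\<And>v. v \<in> carrier V \<Longrightarrow> e v \<in> carrier V" "\<And>v. v \<in> carrier V \<Longrightarrow> \<tau> t v \<in> N \<Longrightarrow> e v \<in> N"
      "\<And>v. v \<in> carrier V \<Longrightarrow> \<tau> t (e v) = \<tau> t v"
      "\<And>s v. s \<in> T \<Longrightarrow> v \<in> carrier V \<Longrightarrow> \<tau> s (e v) = e (\<tau> s v)" "e \<zero>\<^bsub>V\<^esub> = \<zero>\<^bsub>V\<^esub>"
      using local_unit[OF t] by blast
    \<comment> \<open>The next correction is e (m - n). It makes t kill the new difference, and
      since e commutes with \<open>T\<close>, the elements of \<open>X\<close> treated earlier still
      kill it.\<close>
    let ?m = "m \<ominus>\<^bsub>V\<^esub> n"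
    have nc: "n \<in> carrier V" using n Nc by blast
    have mc: "?m \<in> carrier V" using m nc by simp
    have "\<tau> t ?m \<in> N" using diff_r[OF t m(1) nc] V.submodule_minus[OF N(1)] m t N(2)[OF t n(1)] by auto
    then have em: "e ?m \<in> N" using e(2) mc by blast
    have eq: "m \<ominus>\<^bsub>V\<^esub> (n \<oplus>\<^bsub>V\<^esub> e ?m) = ?m \<ominus>\<^bsub>V\<^esub> e ?m"
      using m(1) nc e(1)[OF mc] by (simp add: a_minus_def V.M.minus_add V.M.a_assoc)
    have "\<tau> s (?m \<ominus>\<^bsub>V\<^esub> e ?m) = \<zero>\<^bsub>V\<^esub>" if s: "s \<in> insert t X" for s
    proof -
      have sT: "s \<in> T" using s insert by auto
      have "\<tau> s (?m \<ominus>\<^bsub>V\<^esub> e ?m) = \<tau> s ?m \<ominus>\<^bsub>V\<^esub> \<tau> s (e ?m)" using diff_r[OF sT mc e(1)[OF mc]] .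
      moreover have "\<tau> s (e ?m) = \<tau> s ?m"
        using s e(3)[OF mc] e(4)[OF sT mc] n(2) e(5) by auto
      ultimately show ?thesis using closed[OF sT mc] by (simp add: a_minus_def V.M.r_neg)
    qed
    then show ?case
      using V.submoduleE(5)[OF N(1) n(1) em] eq by (intro bexI[of _ "n \<oplus>\<^bsub>V\<^esub> e ?m"]) auto
  qed
  then obtain n where n: "n \<in> N" "\<And>t. t \<in> X \<Longrightarrow> \<tau> t (m \<ominus>\<^bsub>V\<^esub> n) = \<zero>\<^bsub>V\<^esub>" by auto
  have mc: "m \<ominus>\<^bsub>V\<^esub> n \<in> carrier V" using m(1) Nc[OF n(1)] by simp
  \<comment> \<open>The elements of \<open>T\<close> killing the corrected vector form a subspace,
    so the finite spanning set \<open>X\<close> decides.\<close>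
  have "submodule {t \<in> T. \<tau> t (m \<ominus>\<^bsub>V\<^esub> n) = \<zero>\<^bsub>V\<^esub>} F L"
  proof (rule submoduleI)
    have "\<tau> \<zero>\<^bsub>L\<^esub> (m \<ominus>\<^bsub>V\<^esub> n) = \<zero>\<^bsub>V\<^esub>"
      using smult_l[OF submodule_zero[OF sT], of \<zero>] mc closed[OF submodule_zero[OF sT]] by simp
    then show "\<zero>\<^bsub>L\<^esub> \<in> {t \<in> T. \<tau> t (m \<ominus>\<^bsub>V\<^esub> n) = \<zero>\<^bsub>V\<^esub>}" using submodule_zero[OF sT] by simp
    fix a assume "a \<in> {t \<in> T. \<tau> t (m \<ominus>\<^bsub>V\<^esub> n) = \<zero>\<^bsub>V\<^esub>}"
    then have a: "a \<in> T" "\<tau> a (m \<ominus>\<^bsub>V\<^esub> n) = \<zero>\<^bsub>V\<^esub>" by auto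
    have "\<ominus>\<^bsub>L\<^esub> a = (\<ominus> \<one>) \<odot>\<^bsub>L\<^esub> a" using a Tc by (simp add: smult_l_minus subset_iff)
    then show "\<ominus>\<^bsub>L\<^esub> a \<in> {t \<in> T. \<tau> t (m \<ominus>\<^bsub>V\<^esub> n) = \<zero>\<^bsub>V\<^esub>}"
      using a smult_l[OF a(1), of "\<ominus> \<one>"] mc submoduleE(3)[OF sT a(1)] by simp
  qed (use Tc submoduleE(4,5)[OF sT] mc in \<open>auto simp: add_l smult_l\<close>)
  moreover have "X \<subseteq> {t \<in> T. \<tau> t (m \<ominus>\<^bsub>V\<^esub> n) = \<zero>\<^bsub>V\<^esub>}" using X n by auto
  ultimately have "T \<subseteq> {t \<in> T. \<tau> t (m \<ominus>\<^bsub>V\<^esub> n) = \<zero>\<^bsub>V\<^esub>}" using lin_span_least X(3) by metis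
  then show ?thesis using n(1) by blast
qed

end

section \<open>Maximal tori and simple modules\<close>

context lie_algebra
begin

definition lie_ideal :: "'l set \<Rightarrow> bool"
  where "lie_ideal H \<longleftrightarrow> submodule H F L \<and> (\<forall>y\<in>carrier L. \<forall>x\<in>H. lie_bracket L y x \<in> H)"

text \<open>The derived subspace is an intersection of subspaces. Its elements z with [L,z] inside
  it form one of the subspaces intersected, because brackets of elements of \<open>H\<close> have
  this property by the derivation form of the Jacobi identity.\<close>

lemma derived_lie_ideal:
  assumes H: "lie_ideal H"
  shows "lie_ideal (lie_derived F L H)"
    and "\<And>x y. \<lbrakk>x \<in> H; y \<in> H\<rbrakk> \<Longrightarrow> lie_bracket L x y \<in> lie_derived F L H"
proof -
  let ?D = "lie_derived F L H"
  have Hc: "H \<subseteq> carrier L" using H submoduleE(1) by (simp add: lie_ideal_def)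
  show b: "lie_bracket L x y \<in> ?D" if "x \<in> H" "y \<in> H" for x y
    using that by (auto simp: lie_derived_def)
  have D: "submodule ?D F L"
  proof (rule submoduleI)
    show "?D \<subseteq> carrier L" 
      unfolding lie_derived_def by (intro Inter_lower) (use carrier_is_submodule Hc bracket_closed in auto)
  qed (auto simp: lie_derived_def submodule_zero submoduleE)
  note Dc = submodule_carrier[OF D]
  let ?I = "{z \<in> ?D. \<forall>y\<in>carrier L. lie_bracket L y z \<in> ?D}"
  have "submodule ?I F L"
    by (rule submoduleI)
      (use Dc submodule_zero[OF D] submoduleE(3-5)[OF D] in
        \<open>auto simp: bracket_minus_right bracket_add_right bracket_smult_right\<close>)
  moreover have "lie_bracket L x y \<in> ?I" if x: "x \<in> H" and y: "y \<in> H" for x y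
  proof -
    have "lie_bracket L w (lie_bracket L x y) \<in> ?D" if w: "w \<in> carrier L" for w
    proof -
      have "lie_bracket L w x \<in> H" "lie_bracket L w y \<in> H" using H w x y by (auto simp: lie_ideal_def)
      then show ?thesis
        using bracket_jacobi_left[OF w, of x y] submoduleE(5)[OF D b b] x y Hc by (metis subsetD)
    qed
    then show ?thesis using b x y by blast
  qed
  ultimately have "?D \<subseteq> ?I" unfolding lie_derived_def by blast
  then show "lie_ideal ?D" using D by (auto simp: lie_ideal_def)
qed

lemma derived_series_lie_ideal: "lie_ideal ((lie_derived F L ^^ n) (carrier L))"
proof (induction n)
  case 0 show ?case using carrier_is_submodule by (simp add: lie_ideal_def bracket_closed)
qed (simp add: derived_lie_ideal)

end

context lie_module
begin

sublocale V: vspace F V ..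

lemma act_zero_right [simp]: "x \<in> carrier L \<Longrightarrow> act V x \<zero>\<^bsub>V\<^esub> = \<zero>\<^bsub>V\<^esub>"
  using act_smult_right[of \<zero> x "\<zero>\<^bsub>V\<^esub>"] act_closed by simp

lemma act_zero_left [simp]: "v \<in> carrier V \<Longrightarrow> act V \<zero>\<^bsub>L\<^esub> v = \<zero>\<^bsub>V\<^esub>"
  using act_smult_left[of \<zero> "\<zero>\<^bsub>L\<^esub>" v] act_closed by simp

lemma act_minus_right:
  "\<lbrakk>x \<in> carrier L; v \<in> carrier V\<rbrakk> \<Longrightarrow> act V x (\<ominus>\<^bsub>V\<^esub> v) = \<ominus>\<^bsub>V\<^esub> act V x v"
  using act_smult_right[of "\<ominus> \<one>" x v] by (simp add: act_closed V.smult_l_minus)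

lemma act_minus_left:
  "\<lbrakk>x \<in> carrier L; v \<in> carrier V\<rbrakk> \<Longrightarrow> act V (\<ominus>\<^bsub>L\<^esub> x) v = \<ominus>\<^bsub>V\<^esub> act V x v"
  using act_smult_left[of "\<ominus> \<one>" x v] by (simp add: act_closed V.smult_l_minus smult_l_minus)

lemma act_swap:
  assumes "x \<in> carrier L" "y \<in> carrier L" "v \<in> carrier V"
  shows "act V x (act V y v) = act V y (act V x v) \<oplus>\<^bsub>V\<^esub> act V (lie_bracket L x y) v"
  using assms act_closed unfolding act_bracket[OF assms]
  by (simp add: a_minus_def V.M.add.inv_solve_left V.M.a_ac V.M.r_neg V.M.r_neg2)

lemma act_iter_closed: "\<lbrakk>x \<in> carrier L; v \<in> carrier V\<rbrakk> \<Longrightarrow> (act V x ^^ k) v \<in> carrier V"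
  by (induction k) (auto simp: act_closed)

text \<open>These are the L-submodules of \<open>V\<close>. A quotient by a stable subspace is never
  formed; vanishing in it is expressed as membership.\<close>

definition stable :: "'v set \<Rightarrow> bool"
  where "stable M \<longleftrightarrow> submodule M F V \<and> (\<forall>x\<in>carrier L. \<forall>v\<in>M. act V x v \<in> M)"

end

text \<open>Relative to the maximal stable subspace \<open>N\<close> this says that a simple module with trivial
  \<open>p\<close>-character and a nonzero vector \<open>i\<close> fixed by \<open>T\<close> is trivial. The kernel \<open>J\<close> of the module is an
  ideal. If \<open>[L,z] \<subseteq> J\<close> then \<open>z\<close> may be moved modulo \<open>J\<close> into the centralizer of \<open>T\<close>, where some
  \<open>p\<close>-power of it lies in \<open>T\<close> and kills \<open>i\<close>; as \<open>z\<close> acts by an endomorphism of a simple module, it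
  acts by zero. For \<open>x\<close> in the last derived ideal \<open>K\<close> outside \<open>J\<close> this applies to \<open>z = x\<^bsup>[p]\<^esup>\<close>, so \<open>K\<close>
  acts by commuting nilpotent operators, whose common kernel is then everything.\<close>

lemma (in restricted_lie_algebra) torus_fixed_vector_trivial_action:
  fixes V :: "('k, 'l, 'v, 'w) lie_mod_scheme"
  assumes fd: "finite_dim F L" and solv: "lie_solvable F L" and T: "maximal_torus F L T"
    and V: "lie_module F L V"
    and pow: "\<And>x v. \<lbrakk>x \<in> carrier L; v \<in> carrier V\<rbrakk> \<Longrightarrow> act V (pmap L x) v = (act V x ^^ p) v"
    and N: "lie_module.stable F L V N" and i: "i \<in> carrier V" "i \<notin> N"
    and Ti: "\<And>t. t \<in> T \<Longrightarrow> act V t i = \<zero>\<^bsub>V\<^esub>"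
    and maxN: "\<And>M. \<lbrakk>lie_module.stable F L V M; N \<subseteq> M\<rbrakk> \<Longrightarrow> M = N \<or> M = carrier V"
    and x: "x \<in> carrier L" and v: "v \<in> carrier V"
  shows "act V x v \<in> N"
proof -
  interpret lm: lie_module F L V by (rule V)
  let ?A = "act V"
  obtain B where fdB: "finite B" "B \<subseteq> carrier L" "carrier L = lin_span F L B"
    using finite_dim_spanned[OF fd] .
  have tT: "torus F L T" using T by (simp add: maximal_torus_def)
  have sT: "submodule T F L" using tT by (simp add: torus_def p_subalgebra_def)
  note Tc = submodule_carrier[OF sT]
  have sN: "submodule N F V" and Nst: "\<And>x v. \<lbrakk>x \<in> carrier L; v \<in> N\<rbrakk> \<Longrightarrow> ?A x v \<in> N"
    using N by (auto simp: lm.stable_def)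
  note Nc = lm.V.submodule_carrier[OF sN]
  define J where "J = {x \<in> carrier L. \<forall>v\<in>carrier V. ?A x v \<in> N}"
  have Jsub: "submodule J F L"
    unfolding J_def
    by (rule submoduleI)
      (use lm.V.submodule_zero[OF sN] lm.V.submoduleE(3-5)[OF sN] in
        \<open>auto simp: lm.act_minus_left lm.act_add_left lm.act_smult_left\<close>)
  have Jid: "lie_bracket L y z \<in> J" if y: "y \<in> carrier L" and z: "z \<in> J" for y z
  proof -
    have "act V (lie_bracket L y z) v \<in> N" if v: "v \<in> carrier V" for v
      using y z v lm.V.submodule_minus[OF sN Nst[OF y]]
      by (auto simp: J_def lm.act_bracket lm.act_closed)
    then show ?thesis using y z by (simp add: J_def bracket_closed)
  qed
  note Jc = submodule_carrier[OF Jsub]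
  have central: "z \<in> J" if z: "z \<in> carrier L" and zJ: "\<And>y. y \<in> carrier L \<Longrightarrow> lie_bracket L y z \<in> J" for z
  proof -
    \<comment> \<open>Fixed vectors are lifted for the adjoint action of \<open>T\<close> on
      \<open>L\<close>, with \<open>J\<close> as the invariant subspace: z is fixed modulo
      \<open>J\<close>, so some z - j centralizes \<open>T\<close>.\<close>
    have "\<exists>j\<in>J. \<forall>t\<in>T. lie_bracket L t (z \<ominus>\<^bsub>L\<^esub> j) = \<zero>\<^bsub>L\<^esub>"
    proof (rule torus_fixed_lift[OF fdB tT module_axioms])
      fix t s v assume "t \<in> T" "s \<in> T" "v \<in> carrier L"
      then show "lie_bracket L t (lie_bracket L s v) = lie_bracket L s (lie_bracket L t v)"
        using bracket_jacobi_left[of t s v] tT Tc bracket_closed by (simp add: torus_def)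
    qed (use Tc Jsub Jid zJ z in
        \<open>auto simp: bracket_closed bracket_add_right bracket_add_left bracket_smult_left
            bracket_smult_right ad_pmap\<close>)
    then obtain j where j: "j \<in> J" and cT: "\<And>t. t \<in> T \<Longrightarrow> lie_bracket L t (z \<ominus>\<^bsub>L\<^esub> j) = \<zero>\<^bsub>L\<^esub>" by blast
    define c where "c = z \<ominus>\<^bsub>L\<^esub> j"
    have c: "c \<in> carrier L" using z Jc[OF j] by (simp add: c_def)
    obtain n where n: "(pmap L ^^ n) c \<in> T"
      using centralizer_maximal_torus[OF fdB T c] cT unfolding c_def by blast
    have "?A ((pmap L ^^ n) c) i = (?A c ^^ (p ^ n)) i"
      using c i pow by (intro pmap_iter_action[where S = "carrier L" and X = "carrier V"])
        (auto simp: pmap_closed lm.act_closed)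
    then have ci: "(?A c ^^ (p ^ n)) i \<in> N" using Ti[OF n] lm.V.submodule_zero[OF sN] by simp
    have cJ: "lie_bracket L c y \<in> J" if y: "y \<in> carrier L" for y
    proof -
      have "lie_bracket L y c \<in> J"
        unfolding c_def a_minus_def using y z Jc[OF j] zJ[OF y] Jid[OF y] j submoduleE(3)[OF Jsub]
        by (simp add: bracket_add_right submoduleE(5)[OF Jsub])
      then show ?thesis using y c submoduleE(3)[OF Jsub] by (simp add: bracket_antisym[of c y])
    qed
    \<comment> \<open>The kernel of c modulo \<open>N\<close>. It is a submodule because [c,L] lies
      in \<open>J\<close>, so c acts on the simple quotient by zero or injectively. Injectivity is
      excluded, as a power of c sends i into \<open>N\<close> although i is outside
      \<open>N\<close>.\<close>
    define M where "M = {v \<in> carrier V. ?A c v \<in> N}"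
    have "lm.stable M"
      unfolding lm.stable_def
    proof (intro conjI ballI)
      show "submodule M F V"
        unfolding M_def
        by (rule lm.V.submoduleI)
          (use c lm.V.submodule_zero[OF sN] lm.V.submoduleE(3-5)[OF sN] in
            \<open>auto simp: lm.act_minus_right lm.act_add_right lm.act_smult_right\<close>)
      fix y v assume y: "y \<in> carrier L" and "v \<in> M"
      then have v: "v \<in> carrier V" "?A c v \<in> N" by (auto simp: M_def)
      have "?A (lie_bracket L c y) v \<in> N" using cJ[OF y] v by (simp add: J_def)
      then have "?A c (?A y v) \<in> N"
        unfolding lm.act_swap[OF c y v(1)] using lm.V.submoduleE(5)[OF sN Nst[OF y v(2)]] by blast
      then show "?A y v \<in> M" using y v by (simp add: M_def lm.act_closed)
    qed
    moreover have "N \<subseteq> M" using Nc Nst c by (auto simp: M_def)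
    moreover have "M \<noteq> N"
    proof
      assume MN: "M = N"
      have "(?A c ^^ k) i \<notin> N" for k
      proof (induction k)
        case (Suc k)
        then show ?case using lm.act_iter_closed[OF c i(1)] MN by (auto simp: M_def)
      qed (simp add: i)
      then show False using ci by blast
    qed
    ultimately have "M = carrier V" using maxN by blast
    then have "c \<in> J" using c by (auto simp: J_def M_def)
    then have "c \<oplus>\<^bsub>L\<^esub> j \<in> J" using j submoduleE(5)[OF Jsub] by blast
    moreover have "c \<oplus>\<^bsub>L\<^esub> j = z" using z Jc[OF j] by (simp add: c_def a_minus_def M.a_assoc M.l_neg)
    ultimately show ?thesis by simp
  qed
  let ?D = "\<lambda>n. (lie_derived F L ^^ n) (carrier L)"
  have "carrier L \<subseteq> J"
  proof (rule ccontr)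
    assume nJ: "\<not> carrier L \<subseteq> J"
    obtain n where "?D n = {\<zero>\<^bsub>L\<^esub>}" using solv by (auto simp: lie_solvable_def)
    then have "?D n \<subseteq> J" using submodule_zero[OF Jsub] by simp
    then obtain k where k: "?D k \<subseteq> J" and least: "\<And>m. m < k \<Longrightarrow> \<not> ?D m \<subseteq> J"
      using exists_least_iff[of "\<lambda>n. ?D n \<subseteq> J"] by blast
    have "k \<noteq> 0" using k nJ by (metis funpow_0)
    then obtain k' where k': "k = Suc k'" using not0_implies_Suc by blast
    \<comment> \<open>Term k is the first one inside \<open>J\<close>, and k is positive because
      \<open>L\<close> itself is not inside. The preceding term \<open>K\<close> thus satisfies
      [K,K] \<subseteq> \<open>J\<close>.\<close>
    define K where "K = ?D k'"
    have idK: "lie_ideal K" unfolding K_def by (rule derived_series_lie_ideal)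
    have sK: "submodule K F L" and Kid: "\<And>x y. \<lbrakk>y \<in> carrier L; x \<in> K\<rbrakk> \<Longrightarrow> lie_bracket L y x \<in> K"
      using idK by (auto simp: lie_ideal_def)
    note Kc = submodule_carrier[OF sK]
    have KK: "lie_bracket L x y \<in> J" if "x \<in> K" "y \<in> K" for x y
      using derived_lie_ideal(2)[OF idK that] k by (auto simp: k' K_def)
    have KnJ: "\<not> K \<subseteq> J" using least[of k'] by (simp add: k' K_def)
    have nilp: "(?A x ^^ p) v \<in> N" if x: "x \<in> K" and v: "v \<in> carrier V" for x v
    proof -
      have "pmap L x \<in> J"
      proof (rule central)
        show px: "pmap L x \<in> carrier L" using x Kc pmap_closed by blast
        fix y assume y: "y \<in> carrier L"
        \<comment> \<open>The first application of ad x lands in the ideal \<open>K\<close>, the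
          second in [K,K] and so in \<open>J\<close>. As p >= 2, the operator ad(x^[p]) = (ad x)^p
          sends \<open>L\<close> into \<open>J\<close>, which is the hypothesis of
          \<open>central\<close>.\<close>
        have adJ: "(lie_bracket L x ^^ Suc (Suc m)) y \<in> J" for m
        proof (induction m)
          case 0
          have "lie_bracket L x y \<in> K"
            using Kid[OF y x] x y Kc submoduleE(3)[OF sK] by (simp add: bracket_antisym[of x y])
          then show ?case using KK[OF x] by simp
        next
          case (Suc m)
          then show ?case using Jid Kc[OF x] by simp
        qed
        obtain m where "p = Suc (Suc m)" using p_ge_2 by (metis add_2_eq_Suc le_Suc_ex)
        then have "lie_bracket L (pmap L x) y \<in> J" using adJ[of m] x y Kc by (simp add: ad_pmap)
        then show "lie_bracket L y (pmap L x) \<in> J"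
          using y px submoduleE(3)[OF Jsub] by (simp add: bracket_antisym[of y "pmap L x"])
      qed
      then show ?thesis using pow[OF Kc[OF x] v] v by (auto simp: J_def)
    qed
    obtain X where X: "finite X" "X \<subseteq> K" "K = lin_span F L X"
      using submodule_finitely_spanned[OF fdB(1,2) sK] Kc fdB(3) by blast
    \<comment> \<open>A common null vector modulo \<open>N\<close> is built along \<open>X\<close>:
      for a new x, take the last power of x applied to v that is still outside \<open>N\<close>.
      Elements of \<open>K\<close> commute in their action modulo \<open>N\<close>, so the earlier
      ones keep sending the vector into \<open>N\<close>.\<close>
    have "\<exists>v\<in>carrier V. v \<notin> N \<and> (\<forall>b\<in>X. ?A b v \<in> N)"
      using X(1,2)
    proof (induction X rule: finite_induct)
      case empty
      then show ?case using i by blast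
    next
      case (insert x X)
      then obtain v where v: "v \<in> carrier V" "v \<notin> N" "\<And>b. b \<in> X \<Longrightarrow> ?A b v \<in> N" by blast
      have x: "x \<in> K" and xc: "x \<in> carrier L" using insert Kc by auto
      have "\<exists>j<p. (\<forall>l\<le>j. (?A x ^^ l) v \<notin> N) \<and> (?A x ^^ Suc j) v \<in> N"
        using ex_least_nat_less[of "\<lambda>l. (?A x ^^ l) v \<in> N" p] nilp[OF x v(1)] v(2) by auto
      then obtain j where j: "(?A x ^^ j) v \<notin> N" "(?A x ^^ Suc j) v \<in> N" by blast
      have xv: "(?A x ^^ l) v \<in> carrier V" for l using lm.act_iter_closed[OF xc v(1)] .
      have "?A b ((?A x ^^ l) v) \<in> N" if b: "b \<in> X" for b l
      proof (induction l)
        case 0 then show ?case using v(3)[OF b] by simp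
      next
        case (Suc l)
        have bK: "b \<in> K" using b insert by auto
        have "?A (lie_bracket L b x) ((?A x ^^ l) v) \<in> N" using KK[OF bK x] xv by (simp add: J_def)
        then show ?case
          using lm.act_swap[OF Kc[OF bK] xc xv[of l]] lm.V.submoduleE(5)[OF sN] Nst[OF xc Suc] by simp
      qed
      then show ?case using j xv[of j] by (intro bexI[of _ "(?A x ^^ j) v"]) auto
    qed
    then obtain w where w: "w \<in> carrier V" "w \<notin> N" "\<And>b. b \<in> X \<Longrightarrow> ?A b w \<in> N" by blast
    \<comment> \<open>This common kernel modulo \<open>N\<close> is a submodule because
      \<open>K\<close> is an ideal, and w shows that it is strictly larger than
      \<open>N\<close>.\<close>
    define Q where "Q = {v \<in> carrier V. \<forall>b\<in>K. ?A b v \<in> N}"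
    have "lm.stable Q"
      unfolding lm.stable_def
    proof (intro conjI ballI)
      show "submodule Q F V"
        unfolding Q_def
        by (rule lm.V.submoduleI)
          (use Kc lm.V.submodule_zero[OF sN] lm.V.submoduleE(3-5)[OF sN] in
            \<open>auto simp: lm.act_minus_right lm.act_add_right lm.act_smult_right\<close>)
      fix y v assume y: "y \<in> carrier L" and "v \<in> Q"
      then have v: "v \<in> carrier V" "\<And>b. b \<in> K \<Longrightarrow> ?A b v \<in> N" by (auto simp: Q_def)
      have "?A b (?A y v) \<in> N" if b: "b \<in> K" for b
      proof -
        have "lie_bracket L b y \<in> K"
          using Kid[OF y b] y Kc[OF b] submoduleE(3)[OF sK] by (simp add: bracket_antisym[of b y])
        then show ?thesis
          unfolding lm.act_swap[OF Kc[OF b] y v(1)]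
          using lm.V.submoduleE(5)[OF sN Nst[OF y v(2)[OF b]] v(2)] by blast
      qed
      then show "?A y v \<in> Q" using y v(1) by (simp add: Q_def lm.act_closed)
    qed
    moreover have "N \<subseteq> Q" using Nc Nst Kc by (auto simp: Q_def)
    moreover have "w \<in> Q"
    proof -
      have "submodule {b \<in> carrier L. ?A b w \<in> N} F L"
        by (rule submoduleI)
          (use w(1) lm.V.submodule_zero[OF sN] lm.V.submoduleE(3-5)[OF sN] in
            \<open>auto simp: lm.act_minus_left lm.act_add_left lm.act_smult_left\<close>)
      moreover have "X \<subseteq> {b \<in> carrier L. ?A b w \<in> N}" using w X(2) Kc by blast
      ultimately have "K \<subseteq> {b \<in> carrier L. ?A b w \<in> N}" using lin_span_least X(3) by metis
      then show ?thesis using w(1) by (auto simp: Q_def)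
    qed
    ultimately have "Q = carrier V" using maxN w(2) by blast
    then have "K \<subseteq> J" using Kc by (auto simp: J_def Q_def)
    then show False using KnJ by blast
  qed
  then show ?thesis using x v by (auto simp: J_def)
qed

section \<open>The free algebra and its action\<close>

context ring
begin

definition convolution :: "('x list \<Rightarrow> 'a) \<Rightarrow> ('x list \<Rightarrow> 'a) \<Rightarrow> 'x list \<Rightarrow> 'a"
  where "convolution f g w = (\<Oplus>i\<in>{..length w}. f (take i w) \<otimes> g (drop i w))"

lemma convolution_closed:
  "\<lbrakk>\<And>w. f w \<in> carrier R; \<And>w. g w \<in> carrier R\<rbrakk> \<Longrightarrow> convolution f g w \<in> carrier R"
  by (auto simp: convolution_def intro!: finsum_closed)

lemma convolution_Nil:
  "\<lbrakk>f [] \<in> carrier R; g [] \<in> carrier R\<rbrakk> \<Longrightarrow> convolution f g [] = f [] \<otimes> g []"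
  by (simp add: convolution_def)

text \<open>Splitting off the empty prefix leaves a convolution with the shifted function v -> f (x
  # v). This recursion on the word replaces the rearrangement of double sums over cut
  positions.\<close>

lemma convolution_Cons:
  assumes "\<And>w. f w \<in> carrier R" "\<And>w. g w \<in> carrier R"
  shows "convolution f g (x # w) = f [] \<otimes> g (x # w) \<oplus> convolution (\<lambda>v. f (x # v)) g w"
proof -
  have "convolution f g (x # w) =
      (\<Oplus>i\<in>{..length w}. f (take (Suc i) (x # w)) \<otimes> g (drop (Suc i) (x # w))) \<oplus> f [] \<otimes> g (x # w)"
    unfolding convolution_def list.size(4) add_Suc_right add_0_right
    by (subst finsum_Suc2) (auto simp: assms)
  then show ?thesis
    using assms by (simp add: convolution_def a_comm finsum_closed)
qed

lemma convolution_zero_left: "(\<And>w. g w \<in> carrier R) \<Longrightarrow> convolution (\<lambda>v. \<zero>) g w = \<zero>"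
  by (simp add: convolution_def finsum_zero)

lemma convolution_add_left:
  assumes "\<And>w. f w \<in> carrier R" "\<And>w. f' w \<in> carrier R" "\<And>w. g w \<in> carrier R"
  shows "convolution (\<lambda>v. f v \<oplus> f' v) g w = convolution f g w \<oplus> convolution f' g w"
  unfolding convolution_def using assms
  by (subst finsum_addf[symmetric]) (auto simp: l_distr intro!: finsum_cong')

lemma convolution_add_right:
  assumes "\<And>w. f w \<in> carrier R" "\<And>w. g w \<in> carrier R" "\<And>w. g' w \<in> carrier R"
  shows "convolution f (\<lambda>v. g v \<oplus> g' v) w = convolution f g w \<oplus> convolution f g' w"
  unfolding convolution_def using assms
  by (subst finsum_addf[symmetric]) (auto simp: r_distr intro!: finsum_cong')

lemma convolution_smult_left:
  assumes "\<And>w. f w \<in> carrier R" "\<And>w. g w \<in> carrier R" "a \<in> carrier R"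
  shows "convolution (\<lambda>v. a \<otimes> f v) g w = a \<otimes> convolution f g w"
  unfolding convolution_def using assms
  by (subst finsum_rdistr) (auto simp: m_assoc intro!: finsum_cong')

text \<open>Induction on the word with f arbitrary, since the recursion replaces f by its
  shift.\<close>

lemma convolution_assoc:
  assumes "\<And>w. f w \<in> carrier R" "\<And>w. g w \<in> carrier R" "\<And>w. h w \<in> carrier R"
  shows "convolution (convolution f g) h w = convolution f (convolution g h) w"
  using assms(1)
proof (induction w arbitrary: f)
  case Nil
  then show ?case using assms by (simp add: convolution_Nil convolution_closed m_assoc)
next
  case (Cons x w)
  note cl = Cons.prems assms(2,3) convolution_closed
  have "convolution (convolution f g) h (x # w) =
      f [] \<otimes> g [] \<otimes> h (x # w) \<oplus> convolution (\<lambda>v. f [] \<otimes> g (x # v) \<oplus> convolution (\<lambda>u. f (x # u)) g v) h w"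
    by (simp add: convolution_Cons convolution_Nil cl)
  also have "\<dots> = f [] \<otimes> g [] \<otimes> h (x # w) \<oplus> (f [] \<otimes> convolution (\<lambda>v. g (x # v)) h w
      \<oplus> convolution (\<lambda>v. f (x # v)) (convolution g h) w)"
    using Cons.IH[of "\<lambda>v. f (x # v)"]
    by (simp add: convolution_add_left convolution_smult_left cl)
  also have "\<dots> = convolution f (convolution g h) (x # w)"
    by (simp add: convolution_Cons cl r_distr m_assoc a_assoc)
  finally show ?case .
qed

abbreviation FA :: "'x set \<Rightarrow> ('x list \<Rightarrow> 'a) ring"
  where "FA X \<equiv> free_algebra R X"

lemma free_algebra_sel [simp]:
  "monoid.mult (FA X) = convolution" "add (FA X) f g = (\<lambda>w. f w \<oplus> g w)"
  "zero (FA X) = (\<lambda>w. \<zero>)" "one (FA X) = (\<lambda>w. if w = [] then \<one> else \<zero>)"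
  by (auto simp: free_algebra_def convolution_def fun_eq_iff)

lemma free_algebra_carrier:
  "f \<in> carrier (FA X) \<longleftrightarrow>
    (\<forall>w. f w \<in> carrier R) \<and> finite {w. f w \<noteq> \<zero>} \<and> {w. f w \<noteq> \<zero>} \<subseteq> lists X"
  by (auto simp: free_algebra_def)

lemma free_algebra_support: "\<lbrakk>f \<in> carrier (FA X); f w \<noteq> \<zero>\<rbrakk> \<Longrightarrow> w \<in> lists X"
  by (auto simp only: free_algebra_carrier)

lemma free_algebra_closed: "f \<in> carrier (FA X) \<Longrightarrow> f w \<in> carrier R"
  by (simp add: free_algebra_carrier)

lemma free_algebra_carrierI:
  assumes "\<And>w. f w \<in> carrier R" "finite S" "S \<subseteq> lists X" "\<And>w. w \<notin> S \<Longrightarrow> f w = \<zero>"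
  shows "f \<in> carrier (FA X)"
proof -
  have "{w. f w \<noteq> \<zero>} \<subseteq> S" using assms(4) by blast
  then show ?thesis using assms(1-3) finite_subset unfolding free_algebra_carrier by blast
qed

lemma convolution_in_free_algebra:
  assumes f: "f \<in> carrier (FA X)" and g: "g \<in> carrier (FA X)"
  shows "convolution f g \<in> carrier (FA X)"
proof (rule free_algebra_carrierI)
  let ?S = "(\<lambda>(u, v). u @ v) ` ({w. f w \<noteq> \<zero>} \<times> {w. g w \<noteq> \<zero>})"
  show "finite ?S" using f g by (auto simp: free_algebra_carrier)
  show "?S \<subseteq> lists X" using free_algebra_support[OF f] free_algebra_support[OF g] by fastforce
  show "convolution f g w \<in> carrier R" for w
    using f g by (intro convolution_closed) (auto simp: free_algebra_closed)
  fix w assume w: "w \<notin> ?S"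
  have "f (take i w) \<otimes> g (drop i w) = \<zero>" for i
  proof -
    have "f (take i w) = \<zero> \<or> g (drop i w) = \<zero>"
      using w by (force simp: image_iff)
    then show ?thesis using f g by (auto simp: free_algebra_closed)
  qed
  then show "convolution f g w = \<zero>" by (simp add: convolution_def finsum_zero)
qed

lemma free_scalar_closed: "c \<in> carrier R \<Longrightarrow> free_scalar R c \<in> carrier (FA X)"
  by (rule free_algebra_carrierI[of _ "{[]}"]) (auto simp: free_scalar_def)

lemma free_gen_closed: "x \<in> X \<Longrightarrow> free_gen R x \<in> carrier (FA X)"
  by (rule free_algebra_carrierI[of _ "{[x]}"]) (auto simp: free_gen_def)

lemma free_scalar_mult:
  assumes "c \<in> carrier R" "\<And>w. f w \<in> carrier R"
  shows "convolution (free_scalar R c) f = (\<lambda>w. c \<otimes> f w)"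
proof
  fix w show "convolution (free_scalar R c) f w = c \<otimes> f w"
    using assms
    by (cases w) (simp_all add: convolution_Nil convolution_Cons free_scalar_def convolution_zero_left)
qed

lemma mult_free_scalar:
  assumes "c \<in> carrier R" "\<And>w. f w \<in> carrier R"
  shows "convolution f (free_scalar R c) = (\<lambda>w. f w \<otimes> c)"
proof
  fix w show "convolution f (free_scalar R c) w = f w \<otimes> c"
    using assms(2)
  proof (induction w arbitrary: f)
    case (Cons x w)
    then show ?case using assms(1) by (simp add: convolution_Cons free_scalar_def)
  qed (simp add: convolution_Nil free_scalar_def assms)
qed

lemma free_gen_mult:
  assumes "\<And>w. f w \<in> carrier R"
  shows "convolution (free_gen R x) f = (\<lambda>w. if w \<noteq> [] \<and> hd w = x then f (tl w) else \<zero>)"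
proof
  fix w show "convolution (free_gen R x) f w = (if w \<noteq> [] \<and> hd w = x then f (tl w) else \<zero>)"
  proof (cases w)
    case (Cons y v)
    have "(\<lambda>u. free_gen R x (y # u)) = (if y = x then free_scalar R \<one> else (\<lambda>u. \<zero>))"
      by (auto simp: free_gen_def free_scalar_def fun_eq_iff)
    moreover have "free_gen R x u \<in> carrier R" "free_gen R x [] = \<zero>" for u
      by (simp_all add: free_gen_def)
    ultimately show ?thesis
      using assms Cons by (simp add: convolution_Cons free_scalar_mult convolution_zero_left)
  qed (use assms in \<open>simp add: convolution_Nil free_gen_def\<close>)
qed

lemma free_algebra_uminus:
  assumes "f \<in> carrier (FA X)"
  shows "(\<lambda>w. \<ominus> f w) \<in> carrier (FA X)"
  using assms by (intro free_algebra_carrierI[of _ "{w. f w \<noteq> \<zero>}"]) (auto simp: free_algebra_carrier)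

lemma free_algebra_add:
  assumes "f \<in> carrier (FA X)" "g \<in> carrier (FA X)"
  shows "(\<lambda>w. f w \<oplus> g w) \<in> carrier (FA X)"
  using assms
  by (intro free_algebra_carrierI[of _ "{w. f w \<noteq> \<zero>} \<union> {w. g w \<noteq> \<zero>}"]) (auto simp: free_algebra_carrier)

lemma free_algebra_zero: "(\<lambda>w. \<zero>) \<in> carrier (FA X)"
  by (rule free_algebra_carrierI[of _ "{}"]) auto

lemma free_algebra_ring: "ring (FA X)"
proof (rule ringI)
  show "abelian_group (FA X)"
    by (rule abelian_groupI)
      (auto simp: free_algebra_add free_algebra_zero free_algebra_closed a_ac l_neg r_neg fun_eq_iff
        intro!: bexI[OF _ free_algebra_uminus])
  have one: "(\<lambda>w. if w = [] then \<one> else \<zero>) = free_scalar R \<one>" by (simp add: free_scalar_def)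
  show "monoid (FA X)"
    by (rule monoidI)
      (auto simp: one convolution_in_free_algebra free_scalar_closed free_scalar_mult mult_free_scalar
        convolution_assoc free_algebra_closed fun_eq_iff)
qed (auto simp: free_algebra_closed convolution_add_left convolution_add_right fun_eq_iff)

lemma free_algebra_minus:
  assumes f: "f \<in> carrier (FA X)" and g: "g \<in> carrier (FA X)"
  shows "f \<ominus>\<^bsub>FA X\<^esub> g = (\<lambda>w. f w \<ominus> g w)"
proof -
  interpret A: ring "FA X" by (rule free_algebra_ring)
  have "\<ominus>\<^bsub>FA X\<^esub> g = (\<lambda>w. \<ominus> g w)"
    using g by (intro A.minus_equality) (auto simp: free_algebra_uminus free_algebra_closed l_neg)
  then show ?thesis by (simp add: a_minus_def)
qed

text \<open>An element is a finite combination of words, and a word arises from 1 by multiplying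
  with its letters from the left. That only left multiplications occur suits statements about left
  modules.\<close>

lemma free_algebra_induct [consumes 1, case_names zero one add smult gen]:
  assumes f: "f \<in> carrier (FA X)"
    and zero: "P \<zero>\<^bsub>FA X\<^esub>" and one: "P \<one>\<^bsub>FA X\<^esub>"
    and add: "\<And>f g. \<lbrakk>f \<in> carrier (FA X); g \<in> carrier (FA X); P f; P g\<rbrakk> \<Longrightarrow> P (f \<oplus>\<^bsub>FA X\<^esub> g)"
    and smult: "\<And>c f. \<lbrakk>c \<in> carrier R; f \<in> carrier (FA X); P f\<rbrakk> \<Longrightarrow> P (free_scalar R c \<otimes>\<^bsub>FA X\<^esub> f)"
    and gen: "\<And>x f. \<lbrakk>x \<in> X; f \<in> carrier (FA X); P f\<rbrakk> \<Longrightarrow> P (free_gen R x \<otimes>\<^bsub>FA X\<^esub> f)"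
  shows "P f"
proof -
  let ?m = "\<lambda>w v. if v = w then \<one> else \<zero>"
  have mc: "?m w \<in> carrier (FA X)" if "w \<in> lists X" for w
    using that by (intro free_algebra_carrierI[of _ "{w}"]) auto
  have mono: "P (?m w)" if "w \<in> lists X" for w
    using that
  proof (induction w)
    case Nil
    then show ?case using one by simp
  next
    case (Cons x w)
    have "?m (x # w) = free_gen R x \<otimes>\<^bsub>FA X\<^esub> ?m w"
      by (auto simp: free_gen_mult fun_eq_iff neq_Nil_conv)
    then show ?case using gen[OF Cons.hyps(1) mc Cons.IH] Cons.hyps(2) by simp
  qed
  have "P f" if "finite S" "S \<subseteq> lists X" "f \<in> carrier (FA X)" "{w. f w \<noteq> \<zero>} \<subseteq> S" for f S
    using that
  proof (induction S arbitrary: f rule: finite_induct)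
    case empty
    then have "f = \<zero>\<^bsub>FA X\<^esub>" by (auto simp: fun_eq_iff)
    then show ?case using zero by simp
  next
    case (insert w S)
    let ?g = "f(w := \<zero>)"
    have g: "?g \<in> carrier (FA X)"
      using insert by (intro free_algebra_carrierI[of _ S]) (auto simp: free_algebra_closed)
    have w: "w \<in> lists X" using insert by auto
    have fw: "f w \<in> carrier R" using insert free_algebra_closed by blast
    have "f = free_scalar R (f w) \<otimes>\<^bsub>FA X\<^esub> ?m w \<oplus>\<^bsub>FA X\<^esub> ?g"
      using fw insert.prems free_algebra_closed[of f X] by (auto simp: free_scalar_mult fun_eq_iff)
    moreover have "P (free_scalar R (f w) \<otimes>\<^bsub>FA X\<^esub> ?m w)" using smult[OF fw mc[OF w] mono[OF w]] .
    moreover have "P ?g" by (rule insert.IH[OF _ g]) (use insert.prems in auto)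
    moreover have "free_scalar R (f w) \<otimes>\<^bsub>FA X\<^esub> ?m w \<in> carrier (FA X)"
      using convolution_in_free_algebra[OF free_scalar_closed[OF fw] mc[OF w]] by simp
    ultimately show ?case using add g by metis
  qed
  then show ?thesis using f by (auto simp: free_algebra_carrier)
qed

end

text \<open>Linear operators indexed by \<open>X\<close> with no relations among them, that is, a
  module over the free algebra on \<open>X\<close>. The relations of a Lie algebra come in when the
  action is passed to the quotient.\<close>

locale operator_module = field F + module F V
  for F :: "('k, 'n) ring_scheme" (structure) and V :: "('k, 'l, 'v, 'w) lie_mod_scheme" (structure)
    and X :: "'l set" +
  assumes op_closed: "\<lbrakk>x \<in> X; v \<in> carrier V\<rbrakk> \<Longrightarrow> act V x v \<in> carrier V"
    and op_add: "\<lbrakk>x \<in> X; v \<in> carrier V; w \<in> carrier V\<rbrakk> \<Longrightarrow>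
      act V x (v \<oplus>\<^bsub>V\<^esub> w) = act V x v \<oplus>\<^bsub>V\<^esub> act V x w"
    and op_smult: "\<lbrakk>a \<in> carrier F; x \<in> X; v \<in> carrier V\<rbrakk> \<Longrightarrow>
      act V x (a \<odot>\<^bsub>V\<^esub> v) = a \<odot>\<^bsub>V\<^esub> act V x v"
begin

lemma word_closed: "\<lbrakk>w \<in> lists X; v \<in> carrier V\<rbrakk> \<Longrightarrow> foldr (act V) w v \<in> carrier V"
  by (induction w) (auto simp: op_closed)

lemma word_action_superset:
  assumes "finite A" "{w. f w \<noteq> \<zero>} \<subseteq> A" "A \<subseteq> lists X" "\<And>w. f w \<in> carrier F" "v \<in> carrier V"
  shows "word_action F V f v = (\<Oplus>\<^bsub>V\<^esub>w\<in>A. f w \<odot>\<^bsub>V\<^esub> foldr (act V) w v)"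
proof -
  have "foldr (act V) w v \<in> carrier V" if "w \<in> A" for w using that assms(3,5) word_closed by blast
  then show ?thesis
    unfolding word_action_def
    by (intro M.add.finprod_mono_neutral_cong_left) (use assms in auto)
qed

lemma word_action_closed:
  assumes "f \<in> carrier (FA X)" "v \<in> carrier V"
  shows "word_action F V f v \<in> carrier V"
proof -
  have "foldr (act V) w v \<in> carrier V" if "f w \<noteq> \<zero>" for w
    using free_algebra_support[OF assms(1) that] assms(2) by (rule word_closed)
  then show ?thesis
    unfolding word_action_def using free_algebra_closed[OF assms(1)]
    by (intro M.finsum_closed) auto
qed

lemma op_finsum:
  assumes x: "x \<in> X" and f: "f \<in> A \<rightarrow> carrier V" and A: "finite A"
  shows "act V x (\<Oplus>\<^bsub>V\<^esub>w\<in>A. f w) = (\<Oplus>\<^bsub>V\<^esub>w\<in>A. act V x (f w))"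
  using A f
proof (induction A rule: finite_induct)
  case empty
  then show ?case using op_smult[of \<zero> x "\<zero>\<^bsub>V\<^esub>"] x op_closed by simp
next
  case (insert a A)
  then have "(\<lambda>w. act V x (f w)) \<in> A \<rightarrow> carrier V" using x op_closed by auto
  with insert show ?case using x by (simp add: op_add op_closed M.finsum_closed)
qed

lemma word_action_zero: "word_action F V \<zero>\<^bsub>FA X\<^esub> v = \<zero>\<^bsub>V\<^esub>"
  by (simp add: word_action_def)

lemma word_action_one: "v \<in> carrier V \<Longrightarrow> word_action F V \<one>\<^bsub>FA X\<^esub> v = v"
  by (subst word_action_superset[of "{[]}"]) auto

lemma word_action_add:
  assumes f: "f \<in> carrier (FA X)" and g: "g \<in> carrier (FA X)" and v: "v \<in> carrier V"
  shows "word_action F V (f \<oplus>\<^bsub>FA X\<^esub> g) v = word_action F V f v \<oplus>\<^bsub>V\<^esub> word_action F V g v"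
proof -
  let ?A = "{w. f w \<noteq> \<zero>} \<union> {w. g w \<noteq> \<zero>}"
  have A: "finite ?A" "?A \<subseteq> lists X" using f g by (auto simp: free_algebra_carrier)
  have c: "\<And>w. f w \<in> carrier F" "\<And>w. g w \<in> carrier F" using f g free_algebra_closed by blast+
  have w: "foldr (act V) w v \<in> carrier V" if "w \<in> ?A" for w using that A(2) word_closed v by blast
  have "word_action F V (f \<oplus>\<^bsub>FA X\<^esub> g) v = (\<Oplus>\<^bsub>V\<^esub>w\<in>?A. (f w \<oplus> g w) \<odot>\<^bsub>V\<^esub> foldr (act V) w v)"
    using c v A by (subst word_action_superset[of ?A]) auto
  also have "\<dots> = (\<Oplus>\<^bsub>V\<^esub>w\<in>?A. f w \<odot>\<^bsub>V\<^esub> foldr (act V) w v \<oplus>\<^bsub>V\<^esub> g w \<odot>\<^bsub>V\<^esub> foldr (act V) w v)"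
    using c w by (intro M.finsum_cong') (auto simp: smult_l_distr)
  also have "\<dots> = (\<Oplus>\<^bsub>V\<^esub>w\<in>?A. f w \<odot>\<^bsub>V\<^esub> foldr (act V) w v) \<oplus>\<^bsub>V\<^esub> (\<Oplus>\<^bsub>V\<^esub>w\<in>?A. g w \<odot>\<^bsub>V\<^esub> foldr (act V) w v)"
    using c w by (intro M.finsum_addf) auto
  also have "\<dots> = word_action F V f v \<oplus>\<^bsub>V\<^esub> word_action F V g v"
    using c v A by (subst (1 2) word_action_superset[of ?A]) auto
  finally show ?thesis .
qed

lemma word_action_scalar:
  assumes f: "f \<in> carrier (FA X)" and a: "a \<in> carrier F" and v: "v \<in> carrier V"
  shows "word_action F V (free_scalar F a \<otimes>\<^bsub>FA X\<^esub> f) v = a \<odot>\<^bsub>V\<^esub> word_action F V f v"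
proof -
  let ?A = "{w. f w \<noteq> \<zero>}"
  have A: "finite ?A" "?A \<subseteq> lists X" using f by (auto simp: free_algebra_carrier)
  have c: "\<And>w. f w \<in> carrier F" using f free_algebra_closed by blast
  have w: "foldr (act V) w v \<in> carrier V" if "w \<in> ?A" for w using that A(2) word_closed v by blast
  have "word_action F V (free_scalar F a \<otimes>\<^bsub>FA X\<^esub> f) v = (\<Oplus>\<^bsub>V\<^esub>w\<in>?A. (a \<otimes> f w) \<odot>\<^bsub>V\<^esub> foldr (act V) w v)"
    using c v A a by (subst word_action_superset[of ?A]) (auto simp: free_scalar_mult)
  also have "\<dots> = (\<Oplus>\<^bsub>V\<^esub>w\<in>?A. a \<odot>\<^bsub>V\<^esub> (f w \<odot>\<^bsub>V\<^esub> foldr (act V) w v))"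
    using c w a by (intro M.finsum_cong') (auto simp: smult_assoc1)
  also have "\<dots> = a \<odot>\<^bsub>V\<^esub> word_action F V f v"
    unfolding word_action_def using c w a A by (intro finsum_smult_ldistr[symmetric]) auto
  finally show ?thesis .
qed

text \<open>Left multiplication by x turns each word w into x # w, so the sum over the support is
  reindexed along \<open>Cons x\<close>.\<close>

lemma word_action_gen_mult:
  assumes f: "f \<in> carrier (FA X)" and x: "x \<in> X" and v: "v \<in> carrier V"
  shows "word_action F V (free_gen F x \<otimes>\<^bsub>FA X\<^esub> f) v = act V x (word_action F V f v)"
proof -
  let ?A = "{w. f w \<noteq> \<zero>}"
  have A: "finite ?A" "?A \<subseteq> lists X" using f by (auto simp: free_algebra_carrier)
  have c: "\<And>w. f w \<in> carrier F" using f free_algebra_closed by blast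
  have w: "foldr (act V) w v \<in> carrier V" if "w \<in> ?A" for w using that A(2) word_closed v by blast
  let ?h = "\<lambda>w. if w \<noteq> [] \<and> hd w = x then f (tl w) else \<zero>"
  have inj: "inj_on (Cons x) ?A" by simp
  have "word_action F V (free_gen F x \<otimes>\<^bsub>FA X\<^esub> f) v = (\<Oplus>\<^bsub>V\<^esub>w\<in>Cons x ` ?A. ?h w \<odot>\<^bsub>V\<^esub> foldr (act V) w v)"
  proof (subst word_action_superset[of "Cons x ` ?A"])
    show "{w. (free_gen F x \<otimes>\<^bsub>FA X\<^esub> f) w \<noteq> \<zero>} \<subseteq> Cons x ` ?A"
      using c by (auto simp: free_gen_mult image_iff split: if_splits) (metis list.collapse)
    show "Cons x ` ?A \<subseteq> lists X" using free_algebra_support[OF f] x by fastforce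
  qed (use c v A in \<open>auto simp: free_gen_mult\<close>)
  also have "\<dots> = (\<Oplus>\<^bsub>V\<^esub>w\<in>?A. f w \<odot>\<^bsub>V\<^esub> act V x (foldr (act V) w v))"
    using c w x op_closed by (subst M.add.finprod_reindex[OF _ inj]) (auto intro!: M.finsum_cong')
  also have "\<dots> = (\<Oplus>\<^bsub>V\<^esub>w\<in>?A. act V x (f w \<odot>\<^bsub>V\<^esub> foldr (act V) w v))"
    using c w x op_closed by (intro M.finsum_cong') (auto simp: op_smult)
  also have "\<dots> = act V x (word_action F V f v)"
    unfolding word_action_def using c w x A by (intro op_finsum[symmetric]) auto
  finally show ?thesis .
qed

lemma word_action_gen: "\<lbrakk>x \<in> X; v \<in> carrier V\<rbrakk> \<Longrightarrow> word_action F V (free_gen F x) v = act V x v"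
proof -
  assume x: "x \<in> X" and v: "v \<in> carrier V"
  interpret A: ring "FA X" by (rule free_algebra_ring)
  show ?thesis
    using word_action_gen_mult[OF A.one_closed x v] word_action_one[OF v]
      A.r_one[OF free_gen_closed[OF x]] by simp
qed

lemma word_action_free_scalar:
  "\<lbrakk>a \<in> carrier F; v \<in> carrier V\<rbrakk> \<Longrightarrow> word_action F V (free_scalar F a) v = a \<odot>\<^bsub>V\<^esub> v"
proof -
  assume a: "a \<in> carrier F" and v: "v \<in> carrier V"
  interpret A: ring "FA X" by (rule free_algebra_ring)
  show ?thesis
    using word_action_scalar[OF A.one_closed a v] word_action_one[OF v]
      A.r_one[OF free_scalar_closed[OF a]] by simp
qed

lemma word_action_mult:
  assumes f: "f \<in> carrier (FA X)" and g: "g \<in> carrier (FA X)" and v: "v \<in> carrier V"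
  shows "word_action F V (f \<otimes>\<^bsub>FA X\<^esub> g) v = word_action F V f (word_action F V g v)"
proof -
  interpret A: ring "FA X" by (rule free_algebra_ring)
  note gv = word_action_closed[OF g v]
  show ?thesis
    using f
  proof (induction f rule: free_algebra_induct)
    case zero
    show ?case using A.l_null[OF g] word_action_zero by metis
  next
    case one
    show ?case using A.l_one[OF g] word_action_one[OF gv] by metis
  next
    case (add f f')
    then show ?case
      using word_action_add[OF A.m_closed[OF add(1) g] A.m_closed[OF add(2) g] v]
        word_action_add[OF add(1,2) gv] A.l_distr[OF add(1,2) g] by metis
  next
    case (smult c f)
    then show ?case
      using word_action_scalar[OF A.m_closed[OF smult(2) g] smult(1) v]
        word_action_scalar[OF smult(2,1) gv] A.m_assoc[OF free_scalar_closed[OF smult(1)] smult(2) g] by metis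
  next
    case (gen x f)
    then show ?case
      using word_action_gen_mult[OF A.m_closed[OF gen(2) g] gen(1) v]
        word_action_gen_mult[OF gen(2,1) gv] A.m_assoc[OF free_gen_closed[OF gen(1)] gen(2) g] by metis
  qed
qed

lemma word_action_add_right:
  assumes f: "f \<in> carrier (FA X)" and v: "v \<in> carrier V" and w: "w \<in> carrier V"
  shows "word_action F V f (v \<oplus>\<^bsub>V\<^esub> w) = word_action F V f v \<oplus>\<^bsub>V\<^esub> word_action F V f w"
proof -
  have vw: "v \<oplus>\<^bsub>V\<^esub> w \<in> carrier V" using v w by simp
  show ?thesis
    using f
  proof (induction f rule: free_algebra_induct)
    case zero
    show ?case by (simp add: word_action_zero del: free_algebra_sel)
  next
    case one
    show ?case using v w by (simp add: word_action_one del: free_algebra_sel)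
  next
    case (add f g)
    then show ?case
      using v w word_action_closed[of f] word_action_closed[of g]
      by (simp add: word_action_add M.a_ac del: free_algebra_sel)
  next
    case (smult c f)
    then show ?case
      using v w word_action_closed[of f] by (simp add: word_action_scalar smult_r_distr del: free_algebra_sel)
  next
    case (gen x f)
    then show ?case
      using v w word_action_closed[of f] by (simp add: word_action_gen_mult op_add del: free_algebra_sel)
  qed
qed

end

context ring
begin
declare free_algebra_sel [simp del]
end

section \<open>Reduced enveloping algebras\<close>

text \<open>The assumptions ensure that the relations defining u(L,\<chi>) are formed from elements
  of the algebras involved. A p-subalgebra \<open>H\<close> with the restricted form inherits them,
  so the same facts hold for u(H,\<chi>|H).\<close>

locale reduced_env = lie_algebra F L
  for p :: nat and F :: "('k, 'n) ring_scheme" (structure)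
    and L :: "('k, 'l, 'm) rlie_scheme" (structure) and \<chi> :: "'l \<Rightarrow> 'k" +
  assumes pmap_in: "x \<in> carrier L \<Longrightarrow> pmap L x \<in> carrier L"
    and chi_in: "x \<in> carrier L \<Longrightarrow> \<chi> x \<in> carrier F"
begin

abbreviation A where "A \<equiv> FA (carrier L)"
abbreviation U where "U \<equiv> univ_env F L"
abbreviation R where "R \<equiv> red_env p F L \<chi>"
abbreviation cls where "cls \<equiv> red_class p F L \<chi>"
abbreviation gen where "gen x \<equiv> cls (free_gen F x)"
abbreviation scal where "scal c \<equiv> cls (free_scalar F c)"

sublocale A: ring A by (rule free_algebra_ring)

lemma env_ideal: "ideal (env_ideal F L) A"
  unfolding env_ideal_def Let_def
  by (rule A.genideal_ideal)
    (auto intro!: A.minus_closed A.m_closed A.a_closed free_gen_closed free_scalar_closed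
      bracket_closed smult_closed)

sublocale U: ring U
  unfolding univ_env_def by (rule ideal.quotient_is_ring[OF env_ideal])

lemma env_class_hom: "env_class F L \<in> ring_hom A U"
proof -
  have "env_class F L = (+>\<^bsub>A\<^esub>) (env_ideal F L)" by (simp add: env_class_def fun_eq_iff)
  then show ?thesis unfolding univ_env_def by (simp add: ideal.rcos_ring_hom[OF env_ideal])
qed

sublocale env: ring_hom_ring A U "env_class F L"
  by (rule ring_hom_ringI2) (simp_all add: A.ring_axioms U.ring_axioms env_class_hom)

lemma red_env_ideal: "ideal (red_env_ideal p F L \<chi>) U"
  unfolding red_env_ideal_def Let_def
  by (rule U.genideal_ideal)
    (auto intro!: U.minus_closed U.nat_pow_closed env.hom_closed free_gen_closed free_scalar_closed
      pmap_in chi_in nat_pow_closed)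

sublocale R: ring R
  unfolding red_env_def by (rule ideal.quotient_is_ring[OF red_env_ideal])

lemma red_class_hom: "cls \<in> ring_hom A R"
proof -
  have "(+>\<^bsub>U\<^esub>) (red_env_ideal p F L \<chi>) \<in> ring_hom U R"
    unfolding red_env_def by (rule ideal.rcos_ring_hom[OF red_env_ideal])
  then have "(+>\<^bsub>U\<^esub>) (red_env_ideal p F L \<chi>) \<circ> env_class F L \<in> ring_hom A R"
    by (rule ring_hom_trans[OF env_class_hom])
  moreover have "(+>\<^bsub>U\<^esub>) (red_env_ideal p F L \<chi>) \<circ> env_class F L = cls"
    by (simp add: red_class_def fun_eq_iff)
  ultimately show ?thesis by simp
qed

sublocale cls: ring_hom_ring A R cls
  by (rule ring_hom_ringI2) (simp_all add: A.ring_axioms R.ring_axioms red_class_hom)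

lemma red_class_surj:
  assumes "r \<in> carrier R"
  obtains f where "f \<in> carrier A" "r = cls f"
  using assms that
  by (auto simp: red_env_def univ_env_def FactRing_def A_RCOSETS_def' red_class_def env_class_def)

lemma gen_closed: "x \<in> carrier L \<Longrightarrow> gen x \<in> carrier R"
  by (simp add: free_gen_closed)

lemma scal_closed: "c \<in> carrier F \<Longrightarrow> scal c \<in> carrier R"
  by (simp add: free_scalar_closed)

lemma red_class_eqI:
  assumes "f \<in> carrier A" "g \<in> carrier A" "f \<ominus>\<^bsub>A\<^esub> g \<in> env_ideal F L"
  shows "cls f = cls g"
proof -
  have "env_class F L f = env_class F L g"
    using A.quotient_eq_iff_same_a_r_cos[OF env_ideal assms(1,2)] assms(3) by (simp add: env_class_def)
  then show ?thesis by (simp add: red_class_def)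
qed

lemma gen_add:
  assumes "x \<in> carrier L" "y \<in> carrier L"
  shows "gen (x \<oplus>\<^bsub>L\<^esub> y) = gen x \<oplus>\<^bsub>R\<^esub> gen y"
proof -
  have "cls (free_gen F (x \<oplus>\<^bsub>L\<^esub> y)) = cls (free_gen F x \<oplus>\<^bsub>A\<^esub> free_gen F y)"
  proof (rule red_class_eqI)
    show "free_gen F (x \<oplus>\<^bsub>L\<^esub> y) \<ominus>\<^bsub>A\<^esub> (free_gen F x \<oplus>\<^bsub>A\<^esub> free_gen F y) \<in> env_ideal F L"
      unfolding env_ideal_def Let_def genideal_def
      by (intro InterI) (elim CollectE conjE subsetD, use assms in blast)
  qed (use assms in \<open>simp_all add: free_gen_closed\<close>)
  then show ?thesis using assms by (simp add: free_gen_closed)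
qed

lemma gen_smult:
  assumes "c \<in> carrier F" "x \<in> carrier L"
  shows "gen (c \<odot>\<^bsub>L\<^esub> x) = scal c \<otimes>\<^bsub>R\<^esub> gen x"
proof -
  have "cls (free_gen F (c \<odot>\<^bsub>L\<^esub> x)) = cls (free_scalar F c \<otimes>\<^bsub>A\<^esub> free_gen F x)"
  proof (rule red_class_eqI)
    show "free_gen F (c \<odot>\<^bsub>L\<^esub> x) \<ominus>\<^bsub>A\<^esub> free_scalar F c \<otimes>\<^bsub>A\<^esub> free_gen F x \<in> env_ideal F L"
      unfolding env_ideal_def Let_def genideal_def using assms by blast
  qed (use assms in \<open>simp_all add: free_gen_closed free_scalar_closed\<close>)
  then show ?thesis using assms by (simp add: free_gen_closed free_scalar_closed)
qed

lemma cls_minus: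
  "\<lbrakk>f \<in> carrier A; g \<in> carrier A\<rbrakk> \<Longrightarrow> cls (f \<ominus>\<^bsub>A\<^esub> g) = cls f \<ominus>\<^bsub>R\<^esub> cls g"
  by (simp add: a_minus_def)

lemma gen_bracket:
  assumes "x \<in> carrier L" "y \<in> carrier L"
  shows "gen (lie_bracket L x y) = gen x \<otimes>\<^bsub>R\<^esub> gen y \<ominus>\<^bsub>R\<^esub> gen y \<otimes>\<^bsub>R\<^esub> gen x"
proof -
  have "cls (free_gen F x \<otimes>\<^bsub>A\<^esub> free_gen F y \<ominus>\<^bsub>A\<^esub> free_gen F y \<otimes>\<^bsub>A\<^esub> free_gen F x) =
      cls (free_gen F (lie_bracket L x y))"
  proof (rule red_class_eqI)
    show "free_gen F x \<otimes>\<^bsub>A\<^esub> free_gen F y \<ominus>\<^bsub>A\<^esub> free_gen F y \<otimes>\<^bsub>A\<^esub> free_gen F x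
        \<ominus>\<^bsub>A\<^esub> free_gen F (lie_bracket L x y) \<in> env_ideal F L"
      unfolding env_ideal_def Let_def genideal_def using assms by blast
  qed (use assms in \<open>simp_all add: free_gen_closed bracket_closed\<close>)
  then show ?thesis using assms by (simp add: free_gen_closed cls_minus)
qed

text \<open>Unlike the other relations, this one is imposed on \<open>U\<close>. It is written as
  the class of an element of the free algebra and then read off in \<open>R\<close>.\<close>

lemma gen_pow:
  assumes "x \<in> carrier L"
  shows "gen x [^]\<^bsub>R\<^esub> p = gen (pmap L x) \<oplus>\<^bsub>R\<^esub> scal (\<chi> x [^] p)"
proof -
  let ?g = "free_gen F x [^]\<^bsub>A\<^esub> p" and ?h = "free_gen F (pmap L x)" and ?s = "free_scalar F (\<chi> x [^] p)"
  have c: "free_gen F x \<in> carrier A" "?h \<in> carrier A" "?s \<in> carrier A"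
    using assms by (simp_all add: free_gen_closed pmap_in free_scalar_closed chi_in)
  have "(env_class F L (free_gen F x) [^]\<^bsub>U\<^esub> p \<ominus>\<^bsub>U\<^esub> env_class F L ?h) \<ominus>\<^bsub>U\<^esub> env_class F L ?s
      \<in> red_env_ideal p F L \<chi>"
    unfolding red_env_ideal_def Let_def genideal_def using assms by blast
  moreover have "env_class F L ((?g \<ominus>\<^bsub>A\<^esub> ?h) \<ominus>\<^bsub>A\<^esub> ?s) =
      (env_class F L (free_gen F x) [^]\<^bsub>U\<^esub> p \<ominus>\<^bsub>U\<^esub> env_class F L ?h) \<ominus>\<^bsub>U\<^esub> env_class F L ?s"
    using c by (simp add: a_minus_def env.hom_nat_pow)
  moreover have zU: "env_class F L \<zero>\<^bsub>A\<^esub> = \<zero>\<^bsub>U\<^esub>" by simp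
  ultimately have "env_class F L ((?g \<ominus>\<^bsub>A\<^esub> ?h) \<ominus>\<^bsub>A\<^esub> ?s) \<ominus>\<^bsub>U\<^esub> env_class F L \<zero>\<^bsub>A\<^esub> \<in> red_env_ideal p F L \<chi>"
    using c by (simp add: a_minus_def)
  then have "cls ((?g \<ominus>\<^bsub>A\<^esub> ?h) \<ominus>\<^bsub>A\<^esub> ?s) = cls \<zero>\<^bsub>A\<^esub>"
    unfolding red_class_def using c
    by (subst (asm) U.quotient_eq_iff_same_a_r_cos[OF red_env_ideal]) auto
  then have "(gen x [^]\<^bsub>R\<^esub> p \<ominus>\<^bsub>R\<^esub> gen (pmap L x)) \<ominus>\<^bsub>R\<^esub> scal (\<chi> x [^] p) = \<zero>\<^bsub>R\<^esub>"
    using c by (simp add: cls_minus cls.hom_nat_pow)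
  moreover have "(gen x [^]\<^bsub>R\<^esub> p \<ominus>\<^bsub>R\<^esub> gen (pmap L x)) \<ominus>\<^bsub>R\<^esub> scal (\<chi> x [^] p)
      \<oplus>\<^bsub>R\<^esub> (gen (pmap L x) \<oplus>\<^bsub>R\<^esub> scal (\<chi> x [^] p)) = gen x [^]\<^bsub>R\<^esub> p"
    using c by (simp add: a_minus_def R.a_ac R.r_neg R.r_neg1 R.r_neg2)
  ultimately show ?thesis using c by simp
qed

lemma scal_add: "\<lbrakk>a \<in> carrier F; b \<in> carrier F\<rbrakk> \<Longrightarrow> scal (a \<oplus> b) = scal a \<oplus>\<^bsub>R\<^esub> scal b"
proof -
  assume a: "a \<in> carrier F" "b \<in> carrier F"
  then have "free_scalar F (a \<oplus> b) = free_scalar F a \<oplus>\<^bsub>A\<^esub> free_scalar F b"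
    by (auto simp: free_scalar_def free_algebra_sel)
  then show ?thesis using a by (simp add: free_scalar_closed)
qed

lemma scal_mult: "\<lbrakk>a \<in> carrier F; b \<in> carrier F\<rbrakk> \<Longrightarrow> scal (a \<otimes> b) = scal a \<otimes>\<^bsub>R\<^esub> scal b"
proof -
  assume a: "a \<in> carrier F" "b \<in> carrier F"
  then have "free_scalar F (a \<otimes> b) = free_scalar F a \<otimes>\<^bsub>A\<^esub> free_scalar F b"
    by (subst free_algebra_sel, subst free_scalar_mult) (auto simp: free_scalar_def)
  then show ?thesis using a by (simp add: free_scalar_closed)
qed

lemma scal_one: "scal \<one> = \<one>\<^bsub>R\<^esub>"
proof -
  have "free_scalar F \<one> = \<one>\<^bsub>A\<^esub>" by (auto simp: free_scalar_def free_algebra_sel)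
  then show ?thesis by simp
qed

lemma scal_zero: "scal \<zero> = \<zero>\<^bsub>R\<^esub>"
proof -
  have "free_scalar F \<zero> = \<zero>\<^bsub>A\<^esub>" by (auto simp: free_scalar_def free_algebra_sel)
  then show ?thesis by simp
qed

lemma scal_central:
  assumes a: "a \<in> carrier F" and r: "r \<in> carrier R"
  shows "scal a \<otimes>\<^bsub>R\<^esub> r = r \<otimes>\<^bsub>R\<^esub> scal a"
proof -
  obtain f where f: "f \<in> carrier A" "r = cls f" using red_class_surj[OF r] .
  have "free_scalar F a \<otimes>\<^bsub>A\<^esub> f = f \<otimes>\<^bsub>A\<^esub> free_scalar F a"
    using free_algebra_closed[OF f(1)] a
    by (simp add: free_algebra_sel free_scalar_mult mult_free_scalar m_comm)
  then show ?thesis unfolding f(2) using f(1) a by (metis cls.hom_mult free_scalar_closed)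
qed

lemma red_env_induct [consumes 1, case_names zero one add smult gen]:
  assumes r: "r \<in> carrier R"
    and zero: "P \<zero>\<^bsub>R\<^esub>" and one: "P \<one>\<^bsub>R\<^esub>"
    and add: "\<And>r s. \<lbrakk>r \<in> carrier R; s \<in> carrier R; P r; P s\<rbrakk> \<Longrightarrow> P (r \<oplus>\<^bsub>R\<^esub> s)"
    and smult: "\<And>c r. \<lbrakk>c \<in> carrier F; r \<in> carrier R; P r\<rbrakk> \<Longrightarrow> P (scal c \<otimes>\<^bsub>R\<^esub> r)"
    and gen: "\<And>x r. \<lbrakk>x \<in> carrier L; r \<in> carrier R; P r\<rbrakk> \<Longrightarrow> P (gen x \<otimes>\<^bsub>R\<^esub> r)"
  shows "P r"
proof -
  obtain f where f: "f \<in> carrier A" and r: "r = cls f" using red_class_surj[OF r] .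
  from f have "P (cls f)"
  proof (induction f rule: free_algebra_induct)
    case zero show ?case using assms(2) by simp
  next
    case one show ?case using assms(3) by simp
  next
    case (add f g) then show ?case using assms(4)[of "cls f" "cls g"] by simp
  next
    case (smult c f) then show ?case using assms(5)[of c "cls f"] by (simp add: free_scalar_closed)
  next
    case (gen x f) then show ?case using assms(6)[of x "cls f"] by (simp add: free_gen_closed)
  qed
  then show ?thesis by (simp add: r)
qed

text \<open>The universal property of \<open>u(L,\<chi>)\<close>, with the kernel \<open>K\<close> of a homomorphism in place of the
  homomorphism.\<close>

lemma red_class_eqD:
  assumes K: "ideal K A"
    and K_add: "\<And>x y. \<lbrakk>x \<in> carrier L; y \<in> carrier L\<rbrakk> \<Longrightarrow>
      free_gen F (x \<oplus>\<^bsub>L\<^esub> y) \<ominus>\<^bsub>A\<^esub> (free_gen F x \<oplus>\<^bsub>A\<^esub> free_gen F y) \<in> K"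
    and K_smult: "\<And>c x. \<lbrakk>c \<in> carrier F; x \<in> carrier L\<rbrakk> \<Longrightarrow>
      free_gen F (c \<odot>\<^bsub>L\<^esub> x) \<ominus>\<^bsub>A\<^esub> free_scalar F c \<otimes>\<^bsub>A\<^esub> free_gen F x \<in> K"
    and K_bracket: "\<And>x y. \<lbrakk>x \<in> carrier L; y \<in> carrier L\<rbrakk> \<Longrightarrow>
      (free_gen F x \<otimes>\<^bsub>A\<^esub> free_gen F y \<ominus>\<^bsub>A\<^esub> free_gen F y \<otimes>\<^bsub>A\<^esub> free_gen F x)
        \<ominus>\<^bsub>A\<^esub> free_gen F (lie_bracket L x y) \<in> K"
    and K_pow: "\<And>x. x \<in> carrier L \<Longrightarrow>
      (free_gen F x [^]\<^bsub>A\<^esub> p \<ominus>\<^bsub>A\<^esub> free_gen F (pmap L x)) \<ominus>\<^bsub>A\<^esub> free_scalar F (\<chi> x [^] p) \<in> K"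
    and f: "f \<in> carrier A" and g: "g \<in> carrier A" and eq: "cls f = cls g"
  shows "f \<ominus>\<^bsub>A\<^esub> g \<in> K"
proof -
  interpret K: ideal K A by (rule K)
  have env: "env_ideal F L \<subseteq> K"
    unfolding env_ideal_def Let_def
    using K_add K_smult K_bracket by (intro A.genideal_minimal K) auto
  have Kc: "k \<in> carrier A" if "k \<in> K" for k using that K.a_subset by blast
  \<comment> \<open>The image of \<open>K\<close> in \<open>U\<close> is an ideal containing the
    p-relations. Returning to \<open>A\<close> costs an element of \<open>env_ideal F L\<close>, and
    these lie in \<open>K\<close>.\<close>
  have "ideal ((+>\<^bsub>A\<^esub>) (env_ideal F L) ` K) U"
    unfolding univ_env_def by (rule A.ring_ideal_imp_quot_ideal[OF env_ideal K])
  moreover have "(+>\<^bsub>A\<^esub>) (env_ideal F L) ` K = env_class F L ` K" by (simp add: env_class_def)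
  ultimately have KU: "ideal (env_class F L ` K) U" by simp
  have "red_env_ideal p F L \<chi> \<subseteq> env_class F L ` K"
    unfolding red_env_ideal_def Let_def
  proof (intro U.genideal_minimal KU subsetI)
    fix u assume "u \<in> {(env_class F L (free_gen F x) [^]\<^bsub>U\<^esub> p \<ominus>\<^bsub>U\<^esub> env_class F L (free_gen F (pmap L x)))
        \<ominus>\<^bsub>U\<^esub> env_class F L (free_scalar F (\<chi> x [^] p)) | x. x \<in> carrier L}"
    then obtain x where x: "x \<in> carrier L" and u: "u = (env_class F L (free_gen F x) [^]\<^bsub>U\<^esub> p
        \<ominus>\<^bsub>U\<^esub> env_class F L (free_gen F (pmap L x))) \<ominus>\<^bsub>U\<^esub> env_class F L (free_scalar F (\<chi> x [^] p))"
      by blast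
    have "u = env_class F L ((free_gen F x [^]\<^bsub>A\<^esub> p \<ominus>\<^bsub>A\<^esub> free_gen F (pmap L x))
        \<ominus>\<^bsub>A\<^esub> free_scalar F (\<chi> x [^] p))"
      unfolding u using x
      by (simp add: a_minus_def env.hom_nat_pow free_gen_closed pmap_in free_scalar_closed chi_in)
    then show "u \<in> env_class F L ` K" using K_pow[OF x] by blast
  qed
  moreover have "env_class F L f \<ominus>\<^bsub>U\<^esub> env_class F L g \<in> red_env_ideal p F L \<chi>"
    using eq f g by (subst U.quotient_eq_iff_same_a_r_cos[OF red_env_ideal]) (auto simp: red_class_def)
  ultimately obtain k where k: "k \<in> K" "env_class F L f \<ominus>\<^bsub>U\<^esub> env_class F L g = env_class F L k" by blast
  then have "env_class F L (f \<ominus>\<^bsub>A\<^esub> g) = env_class F L k" using f g by (simp add: a_minus_def)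
  then have "(f \<ominus>\<^bsub>A\<^esub> g) \<ominus>\<^bsub>A\<^esub> k \<in> K"
    using A.quotient_eq_iff_same_a_r_cos[OF env_ideal, of "f \<ominus>\<^bsub>A\<^esub> g" k] f g Kc[OF k(1)] env
    by (auto simp: env_class_def)
  then have "(f \<ominus>\<^bsub>A\<^esub> g) \<ominus>\<^bsub>A\<^esub> k \<oplus>\<^bsub>A\<^esub> k \<in> K" using k(1) K.a_closed by blast
  moreover have "(f \<ominus>\<^bsub>A\<^esub> g) \<ominus>\<^bsub>A\<^esub> k \<oplus>\<^bsub>A\<^esub> k = f \<ominus>\<^bsub>A\<^esub> g"
    using f g Kc[OF k(1)] by (simp add: a_minus_def A.a_assoc A.l_neg)
  ultimately show ?thesis by simp
qed

end

sublocale lie_module \<subseteq> operator_module F V "carrier L"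
  by unfold_locales (simp_all add: act_closed act_add_right act_smult_right)

locale reduced_env_module = reduced_env p F L \<chi> + lie_module F L V
  for p :: nat and F :: "('k, 'n) ring_scheme" (structure)
    and L :: "('k, 'l, 'm) rlie_scheme" (structure) and \<chi> :: "'l \<Rightarrow> 'k"
    and V :: "('k, 'l, 'v, 'w) lie_mod_scheme" (structure) +
  assumes p_char: "has_p_character p F L \<chi> V"
begin

lemma word_action_minus:
  assumes f: "f \<in> carrier A" and g: "g \<in> carrier A" and v: "v \<in> carrier V"
  shows "word_action F V (f \<ominus>\<^bsub>A\<^esub> g) v = word_action F V f v \<ominus>\<^bsub>V\<^esub> word_action F V g v"
proof -
  have "word_action F V ((f \<ominus>\<^bsub>A\<^esub> g) \<oplus>\<^bsub>A\<^esub> g) v = word_action F V (f \<ominus>\<^bsub>A\<^esub> g) v \<oplus>\<^bsub>V\<^esub> word_action F V g v"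
    using f g v by (intro word_action_add) auto
  moreover have "(f \<ominus>\<^bsub>A\<^esub> g) \<oplus>\<^bsub>A\<^esub> g = f" using f g by (simp add: a_minus_def A.a_assoc A.l_neg)
  ultimately show ?thesis
    using word_action_closed[OF _ v] f g by (simp add: a_minus_def V.M.a_assoc V.M.r_neg)
qed

lemma word_action_gen_pow:
  assumes x: "x \<in> carrier L" and v: "v \<in> carrier V"
  shows "word_action F V (free_gen F x [^]\<^bsub>A\<^esub> (n :: nat)) v = (act V x ^^ n) v"
  using v
proof (induction n arbitrary: v)
  case (Suc n)
  then show ?case
    using x by (simp add: word_action_mult word_action_gen free_gen_closed act_closed funpow_swap1)
qed (simp add: word_action_one)

text \<open>Well-definedness of the action of u(L,\<chi>): the annihilator of \<open>V\<close> in
  the free algebra is an ideal, and it contains the four families of relations because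
  \<open>V\<close> is a Lie module with p-character \<chi>.\<close>

lemma word_action_cong:
  assumes f: "f \<in> carrier A" and g: "g \<in> carrier A" and eq: "cls f = cls g" and v: "v \<in> carrier V"
  shows "word_action F V f v = word_action F V g v"
proof -
  let ?K = "{f \<in> carrier A. \<forall>v\<in>carrier V. word_action F V f v = \<zero>\<^bsub>V\<^esub>}"
  have wa0: "word_action F V f \<zero>\<^bsub>V\<^esub> = \<zero>\<^bsub>V\<^esub>" if "f \<in> carrier A" for f
    using word_action_add_right[OF that, of "\<zero>\<^bsub>V\<^esub>" "\<zero>\<^bsub>V\<^esub>"] word_action_closed[OF that, of "\<zero>\<^bsub>V\<^esub>"]
    by (metis V.M.add.r_cancel_one' V.M.l_zero V.M.zero_closed)
  have "ideal ?K A"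
  proof (rule idealI)
    show "subgroup ?K (add_monoid A)"
    proof (rule A.add.subgroupI)
      show "?K \<noteq> {}" using word_action_zero A.zero_closed by blast
      fix a assume a: "a \<in> ?K"
      have "word_action F V (\<zero>\<^bsub>A\<^esub> \<ominus>\<^bsub>A\<^esub> a) v = \<zero>\<^bsub>V\<^esub>" if "v \<in> carrier V" for v
        using a that word_action_minus[of "\<zero>\<^bsub>A\<^esub>" a v] by (simp add: word_action_zero a_minus_def)
      then show "\<ominus>\<^bsub>A\<^esub> a \<in> ?K" using a by (simp add: a_minus_def)
    qed (auto simp: word_action_add)
  qed (auto simp: A.ring_axioms word_action_mult word_action_closed wa0)
  then have "f \<ominus>\<^bsub>A\<^esub> g \<in> ?K"
  proof (rule red_class_eqD[OF _ _ _ _ _ f g eq])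
    fix x y assume xy: "x \<in> carrier L" "y \<in> carrier L"
    then show "free_gen F (x \<oplus>\<^bsub>L\<^esub> y) \<ominus>\<^bsub>A\<^esub> (free_gen F x \<oplus>\<^bsub>A\<^esub> free_gen F y) \<in> ?K"
      by (auto simp: free_gen_closed word_action_minus word_action_gen word_action_add act_add_left
          act_closed a_minus_def[of V] V.M.r_neg)
    show "(free_gen F x \<otimes>\<^bsub>A\<^esub> free_gen F y \<ominus>\<^bsub>A\<^esub> free_gen F y \<otimes>\<^bsub>A\<^esub> free_gen F x)
        \<ominus>\<^bsub>A\<^esub> free_gen F (lie_bracket L x y) \<in> ?K"
      using xy by (auto simp: free_gen_closed bracket_closed word_action_minus word_action_gen word_action_mult
          act_bracket act_closed a_minus_def[of V] V.M.r_neg)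
  next
    fix c x assume "c \<in> carrier F" "x \<in> carrier L"
    then show "free_gen F (c \<odot>\<^bsub>L\<^esub> x) \<ominus>\<^bsub>A\<^esub> free_scalar F c \<otimes>\<^bsub>A\<^esub> free_gen F x \<in> ?K"
      by (auto simp: free_gen_closed free_scalar_closed word_action_minus word_action_gen
          word_action_scalar act_smult_left act_closed a_minus_def[of V] V.M.r_neg)
  next
    fix x assume x: "x \<in> carrier L"
    have "(act V x ^^ p) v \<ominus>\<^bsub>V\<^esub> act V (pmap L x) v = (\<chi> x [^] p) \<odot>\<^bsub>V\<^esub> v" if "v \<in> carrier V" for v
      using p_char x that by (simp add: has_p_character_def)
    then show "(free_gen F x [^]\<^bsub>A\<^esub> p \<ominus>\<^bsub>A\<^esub> free_gen F (pmap L x)) \<ominus>\<^bsub>A\<^esub> free_scalar F (\<chi> x [^] p) \<in> ?K"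
      using x by (simp add: free_gen_closed free_scalar_closed pmap_in chi_in word_action_minus
          word_action_gen word_action_gen_pow word_action_free_scalar a_minus_def[of V "_ \<odot>\<^bsub>V\<^esub> _"] V.M.r_neg)
  qed
  then have "word_action F V f v \<ominus>\<^bsub>V\<^esub> word_action F V g v = \<zero>\<^bsub>V\<^esub>"
    using word_action_minus[OF f g v] v by simp
  then show ?thesis using word_action_closed f g v by (simp add: V.diff_eq_zero_iff)
qed

abbreviation VR where "VR \<equiv> to_red_env_module p F L \<chi> V"

lemma to_red_env_module_sel [simp]:
  "carrier VR = carrier V" "add VR = add V" "zero VR = zero V"
  by (simp_all add: to_red_env_module_def)

text \<open>The definite description in \<open>to_red_env_module\<close> has a value because all
  representatives of a class act alike.\<close>

lemma smult_red_class:
  assumes f: "f \<in> carrier A" and v: "v \<in> carrier V"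
  shows "cls f \<odot>\<^bsub>VR\<^esub> v = word_action F V f v"
proof -
  have "(THE w. \<exists>g\<in>carrier A. cls f = cls g \<and> w = word_action F V g v) = word_action F V f v"
    using f word_action_cong[OF _ _ _ v] by (intro the_equality) (blast, metis)
  then show ?thesis by (simp add: to_red_env_module_def)
qed

lemma to_red_env_left_module: "left_module R VR"
proof (intro left_module.intro left_module_axioms.intro R.ring_axioms)
  show "abelian_group VR"
    by (rule abelian_groupI) (auto simp: V.M.a_ac intro: V.M.l_neg bexI[of _ "\<ominus>\<^bsub>V\<^esub> _"])
next
  fix a x assume "a \<in> carrier R" "x \<in> carrier VR"
  then show "a \<odot>\<^bsub>VR\<^esub> x \<in> carrier VR"
    by (auto elim!: red_class_surj simp: smult_red_class word_action_closed)
next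
  fix a b x assume "a \<in> carrier R" "b \<in> carrier R" and x: "x \<in> carrier VR"
  then obtain f g where f: "f \<in> carrier A" "a = cls f" and g: "g \<in> carrier A" "b = cls g"
    by (meson red_class_surj)
  show "(a \<oplus>\<^bsub>R\<^esub> b) \<odot>\<^bsub>VR\<^esub> x = a \<odot>\<^bsub>VR\<^esub> x \<oplus>\<^bsub>VR\<^esub> b \<odot>\<^bsub>VR\<^esub> x"
    using f g x smult_red_class[of "f \<oplus>\<^bsub>A\<^esub> g" x] by (simp add: smult_red_class word_action_add)
  show "(a \<otimes>\<^bsub>R\<^esub> b) \<odot>\<^bsub>VR\<^esub> x = a \<odot>\<^bsub>VR\<^esub> (b \<odot>\<^bsub>VR\<^esub> x)"
    using f g x smult_red_class[of "f \<otimes>\<^bsub>A\<^esub> g" x]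
    by (simp add: smult_red_class word_action_mult word_action_closed)
next
  fix a x y assume "a \<in> carrier R" "x \<in> carrier VR" "y \<in> carrier VR"
  then show "a \<odot>\<^bsub>VR\<^esub> (x \<oplus>\<^bsub>VR\<^esub> y) = a \<odot>\<^bsub>VR\<^esub> x \<oplus>\<^bsub>VR\<^esub> a \<odot>\<^bsub>VR\<^esub> y"
    by (auto elim!: red_class_surj simp: smult_red_class word_action_add_right)
next
  fix x assume "x \<in> carrier VR"
  then show "\<one>\<^bsub>R\<^esub> \<odot>\<^bsub>VR\<^esub> x = x"
    using smult_red_class[of "\<one>\<^bsub>A\<^esub>" x] by (simp add: word_action_one)
qed

end

section \<open>Extension of scalars\<close>

text \<open>The closure conditions place the relations of the tensor product in the free abelian
  group \<open>G\<close>; multiplication in the ring \<open>A\<close> supplies the left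
  action.\<close>

locale scalar_extension = A: ring A
  for R :: "('r, 'n) ring_scheme" and A :: "('a, 'm) ring_scheme"
    and \<iota> :: "'r \<Rightarrow> 'a" and N :: "('r, 'v, 'o) module_scheme" +
  assumes map_closed: "r \<in> carrier R \<Longrightarrow> \<iota> r \<in> carrier A"
    and N_add_closed: "\<lbrakk>n \<in> carrier N; m \<in> carrier N\<rbrakk> \<Longrightarrow> n \<oplus>\<^bsub>N\<^esub> m \<in> carrier N"
    and N_smult_closed: "\<lbrakk>r \<in> carrier R; n \<in> carrier N\<rbrakk> \<Longrightarrow> r \<odot>\<^bsub>N\<^esub> n \<in> carrier N"
begin

abbreviation E where "E \<equiv> extension_of_scalars R A \<iota> N"
abbreviation G where "G \<equiv> free_Abelian_group (carrier A \<times> carrier N)"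
definition K where "K = generate G (tensor_relations R A \<iota> N)"
definition cl where "cl c = K #>\<^bsub>G\<^esub> c"
definition mulmap where "mulmap a = frag_extend (\<lambda>(b, n). frag_of (a \<otimes>\<^bsub>A\<^esub> b, n))"

sublocale G: comm_group G by (rule abelian_free_Abelian_group)

lemma mulmap_of [simp]: "mulmap a (frag_of (b, n)) = frag_of (a \<otimes>\<^bsub>A\<^esub> b, n)"
  by (simp add: mulmap_def)

lemma mulmap_add: "mulmap a (c + d) = mulmap a c + mulmap a d"
  and mulmap_diff: "mulmap a (c - d) = mulmap a c - mulmap a d"
  and mulmap_0 [simp]: "mulmap a 0 = 0"
  by (simp_all add: mulmap_def frag_extend_add frag_extend_diff)

lemma carrier_G_diff: "\<lbrakk>c \<in> carrier G; d \<in> carrier G\<rbrakk> \<Longrightarrow> c - d \<in> carrier G"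
  and carrier_G_add: "\<lbrakk>c \<in> carrier G; d \<in> carrier G\<rbrakk> \<Longrightarrow> c + d \<in> carrier G"
  and carrier_G_0: "0 \<in> carrier G"
  using G.m_closed[of c d] G.m_closed[of c "- d"] by simp_all

lemma G_induct [consumes 1, case_names zero diff of]:
  assumes "c \<in> carrier G" and "P 0"
    and "\<And>c d. \<lbrakk>c \<in> carrier G; d \<in> carrier G; P c; P d\<rbrakk> \<Longrightarrow> P (c - d)"
    and "\<And>a n. \<lbrakk>a \<in> carrier A; n \<in> carrier N\<rbrakk> \<Longrightarrow> P (frag_of (a, n))"
  shows "P c"
  using assms by (intro free_Abelian_group_induct[of c "carrier A \<times> carrier N" P]) auto

lemma of_closed: "\<lbrakk>a \<in> carrier A; n \<in> carrier N\<rbrakk> \<Longrightarrow> frag_of (a, n) \<in> carrier G"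
  by simp

lemma mulmap_closed:
  assumes a: "a \<in> carrier A" and c: "c \<in> carrier G"
  shows "mulmap a c \<in> carrier G"
  using c
proof (induction c rule: G_induct)
  case (diff c d)
  then show ?case using carrier_G_diff by (simp only: mulmap_diff)
qed (simp_all add: a)

lemma relations_closed: "tensor_relations R A \<iota> N \<subseteq> carrier G"
proof
  fix c assume "c \<in> tensor_relations R A \<iota> N"
  then show "c \<in> carrier G"
    unfolding tensor_relations_def
    by (elim UnE CollectE exE conjE; hypsubst; intro carrier_G_diff of_closed)
      (simp_all add: map_closed N_add_closed N_smult_closed)
qed

lemma K_subgroup: "subgroup K G"
  unfolding K_def by (rule G.generate_is_subgroup[OF relations_closed])

lemma K_normal: "K \<lhd> G"
  by (rule G.subgroup_imp_normal[OF K_subgroup])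

lemma cl_eq_iff:
  assumes c: "c \<in> carrier G" and d: "d \<in> carrier G"
  shows "cl c = cl d \<longleftrightarrow> c - d \<in> K"
proof
  assume "cl c = cl d"
  then have "c \<in> K #>\<^bsub>G\<^esub> d" using G.rcos_self[OF c K_subgroup] by (simp add: cl_def)
  then show "c - d \<in> K" by (auto simp: r_coset_def)
next
  assume k: "c - d \<in> K"
  have "c = (c - d) \<otimes>\<^bsub>G\<^esub> d" by simp
  then have "c \<in> K #>\<^bsub>G\<^esub> d" using k unfolding r_coset_def by blast
  then show "cl c = cl d" using G.repr_independence[OF _ d K_subgroup] by (simp add: cl_def)
qed

lemma relation_cl:
  assumes "c \<in> carrier G" "d \<in> carrier G" "c - d \<in> tensor_relations R A \<iota> N"
  shows "cl c = cl d"
  using assms generate.incl[of "c - d" "tensor_relations R A \<iota> N" G] by (simp add: cl_eq_iff K_def)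

text \<open>Left multiplication by a turns a relation into one of the same family, so it preserves
  the subgroup that the relations generate. This makes scalar multiplication independent of
  representatives.\<close>

lemma mulmap_K:
  assumes a: "a \<in> carrier A" and c: "c \<in> K"
  shows "mulmap a c \<in> K"
proof -
  have "subgroup {c \<in> carrier G. mulmap a c \<in> K} G"
  proof (rule G.subgroupI)
    show "{c \<in> carrier G. mulmap a c \<in> K} \<noteq> {}"
      using carrier_G_0 subgroup.one_closed[OF K_subgroup] by (auto intro!: exI[of _ 0])
    fix c assume "c \<in> {c \<in> carrier G. mulmap a c \<in> K}"
    then have c: "c \<in> carrier G" "mulmap a c \<in> K" by auto
    have "mulmap a (- c) = - mulmap a c" using mulmap_diff[of a 0 c] by simp
    then show "inv\<^bsub>G\<^esub> c \<in> {c \<in> carrier G. mulmap a c \<in> K}"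
      using c subgroup.m_inv_closed[OF K_subgroup c(2)] mulmap_closed[OF a c(1)] by simp
    fix d assume "d \<in> {c \<in> carrier G. mulmap a c \<in> K}"
    then show "c \<otimes>\<^bsub>G\<^esub> d \<in> {c \<in> carrier G. mulmap a c \<in> K}"
      using c carrier_G_add[OF c(1)] subgroup.m_closed[OF K_subgroup c(2)] by (simp add: mulmap_add)
  qed auto
  moreover have "tensor_relations R A \<iota> N \<subseteq> {c \<in> carrier G. mulmap a c \<in> K}"
  proof
    fix r assume r: "r \<in> tensor_relations R A \<iota> N"
    have "mulmap a r \<in> tensor_relations R A \<iota> N"
      using r unfolding tensor_relations_def
    proof (elim UnE CollectE exE conjE, goal_cases)
      case (1 b b' n)
      then have "mulmap a r = frag_of (a \<otimes>\<^bsub>A\<^esub> b \<oplus>\<^bsub>A\<^esub> a \<otimes>\<^bsub>A\<^esub> b', n) - frag_of (a \<otimes>\<^bsub>A\<^esub> b, n) - frag_of (a \<otimes>\<^bsub>A\<^esub> b', n)"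
        using a by (simp add: mulmap_diff A.r_distr)
      then show ?case using 1 a A.m_closed by blast
    next
      case (2 b n m)
      then have "mulmap a r = frag_of (a \<otimes>\<^bsub>A\<^esub> b, n \<oplus>\<^bsub>N\<^esub> m) - frag_of (a \<otimes>\<^bsub>A\<^esub> b, n) - frag_of (a \<otimes>\<^bsub>A\<^esub> b, m)"
        by (simp add: mulmap_diff)
      then show ?case using 2 a A.m_closed by blast
    next
      case (3 b s n)
      then have "mulmap a r = frag_of (a \<otimes>\<^bsub>A\<^esub> b \<otimes>\<^bsub>A\<^esub> \<iota> s, n) - frag_of (a \<otimes>\<^bsub>A\<^esub> b, s \<odot>\<^bsub>N\<^esub> n)"
        using a by (simp add: mulmap_diff A.m_assoc map_closed)
      then show ?case using 3 a A.m_closed by blast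
    qed
    then show "r \<in> {c \<in> carrier G. mulmap a c \<in> K}"
      using r relations_closed generate.incl[of _ "tensor_relations R A \<iota> N" G] unfolding K_def by blast
  qed
  ultimately show ?thesis using G.generate_subgroup_incl c unfolding K_def by blast
qed

lemma carrier_E: "carrier E = cl ` carrier G"
  by (simp add: extension_of_scalars_def Let_def carrier_FactGroup K_def cl_def)

lemma zero_E: "\<zero>\<^bsub>E\<^esub> = cl 0"
  using G.coset_mult_one[OF subgroup.subset[OF K_subgroup]]
  by (simp add: extension_of_scalars_def Let_def FactGroup_def cl_def flip: K_def)

lemma add_E: "\<lbrakk>c \<in> carrier G; d \<in> carrier G\<rbrakk> \<Longrightarrow> cl c \<oplus>\<^bsub>E\<^esub> cl d = cl (c + d)"
  using normal.rcos_sum[OF K_normal]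
  by (simp add: extension_of_scalars_def Let_def FactGroup_def cl_def flip: K_def)

lemma smult_E:
  assumes a: "a \<in> carrier A" and c: "c \<in> carrier G"
  shows "a \<odot>\<^bsub>E\<^esub> cl c = cl (mulmap a c)"
proof -
  have "(THE Y. \<exists>d\<in>carrier G. cl c = cl d \<and> Y = cl (mulmap a d)) = cl (mulmap a c)"
  proof (rule the_equality)
    fix Y assume "\<exists>d\<in>carrier G. cl c = cl d \<and> Y = cl (mulmap a d)"
    then obtain d where d: "d \<in> carrier G" "cl c = cl d" "Y = cl (mulmap a d)" by blast
    have "mulmap a (c - d) \<in> K" using d cl_eq_iff[OF c d(1)] by (intro mulmap_K a) simp
    then show "Y = cl (mulmap a c)"
      using d cl_eq_iff[OF mulmap_closed[OF a c] mulmap_closed[OF a d(1)]] by (simp add: mulmap_diff)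
  qed (use c in blast)
  then show ?thesis
    by (simp add: extension_of_scalars_def Let_def cl_def mulmap_def flip: K_def)
qed

lemma cl_diff: "\<lbrakk>c \<in> carrier G; d \<in> carrier G\<rbrakk> \<Longrightarrow> cl (c - d) \<oplus>\<^bsub>E\<^esub> cl d = cl c"
  using add_E[OF carrier_G_diff] by simp

lemma abelian_group_E: "abelian_group E"
proof (rule abelian_groupI)
  show "\<zero>\<^bsub>E\<^esub> \<in> carrier E" using carrier_G_0 unfolding carrier_E zero_E by blast
  fix x assume "x \<in> carrier E"
  then obtain c where c: "c \<in> carrier G" "x = cl c" unfolding carrier_E by blast
  show "\<zero>\<^bsub>E\<^esub> \<oplus>\<^bsub>E\<^esub> x = x" unfolding c zero_E using add_E[OF carrier_G_0 c(1)] by simp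
  have "cl (0 - c) \<oplus>\<^bsub>E\<^esub> cl c = \<zero>\<^bsub>E\<^esub>" unfolding zero_E using carrier_G_0 c(1) by (rule cl_diff)
  then show "\<exists>y\<in>carrier E. y \<oplus>\<^bsub>E\<^esub> x = \<zero>\<^bsub>E\<^esub>"
    unfolding c carrier_E using carrier_G_diff[OF carrier_G_0 c(1)] by blast
  fix y assume "y \<in> carrier E"
  then obtain d where d: "d \<in> carrier G" "y = cl d" unfolding carrier_E by blast
  note cd = carrier_G_add[OF c(1) d(1)]
  show "x \<oplus>\<^bsub>E\<^esub> y \<in> carrier E"
    unfolding c d carrier_E add_E[OF c(1) d(1)] using cd by blast
  show "x \<oplus>\<^bsub>E\<^esub> y = y \<oplus>\<^bsub>E\<^esub> x"
    unfolding c d add_E[OF c(1) d(1)] add_E[OF d(1) c(1)] by (simp add: add.commute)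
  fix z assume "z \<in> carrier E"
  then obtain e where e: "e \<in> carrier G" "z = cl e" unfolding carrier_E by blast
  show "x \<oplus>\<^bsub>E\<^esub> y \<oplus>\<^bsub>E\<^esub> z = x \<oplus>\<^bsub>E\<^esub> (y \<oplus>\<^bsub>E\<^esub> z)"
    unfolding c d e using c(1) d(1) e(1) cd carrier_G_add[OF d(1) e(1)] by (simp only: add_E add.assoc)
qed

text \<open>In \<open>G\<close> itself left multiplication is not additive in the ring element. On a
  generator the discrepancy is a relation of the first family, so additivity holds modulo
  \<open>K\<close>.\<close>

lemma mulmap_add_left:
  assumes a: "a \<in> carrier A" "b \<in> carrier A" and c: "c \<in> carrier G"
  shows "cl (mulmap (a \<oplus>\<^bsub>A\<^esub> b) c) = cl (mulmap a c + mulmap b c)"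
proof -
  have ab: "a \<oplus>\<^bsub>A\<^esub> b \<in> carrier A" using a by simp
  have "mulmap (a \<oplus>\<^bsub>A\<^esub> b) c - (mulmap a c + mulmap b c) \<in> K"
    using c
  proof (induction c rule: G_induct)
    case zero
    show ?case using subgroup.one_closed[OF K_subgroup] by simp
  next
    case (diff c d)
    let ?f = "\<lambda>c. mulmap (a \<oplus>\<^bsub>A\<^esub> b) c - (mulmap a c + mulmap b c)"
    have "- ?f d \<in> K"
      using subgroup.m_inv_closed[OF K_subgroup diff(4)]
        subgroup.mem_carrier[OF K_subgroup diff(4)] by simp
    then have "?f c \<otimes>\<^bsub>G\<^esub> (- ?f d) \<in> K" using subgroup.m_closed[OF K_subgroup diff(3)] by blast
    then show ?case by (simp add: mulmap_diff algebra_simps)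
  next
    case (of b' n)
    then have "frag_of (a \<otimes>\<^bsub>A\<^esub> b' \<oplus>\<^bsub>A\<^esub> b \<otimes>\<^bsub>A\<^esub> b', n) - frag_of (a \<otimes>\<^bsub>A\<^esub> b', n) - frag_of (b \<otimes>\<^bsub>A\<^esub> b', n)
        \<in> tensor_relations R A \<iota> N"
      unfolding tensor_relations_def using a by blast
    then show ?case
      using of a generate.incl[of _ "tensor_relations R A \<iota> N" G]
      by (simp add: A.l_distr K_def diff_diff_add)
  qed
  then show ?thesis
    using cl_eq_iff[OF mulmap_closed[OF ab c] carrier_G_add[OF mulmap_closed mulmap_closed]] a c by blast
qed

lemma left_module_E: "left_module A E"
proof (intro left_module.intro left_module_axioms.intro abelian_group_E A.ring_axioms)
  fix a x assume a: "a \<in> carrier A" and "x \<in> carrier E"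
  then obtain c where c: "c \<in> carrier G" "x = cl c" unfolding carrier_E by blast
  show "a \<odot>\<^bsub>E\<^esub> x \<in> carrier E"
    unfolding c smult_E[OF a c(1)] carrier_E using mulmap_closed[OF a c(1)] by blast
  fix y assume "y \<in> carrier E"
  then obtain d where d: "d \<in> carrier G" "y = cl d" unfolding carrier_E by blast
  show "a \<odot>\<^bsub>E\<^esub> (x \<oplus>\<^bsub>E\<^esub> y) = a \<odot>\<^bsub>E\<^esub> x \<oplus>\<^bsub>E\<^esub> a \<odot>\<^bsub>E\<^esub> y"
    unfolding c d using a c(1) d(1)
    by (simp only: add_E smult_E carrier_G_add mulmap_closed mulmap_add)
next
  fix a b x assume a: "a \<in> carrier A" "b \<in> carrier A" and "x \<in> carrier E"
  then obtain c where c: "c \<in> carrier G" "x = cl c" unfolding carrier_E by blast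
  show "(a \<oplus>\<^bsub>A\<^esub> b) \<odot>\<^bsub>E\<^esub> x = a \<odot>\<^bsub>E\<^esub> x \<oplus>\<^bsub>E\<^esub> b \<odot>\<^bsub>E\<^esub> x"
    unfolding c using a c(1) mulmap_add_left[OF a c(1)]
    by (simp only: smult_E add_E mulmap_closed A.a_closed)
  have "mulmap (a \<otimes>\<^bsub>A\<^esub> b) c = mulmap a (mulmap b c)"
    using c(1)
  proof (induction c rule: G_induct)
    case (diff c d) then show ?case by (simp only: mulmap_diff)
  qed (simp_all add: A.m_assoc a)
  then show "(a \<otimes>\<^bsub>A\<^esub> b) \<odot>\<^bsub>E\<^esub> x = a \<odot>\<^bsub>E\<^esub> (b \<odot>\<^bsub>E\<^esub> x)"
    unfolding c using a c(1) by (simp only: smult_E mulmap_closed A.m_closed)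
next
  fix x assume "x \<in> carrier E"
  then obtain c where c: "c \<in> carrier G" "x = cl c" unfolding carrier_E by blast
  have "mulmap \<one>\<^bsub>A\<^esub> c = c"
    using c(1)
  proof (induction c rule: G_induct)
    case (diff c d) then show ?case by (simp only: mulmap_diff)
  qed simp_all
  then show "\<one>\<^bsub>A\<^esub> \<odot>\<^bsub>E\<^esub> x = x" unfolding c using smult_E[OF A.one_closed c(1)] by simp
qed

definition tensor where "tensor a n = cl (frag_of (a, n))"

lemma tensor_closed: "\<lbrakk>a \<in> carrier A; n \<in> carrier N\<rbrakk> \<Longrightarrow> tensor a n \<in> carrier E"
  unfolding tensor_def carrier_E by (rule imageI) simp

lemma smult_tensor:
  "\<lbrakk>a \<in> carrier A; b \<in> carrier A; n \<in> carrier N\<rbrakk> \<Longrightarrow> a \<odot>\<^bsub>E\<^esub> tensor b n = tensor (a \<otimes>\<^bsub>A\<^esub> b) n"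
  unfolding tensor_def by (simp add: smult_E)

lemma tensor_balanced:
  assumes "a \<in> carrier A" "r \<in> carrier R" "n \<in> carrier N"
  shows "tensor (a \<otimes>\<^bsub>A\<^esub> \<iota> r) n = tensor a (r \<odot>\<^bsub>N\<^esub> n)"
  unfolding tensor_def
proof (rule relation_cl)
  show "frag_of (a \<otimes>\<^bsub>A\<^esub> \<iota> r, n) - frag_of (a, r \<odot>\<^bsub>N\<^esub> n) \<in> tensor_relations R A \<iota> N"
    unfolding tensor_relations_def using assms by blast
qed (use assms in \<open>simp_all add: map_closed N_smult_closed\<close>)

text \<open>Every element is an integral combination of pure tensors.\<close>

lemma E_submodule_eqI:
  assumes M: "submodule M A E" and t: "\<And>a n. \<lbrakk>a \<in> carrier A; n \<in> carrier N\<rbrakk> \<Longrightarrow> tensor a n \<in> M"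
  shows "M = carrier E"
proof
  interpret E: left_module A E by (rule left_module_E)
  have sub: "subgroup M (add_monoid E)" using M by (rule submodule.axioms)
  show "M \<subseteq> carrier E" using subgroup.subset[OF sub] by simp
  have "cl c \<in> M" if "c \<in> carrier G" for c
    using that
  proof (induction c rule: G_induct)
    case zero
    show ?case using subgroup.one_closed[OF sub] by (simp add: zero_E)
  next
    case (diff c d)
    have c: "cl c \<in> carrier E" "cl d \<in> carrier E" "cl (c - d) \<in> carrier E"
      unfolding carrier_E using diff(1,2) carrier_G_diff by blast+
    have "cl (c - d) = cl c \<ominus>\<^bsub>E\<^esub> cl d"
      using c cl_diff[OF diff(1,2)] by (metis E.add.inv_solve_right a_minus_def)
    then show ?case
      using subgroup.m_closed[OF sub diff(3)] subgroup.m_inv_closed[OF sub diff(4)]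
      by (simp add: a_minus_def a_inv_def)
  next
    case (of a n)
    then show ?case using t by (simp add: tensor_def)
  qed
  then show "carrier E \<subseteq> M" unfolding carrier_E by blast
qed

text \<open>The rule (a, n) -> a (g n) extends to the free abelian group. Additivity of g and its
  compatibility with \<iota> say that the extension kills the relations, so it factors through the
  quotient.\<close>

lemma E_universal:
  assumes M: "left_module A M" and g: "\<And>n. n \<in> carrier N \<Longrightarrow> g n \<in> carrier M"
    and add: "\<And>n m. \<lbrakk>n \<in> carrier N; m \<in> carrier N\<rbrakk> \<Longrightarrow> g (n \<oplus>\<^bsub>N\<^esub> m) = g n \<oplus>\<^bsub>M\<^esub> g m"
    and smult: "\<And>r n. \<lbrakk>r \<in> carrier R; n \<in> carrier N\<rbrakk> \<Longrightarrow> g (r \<odot>\<^bsub>N\<^esub> n) = \<iota> r \<odot>\<^bsub>M\<^esub> g n"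
  obtains h where "h \<in> lmod_hom A E M"
    "\<And>a n. \<lbrakk>a \<in> carrier A; n \<in> carrier N\<rbrakk> \<Longrightarrow> h (tensor a n) = a \<odot>\<^bsub>M\<^esub> g n"
proof -
  interpret M: left_module A M by (rule M)
  let ?f = "\<lambda>(a, n). a \<odot>\<^bsub>M\<^esub> g n"
  have fim: "?f ` (carrier A \<times> carrier N) \<subseteq> carrier (add_monoid M)"
    using g by (auto intro: M.smult_closed)
  obtain k where k: "k \<in> hom G (add_monoid M)"
    and kof: "\<And>x. x \<in> carrier A \<times> carrier N \<Longrightarrow> k (frag_of x) = ?f x"
    using comm_group.free_Abelian_group_universal[OF M.M.a_comm_group fim] by metis
  have kc: "k c \<in> carrier M" if "c \<in> carrier G" for c using hom_in_carrier[OF k that] by simp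
  have kadd: "k (c + d) = k c \<oplus>\<^bsub>M\<^esub> k d" if "c \<in> carrier G" "d \<in> carrier G" for c d
    using hom_mult[OF k that] by simp
  have kdiff: "k (c - d) = k c \<ominus>\<^bsub>M\<^esub> k d" if c: "c \<in> carrier G" and d: "d \<in> carrier G" for c d
  proof -
    have "k (c - d) \<oplus>\<^bsub>M\<^esub> k d = k c" using kadd[OF carrier_G_diff[OF c d] d] by simp
    then show ?thesis
      using kc[OF c] kc[OF d] kc[OF carrier_G_diff[OF c d]] by (metis M.M.add.inv_solve_right a_minus_def)
  qed
  have khom: "group_hom G (add_monoid M) k"
    using k by (simp add: group_hom_def group_hom_axioms_def M.M.a_group G.is_group)
  have "subgroup (kernel G (add_monoid M) k) G" by (rule group_hom.subgroup_kernel[OF khom])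
  moreover have "tensor_relations R A \<iota> N \<subseteq> kernel G (add_monoid M) k"
  proof
    fix c assume c: "c \<in> tensor_relations R A \<iota> N"
    have cancel: "x \<oplus>\<^bsub>M\<^esub> y \<ominus>\<^bsub>M\<^esub> x \<ominus>\<^bsub>M\<^esub> y = \<zero>\<^bsub>M\<^esub>" if "x \<in> carrier M" "y \<in> carrier M" for x y
      using that M.M.r_neg[of "x \<oplus>\<^bsub>M\<^esub> y"] by (simp add: a_minus_def M.M.a_assoc M.M.minus_add)
    have cG: "frag_of (a, n) \<in> carrier G" if "a \<in> carrier A" "n \<in> carrier N" for a n using that by simp
    have "k c = \<zero>\<^bsub>M\<^esub>"
      using c unfolding tensor_relations_def
    proof (elim UnE CollectE exE conjE, goal_cases)
      case (1 a b n)
      then show ?thesis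
        using cG[of a n] cG[of b n] cG[of "a \<oplus>\<^bsub>A\<^esub> b" n] g[of n]
        by (simp add: kdiff carrier_G_diff kof M.smult_l_distr M.smult_closed cancel del: carrier_free_Abelian_group_iff)
    next
      case (2 a n m)
      then show ?thesis
        using cG[of a n] cG[of a m] cG[of a "n \<oplus>\<^bsub>N\<^esub> m"] g[of n] g[of m]
        by (simp add: kdiff carrier_G_diff kof add N_add_closed M.smult_r_distr M.smult_closed cancel
            del: carrier_free_Abelian_group_iff)
    next
      case (3 a r n)
      then show ?thesis
        using cG[of "a \<otimes>\<^bsub>A\<^esub> \<iota> r" n] cG[of a "r \<odot>\<^bsub>N\<^esub> n"] g[of n] map_closed[of r] N_smult_closed[of r n]
        by (simp add: kdiff kof smult M.smult_assoc1 M.smult_closed a_minus_def M.M.r_neg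
            del: carrier_free_Abelian_group_iff)
    qed
    moreover have "c \<in> carrier G" using relations_closed c by blast
    ultimately show "c \<in> kernel G (add_monoid M) k"
      by (simp add: kernel_def del: carrier_free_Abelian_group_iff)
  qed
  ultimately have "K \<subseteq> kernel G (add_monoid M) k" unfolding K_def by (intro G.generate_subgroup_incl)
  then obtain h where h: "\<And>c. c \<in> carrier G \<Longrightarrow> h (cl c) = k c"
    using group_hom.FactGroup_universal_kernel[OF khom K_normal] unfolding cl_def by metis
  have ksm: "k (mulmap a c) = a \<odot>\<^bsub>M\<^esub> k c" if a: "a \<in> carrier A" and c: "c \<in> carrier G" for a c
    using c
  proof (induction c rule: G_induct)
    case zero
    have "k 0 = \<zero>\<^bsub>M\<^esub>" using kdiff[OF carrier_G_0 carrier_G_0] kc[OF carrier_G_0]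
      by (simp add: a_minus_def M.M.r_neg)
    then show ?case using a by (simp add: M.smult_r_null)
  next
    case (diff c d)
    have "k (mulmap a c) = k (mulmap a (c - d)) \<oplus>\<^bsub>M\<^esub> k (mulmap a d)"
      using kadd[OF mulmap_closed[OF a carrier_G_diff[OF diff(1,2)]] mulmap_closed[OF a diff(2)]]
      by (simp flip: mulmap_add)
    moreover have "a \<odot>\<^bsub>M\<^esub> k c = a \<odot>\<^bsub>M\<^esub> k (c - d) \<oplus>\<^bsub>M\<^esub> a \<odot>\<^bsub>M\<^esub> k d"
      using kadd[OF carrier_G_diff[OF diff(1,2)] diff(2)] kc diff(1,2) carrier_G_diff[OF diff(1,2)] a
      by (simp flip: M.smult_r_distr del: carrier_free_Abelian_group_iff)
    ultimately show ?case
      using diff kc carrier_G_diff[OF diff(1,2)] mulmap_closed[OF a] a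
      by (metis M.M.add.right_cancel M.smult_closed)
  next
    case (of b n)
    then show ?case using a g by (simp add: kof M.smult_assoc1)
  qed
  have "h \<in> lmod_hom A E M"
    unfolding lmod_hom_def
  proof (intro CollectI conjI ballI Pi_I)
    fix x assume "x \<in> carrier E"
    then obtain c where c: "c \<in> carrier G" "x = cl c" unfolding carrier_E by blast
    show "h x \<in> carrier M" using c h kc by simp
    show "h (a \<odot>\<^bsub>E\<^esub> x) = a \<odot>\<^bsub>M\<^esub> h x" if a: "a \<in> carrier A" for a
      using c(2) h[OF c(1)] h[OF mulmap_closed[OF a c(1)]] ksm[OF a c(1)] smult_E[OF a c(1)] by simp
    fix y assume "y \<in> carrier E"
    then obtain d where d: "d \<in> carrier G" "y = cl d" unfolding carrier_E by blast
    show "h (x \<oplus>\<^bsub>E\<^esub> y) = h x \<oplus>\<^bsub>M\<^esub> h y"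
      using c(2) d(2) h[OF c(1)] h[OF d(1)] h[OF carrier_G_add[OF c(1) d(1)]] kadd[OF c(1) d(1)]
        add_E[OF c(1) d(1)] by simp
  qed
  moreover have "h (tensor a n) = a \<odot>\<^bsub>M\<^esub> g n" if "a \<in> carrier A" "n \<in> carrier N" for a n
    using h[of "frag_of (a, n)"] kof[of "(a, n)"] that by (simp add: tensor_def)
  ultimately show ?thesis using that by blast
qed

end

section \<open>Restriction to a subalgebra\<close>

context lie_algebra
begin

lemma lie_algebra_sub:
  assumes H: "submodule H F L" and br: "\<And>x y. \<lbrakk>x \<in> H; y \<in> H\<rbrakk> \<Longrightarrow> lie_bracket L x y \<in> H"
  shows "lie_algebra F (sub_rlie L H)"
proof -
  interpret S: module F "sub_rlie L H" by (rule submodule.submodule_is_module[OF H module_axioms])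
  note c = submodule_carrier[OF H]
  show ?thesis
    by unfold_locales
      (auto simp: br c bracket_add_left bracket_add_right bracket_smult_left bracket_smult_right
        bracket_self jacobi)
qed

end

lemma (in lie_module) lie_module_restrict:
  assumes H: "submodule H F L" and br: "\<And>x y. \<lbrakk>x \<in> H; y \<in> H\<rbrakk> \<Longrightarrow> lie_bracket L x y \<in> H"
  shows "lie_module F (sub_rlie L H) (restrict_module V H)"
proof -
  interpret H: lie_algebra F "sub_rlie L H" by (rule lie_algebra_sub[OF H br])
  note c = submodule_carrier[OF H]
  have ag: "abelian_group (restrict_module V H)"
    by (rule abelian_groupI)
      (auto simp: restrict_module_def V.M.a_ac intro: V.M.l_neg bexI[of _ "\<ominus>\<^bsub>V\<^esub> _"])
  then interpret RV: module F "restrict_module V H"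
    by (intro moduleI)
      (auto simp: restrict_module_def V.smult_l_distr V.smult_r_distr V.smult_assoc1 is_cring)
  have minus: "v \<ominus>\<^bsub>restrict_module V H\<^esub> w = v \<ominus>\<^bsub>V\<^esub> w" for v w
    by (simp add: restrict_module_def a_minus_def a_inv_def)
  show ?thesis
    by unfold_locales
      (auto simp: minus, auto simp: restrict_module_def c br submoduleE(4,5)[OF H] act_closed act_add_left
        act_smult_left act_add_right act_smult_right act_bracket)
qed

context reduced_env
begin

lemma reduced_env_sub:
  assumes H: "p_subalgebra F L H"
  shows "reduced_env F (sub_rlie L H) (restrict \<chi> H)"
proof -
  have H': "submodule H F L" "\<And>x y. \<lbrakk>x \<in> H; y \<in> H\<rbrakk> \<Longrightarrow> lie_bracket L x y \<in> H"
      "\<And>x. x \<in> H \<Longrightarrow> pmap L x \<in> H"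
    using H by (auto simp: p_subalgebra_def)
  interpret H: lie_algebra F "sub_rlie L H" by (rule lie_algebra_sub[OF H'(1,2)])
  show ?thesis by unfold_locales (auto simp: H' chi_in submodule_carrier[OF H'(1)])
qed

lemma free_algebra_mono: "X \<subseteq> Y \<Longrightarrow> f \<in> carrier (FA X) \<Longrightarrow> f \<in> carrier (FA Y)"
  unfolding free_algebra_carrier using lists_mono[of X Y] by blast

text \<open>Well-definedness of the map from u(H,\<chi>|H) to u(L,\<chi>): the elements of the free
  algebra on \<open>H\<close> that vanish in u(L,\<chi>) form an ideal containing all relations of
  u(H,\<chi>|H).\<close>

lemma red_env_map_class:
  assumes H: "p_subalgebra F L H" and f: "f \<in> carrier (FA H)"
  shows "red_env_map p F L \<chi> H (red_class p F (sub_rlie L H) (restrict \<chi> H) f) = cls f"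
proof -
  interpret H: reduced_env p F "sub_rlie L H" "restrict \<chi> H" by (rule reduced_env_sub[OF H])
  have H': "submodule H F L" "\<And>x y. \<lbrakk>x \<in> H; y \<in> H\<rbrakk> \<Longrightarrow> lie_bracket L x y \<in> H"
      "\<And>x. x \<in> H \<Longrightarrow> pmap L x \<in> H"
    using H by (auto simp: p_subalgebra_def)
  have Hc: "H \<subseteq> carrier L" using submoduleE(1)[OF H'(1)] .
  note c = subsetD[OF Hc]
  let ?B = "FA H"
  interpret B: ring ?B by (rule free_algebra_ring)
  have mono: "f \<in> carrier A" if "f \<in> carrier ?B" for f using free_algebra_mono[OF Hc that] .
  \<comment> \<open>The free algebras on \<open>H\<close> and on \<open>L\<close> share their
    operations as functions on words and differ in their carriers.\<close>
  have ops: "f \<oplus>\<^bsub>?B\<^esub> g = f \<oplus>\<^bsub>A\<^esub> g" "f \<otimes>\<^bsub>?B\<^esub> g = f \<otimes>\<^bsub>A\<^esub> g" "\<zero>\<^bsub>?B\<^esub> = \<zero>\<^bsub>A\<^esub>" "\<one>\<^bsub>?B\<^esub> = \<one>\<^bsub>A\<^esub>" for f g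
    by (simp_all add: free_algebra_sel)
  have minus: "f \<ominus>\<^bsub>?B\<^esub> g = f \<ominus>\<^bsub>A\<^esub> g" if "f \<in> carrier ?B" "g \<in> carrier ?B" for f g
    using that mono by (simp add: free_algebra_minus)
  have pow: "f [^]\<^bsub>?B\<^esub> n = f [^]\<^bsub>A\<^esub> n" for f and n :: nat
    by (induction n) (simp_all add: nat_pow_def ops)
  define K where "K = {f \<in> carrier ?B. cls f = \<zero>\<^bsub>R\<^esub>}"
  have K: "ideal K ?B"
  proof (rule idealI[OF B.ring_axioms])
    show "subgroup K (add_monoid ?B)"
      unfolding K_def
    proof (rule B.add.subgroupI)
      have "cls \<zero>\<^bsub>?B\<^esub> = \<zero>\<^bsub>R\<^esub>" unfolding ops(3) by simp
      then show "{f \<in> carrier ?B. cls f = \<zero>\<^bsub>R\<^esub>} \<noteq> {}" using B.zero_closed by blast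
      fix f assume "f \<in> {f \<in> carrier ?B. cls f = \<zero>\<^bsub>R\<^esub>}"
      then have f: "f \<in> carrier ?B" "cls f = \<zero>\<^bsub>R\<^esub>" by auto
      have "cls (\<zero>\<^bsub>?B\<^esub> \<ominus>\<^bsub>?B\<^esub> f) = \<zero>\<^bsub>R\<^esub>"
        unfolding minus[OF B.zero_closed f(1)] unfolding ops(3)
        using f mono by (simp add: cls_minus) (simp add: a_minus_def)
      then show "\<ominus>\<^bsub>?B\<^esub> f \<in> {f \<in> carrier ?B. cls f = \<zero>\<^bsub>R\<^esub>}"
        using f by (simp add: a_minus_def)
      fix g assume "g \<in> {f \<in> carrier ?B. cls f = \<zero>\<^bsub>R\<^esub>}"
      then have g: "g \<in> carrier ?B" "cls g = \<zero>\<^bsub>R\<^esub>" by auto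
      have "cls (f \<oplus>\<^bsub>?B\<^esub> g) = \<zero>\<^bsub>R\<^esub>" unfolding ops(1) using f g mono by simp
      then show "f \<oplus>\<^bsub>?B\<^esub> g \<in> {f \<in> carrier ?B. cls f = \<zero>\<^bsub>R\<^esub>}" using f g by simp
    qed auto
    fix f g assume "f \<in> K" and g: "g \<in> carrier ?B"
    then have f: "f \<in> carrier ?B" "cls f = \<zero>\<^bsub>R\<^esub>" by (auto simp: K_def)
    have "cls (f \<otimes>\<^bsub>?B\<^esub> g) = \<zero>\<^bsub>R\<^esub>" "cls (g \<otimes>\<^bsub>?B\<^esub> f) = \<zero>\<^bsub>R\<^esub>"
      unfolding ops(2) using f g mono by simp_all
    then show "g \<otimes>\<^bsub>?B\<^esub> f \<in> K" "f \<otimes>\<^bsub>?B\<^esub> g \<in> K" using f g by (simp_all add: K_def)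
  qed
  have K_I: "f \<ominus>\<^bsub>?B\<^esub> g \<in> K" if "f \<in> carrier ?B" "g \<in> carrier ?B" "cls f = cls g" for f g
  proof -
    have "cls (f \<ominus>\<^bsub>?B\<^esub> g) = \<zero>\<^bsub>R\<^esub>"
      unfolding minus[OF that(1,2)] using that mono by (simp add: cls_minus) (simp add: a_minus_def R.r_neg)
    then show ?thesis using that by (simp add: K_def)
  qed
  note gB = free_gen_closed[of _ H] and sB = free_scalar_closed[of _ H]
  have eqD: "cls f = cls g"
    if f: "f \<in> carrier ?B" and g: "g \<in> carrier ?B"
      and eq: "red_class p F (sub_rlie L H) (restrict \<chi> H) f = red_class p F (sub_rlie L H) (restrict \<chi> H) g" for f g
  proof -
    have 1: "free_gen F (x \<oplus>\<^bsub>L\<^esub> y) \<ominus>\<^bsub>?B\<^esub> (free_gen F x \<oplus>\<^bsub>?B\<^esub> free_gen F y) \<in> K"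
      if "x \<in> H" "y \<in> H" for x y
      using that mono[OF gB] c
      by (intro K_I B.a_closed gB) (simp_all add: submoduleE(5)[OF H'(1)] gen_add ops)
    have 2: "free_gen F (a \<odot>\<^bsub>L\<^esub> x) \<ominus>\<^bsub>?B\<^esub> free_scalar F a \<otimes>\<^bsub>?B\<^esub> free_gen F x \<in> K"
      if "a \<in> carrier F" "x \<in> H" for a x
      using that mono[OF gB] mono[OF sB] c
      by (intro K_I B.m_closed gB sB) (simp_all add: submoduleE(4)[OF H'(1)] gen_smult ops)
    have 3: "free_gen F x \<otimes>\<^bsub>?B\<^esub> free_gen F y \<ominus>\<^bsub>?B\<^esub> free_gen F y \<otimes>\<^bsub>?B\<^esub> free_gen F x
        \<ominus>\<^bsub>?B\<^esub> free_gen F (lie_bracket L x y) \<in> K" if "x \<in> H" "y \<in> H" for x y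
    proof (intro K_I B.minus_closed B.m_closed gB that H'(2))
      show "cls (free_gen F x \<otimes>\<^bsub>?B\<^esub> free_gen F y \<ominus>\<^bsub>?B\<^esub> free_gen F y \<otimes>\<^bsub>?B\<^esub> free_gen F x) =
          gen (lie_bracket L x y)"
        unfolding minus[OF B.m_closed[OF gB gB] B.m_closed[OF gB gB], OF that that(2,1)]
        unfolding ops(2) using that mono[OF gB] c by (simp add: cls_minus gen_bracket)
    qed
    have 4: "free_gen F x [^]\<^bsub>?B\<^esub> p \<ominus>\<^bsub>?B\<^esub> free_gen F (pmap L x) \<ominus>\<^bsub>?B\<^esub> free_scalar F (\<chi> x [^] p) \<in> K"
      if x: "x \<in> H" for x
    proof (intro K_I B.minus_closed B.nat_pow_closed gB sB x H'(3) nat_pow_closed chi_in c)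
      show "cls (free_gen F x [^]\<^bsub>?B\<^esub> p \<ominus>\<^bsub>?B\<^esub> free_gen F (pmap L x)) = scal (\<chi> x [^] p)"
        unfolding minus[OF B.nat_pow_closed[OF gB[OF x]] gB[OF H'(3)[OF x]]]
        unfolding pow using mono[OF gB[OF x]] mono[OF gB[OF H'(3)[OF x]]] c[OF x]
        by (simp add: cls_minus cls.hom_nat_pow gen_pow scal_closed chi_in a_minus_def
            R.a_comm[of "gen (pmap L x)"] R.a_assoc R.r_neg)
    qed
    have "f \<ominus>\<^bsub>FA (carrier (sub_rlie L H))\<^esub> g \<in> K"
      by (rule H.red_class_eqD[OF _ _ _ _ _ _ _ eq]) (use K 1 2 3 4 f g in simp_all)
    then have "f \<ominus>\<^bsub>?B\<^esub> g \<in> K" by simp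
    then have "cls f \<ominus>\<^bsub>R\<^esub> cls g = \<zero>\<^bsub>R\<^esub>"
      unfolding minus[OF f g] using mono[OF f] mono[OF g] by (simp add: K_def cls_minus)
    moreover have "cls f \<ominus>\<^bsub>R\<^esub> cls g \<oplus>\<^bsub>R\<^esub> cls g = cls f"
      using mono[OF f] mono[OF g] by (simp add: a_minus_def R.a_assoc R.l_neg)
    ultimately show ?thesis using mono[OF g] by simp
  qed
  show ?thesis
    unfolding red_env_map_def
    by (rule the_equality) (use f eqD in blast)+
qed

end

section \<open>Modules twisted by a character\<close>

context ring
begin

text \<open>Commutation moves a past the powers of b, after which Pascal's rule applies
  termwise.\<close>

lemma pow_add_commuting:
  assumes a: "a \<in> carrier R" and b: "b \<in> carrier R" and ab: "a \<otimes> b = b \<otimes> a"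
  shows "(a \<oplus> b) [^] (n :: nat) = (\<Oplus>k\<in>{..n}. add_pow R (n choose k) (a [^] k \<otimes> b [^] (n - k)))"
proof (induction n)
  case 0
  show ?case by simp
next
  case (Suc n)
  let ?t = "\<lambda>(n :: nat) (k :: nat). a [^] k \<otimes> b [^] (n - k)"
  let ?B = "\<lambda>k. add_pow R (n choose k) (?t n k)"
  have tc: "?t m k \<in> carrier R" for m k using a b by simp
  have ba: "b [^] k \<otimes> a = a \<otimes> b [^] k" for k :: nat
  proof (induction k)
    case (Suc k)
    have "b [^] k \<otimes> b \<otimes> a = b [^] k \<otimes> a \<otimes> b" using a b ab by (simp add: m_assoc)
    then show ?case using Suc a b by (simp add: m_assoc)
  qed (use a in simp)
  have ta: "?t n k \<otimes> a = ?t (Suc n) (Suc k)" for k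
    using a b ba[of "n - k"] nat_pow_mult[OF a, of k 1] by (simp add: m_assoc flip: nat_pow_Suc2)
  have tb: "?t n k \<otimes> b = ?t (Suc n) k" if "k \<le> n" for k
    using a b that by (simp add: m_assoc Suc_diff_le)
  have "(a \<oplus> b) [^] Suc n = (\<Oplus>k\<in>{..n}. ?B k) \<otimes> a \<oplus> (\<Oplus>k\<in>{..n}. ?B k) \<otimes> b"
    using Suc a b tc by (simp add: r_distr)
  also have "(\<Oplus>k\<in>{..n}. ?B k) \<otimes> a = (\<Oplus>k\<in>{..n}. add_pow R (n choose k) (?t (Suc n) (Suc k)))"
    using a tc by (subst finsum_ldistr) (auto simp: add_pow_ldistr ta intro!: finsum_cong')
  also have "(\<Oplus>k\<in>{..n}. ?B k) \<otimes> b = (\<Oplus>k\<in>{..n}. add_pow R (n choose k) (?t (Suc n) k))"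
    using b tc by (subst finsum_ldistr) (auto simp: add_pow_ldistr tb intro!: finsum_cong')
  also have "\<dots> = (\<Oplus>k\<in>{..Suc n}. add_pow R (n choose k) (?t (Suc n) k))"
    using tc a b by (subst finsum_Suc) (auto simp: binomial_eq_0 simp del: nat_pow_Suc)
  also have "\<dots> = (\<Oplus>k\<in>{..n}. add_pow R (n choose Suc k) (?t (Suc n) (Suc k))) \<oplus> add_pow R (Suc n choose 0) (?t (Suc n) 0)"
    using tc a b by (subst finsum_Suc2) (auto simp del: nat_pow_Suc)
  also have "(\<Oplus>k\<in>{..n}. add_pow R (n choose k) (?t (Suc n) (Suc k))) \<oplus>
      ((\<Oplus>k\<in>{..n}. add_pow R (n choose Suc k) (?t (Suc n) (Suc k))) \<oplus> add_pow R (Suc n choose 0) (?t (Suc n) 0)) =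
      (\<Oplus>k\<in>{..n}. add_pow R (n choose k) (?t (Suc n) (Suc k)) \<oplus> add_pow R (n choose Suc k) (?t (Suc n) (Suc k)))
      \<oplus> add_pow R (Suc n choose 0) (?t (Suc n) 0)"
    using a b by (subst finsum_addf) (auto simp: a_assoc finsum_closed simp del: nat_pow_Suc add.nat_pow_Suc)
  also have "(\<Oplus>k\<in>{..n}. add_pow R (n choose k) (?t (Suc n) (Suc k)) \<oplus> add_pow R (n choose Suc k) (?t (Suc n) (Suc k))) =
      (\<Oplus>k\<in>{..n}. add_pow R (Suc n choose Suc k) (?t (Suc n) (Suc k)))"
    using tc a b by (intro finsum_cong') (auto simp: add.nat_pow_mult simp del: nat_pow_Suc)
  also have "\<dots> \<oplus> add_pow R (Suc n choose 0) (?t (Suc n) 0) = (\<Oplus>k\<in>{..Suc n}. add_pow R (Suc n choose k) (?t (Suc n) k))"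
    using tc a b by (subst finsum_Suc2) (auto simp del: nat_pow_Suc)
  finally show ?case .
qed

text \<open>The inner binomial coefficients are divisible by p. In u(L,\<chi>) this is applied to a
  shifted generator and a central scalar.\<close>

lemma frobenius_commuting:
  assumes a: "a \<in> carrier R" and b: "b \<in> carrier R" and ab: "a \<otimes> b = b \<otimes> a"
    and p: "Factorial_Ring.prime (p :: nat)" and char: "add_pow R p \<one> = \<zero>"
  shows "(a \<oplus> b) [^] p = a [^] p \<oplus> b [^] p"
proof -
  let ?B = "\<lambda>k. add_pow R (p choose k) (a [^] k \<otimes> b [^] (p - k))"
  have p0: "0 < p" using p prime_gt_0_nat by blast
  have zero: "add_pow R (p * m) x = \<zero>" if x: "x \<in> carrier R" for m x
  proof -
    have "add_pow R p x = add_pow R p \<one> \<otimes> x" using x by (simp add: add_pow_ldistr)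
    then have "add_pow R p x = \<zero>" using char x by simp
    then show ?thesis using add.nat_pow_pow[of x m p] x by (simp add: mult.commute)
  qed
  have "?B k = \<zero>" if "k \<in> {..p} - {0, p}" for k
  proof -
    have "p dvd (p choose k)" using that p by (intro dvd_choose_prime) auto
    then obtain m where "p choose k = p * m" by blast
    then show ?thesis using zero a b by simp
  qed
  then have "(\<Oplus>k\<in>{..p}. ?B k) = (\<Oplus>k\<in>{0, p}. ?B k)"
    using a b by (intro add.finprod_mono_neutral_cong_right) auto
  also have "\<dots> = b [^] p \<oplus> a [^] p" using p0 a b by (simp add: finsum_insert)
  finally show ?thesis using pow_add_commuting[OF a b ab, of p] a b by (simp add: a_comm)
qed

end

section \<open>Signs, powers and submodules over noncommutative rings\<close>

context left_module
begin

lemma smult_l_minus: "\<lbrakk>a \<in> carrier R; x \<in> carrier M\<rbrakk> \<Longrightarrow> (\<ominus> a) \<odot>\<^bsub>M\<^esub> x = \<ominus>\<^bsub>M\<^esub> (a \<odot>\<^bsub>M\<^esub> x)"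
proof -
  assume a: "a \<in> carrier R" and x: "x \<in> carrier M"
  have "(\<ominus> a) \<odot>\<^bsub>M\<^esub> x \<oplus>\<^bsub>M\<^esub> a \<odot>\<^bsub>M\<^esub> x = \<zero>\<^bsub>M\<^esub>"
    using a x by (simp add: R.l_neg smult_l_null flip: smult_l_distr)
  then show ?thesis using a x by (metis M.minus_equality smult_closed R.a_inv_closed)
qed

lemma smult_r_minus: "\<lbrakk>a \<in> carrier R; x \<in> carrier M\<rbrakk> \<Longrightarrow> a \<odot>\<^bsub>M\<^esub> (\<ominus>\<^bsub>M\<^esub> x) = \<ominus>\<^bsub>M\<^esub> (a \<odot>\<^bsub>M\<^esub> x)"
proof -
  assume a: "a \<in> carrier R" and x: "x \<in> carrier M"
  have "a \<odot>\<^bsub>M\<^esub> (\<ominus>\<^bsub>M\<^esub> x) \<oplus>\<^bsub>M\<^esub> a \<odot>\<^bsub>M\<^esub> x = \<zero>\<^bsub>M\<^esub>"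
    using a x by (simp add: M.l_neg smult_r_null flip: smult_r_distr)
  then show ?thesis using a x by (metis M.minus_equality smult_closed M.a_inv_closed)
qed

lemma smult_r_diff:
  "\<lbrakk>a \<in> carrier R; x \<in> carrier M; y \<in> carrier M\<rbrakk> \<Longrightarrow> a \<odot>\<^bsub>M\<^esub> (x \<ominus>\<^bsub>M\<^esub> y) = a \<odot>\<^bsub>M\<^esub> x \<ominus>\<^bsub>M\<^esub> a \<odot>\<^bsub>M\<^esub> y"
  by (simp add: a_minus_def smult_r_distr smult_r_minus)

lemma smult_l_diff:
  "\<lbrakk>a \<in> carrier R; b \<in> carrier R; x \<in> carrier M\<rbrakk> \<Longrightarrow> (a \<ominus> b) \<odot>\<^bsub>M\<^esub> x = a \<odot>\<^bsub>M\<^esub> x \<ominus>\<^bsub>M\<^esub> b \<odot>\<^bsub>M\<^esub> x"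
  by (simp add: a_minus_def smult_l_distr smult_l_minus)

lemma smult_pow:
  "\<lbrakk>a \<in> carrier R; x \<in> carrier M\<rbrakk> \<Longrightarrow> (a [^] (n :: nat)) \<odot>\<^bsub>M\<^esub> x = ((\<lambda>y. a \<odot>\<^bsub>M\<^esub> y) ^^ n) x"
proof (induction n arbitrary: x)
  case (Suc n)
  then show ?case by (simp add: smult_assoc1 smult_closed funpow_swap1)
qed (simp add: smult_one)

lemma lsubmoduleI:
  assumes "N \<subseteq> carrier M" "\<zero>\<^bsub>M\<^esub> \<in> N" "\<And>x y. \<lbrakk>x \<in> N; y \<in> N\<rbrakk> \<Longrightarrow> x \<oplus>\<^bsub>M\<^esub> y \<in> N"
    and sm: "\<And>a x. \<lbrakk>a \<in> carrier R; x \<in> N\<rbrakk> \<Longrightarrow> a \<odot>\<^bsub>M\<^esub> x \<in> N"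
  shows "submodule N R M"
proof (intro submodule.intro submodule_axioms.intro sm)
  have "\<ominus>\<^bsub>M\<^esub> x \<in> N" if x: "x \<in> N" for x
  proof -
    have "\<ominus>\<^bsub>M\<^esub> x = (\<ominus> \<one>) \<odot>\<^bsub>M\<^esub> x" using x assms(1) by (simp add: smult_l_minus smult_one subset_iff)
    then show ?thesis using sm[OF _ x, of "\<ominus> \<one>"] by simp
  qed
  then show "subgroup N (add_monoid M)"
    using assms by (intro subgroup.intro) (auto simp: a_inv_def)
qed

lemma lsubmoduleD:
  assumes "submodule N R M"
  shows "N \<subseteq> carrier M" "\<zero>\<^bsub>M\<^esub> \<in> N" "\<And>x y. \<lbrakk>x \<in> N; y \<in> N\<rbrakk> \<Longrightarrow> x \<oplus>\<^bsub>M\<^esub> y \<in> N"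
    "\<And>a x. \<lbrakk>a \<in> carrier R; x \<in> N\<rbrakk> \<Longrightarrow> a \<odot>\<^bsub>M\<^esub> x \<in> N"
    "\<And>x y. \<lbrakk>x \<in> N; y \<in> N\<rbrakk> \<Longrightarrow> x \<ominus>\<^bsub>M\<^esub> y \<in> N"
proof -
  have s: "subgroup N (add_monoid M)" using assms by (rule submodule.axioms)
  show "N \<subseteq> carrier M" "\<zero>\<^bsub>M\<^esub> \<in> N" using subgroup.subset[OF s] subgroup.one_closed[OF s] by auto
  show a: "x \<oplus>\<^bsub>M\<^esub> y \<in> N" if "x \<in> N" "y \<in> N" for x y using subgroup.m_closed[OF s that] by simp
  show "a \<odot>\<^bsub>M\<^esub> x \<in> N" if "a \<in> carrier R" "x \<in> N" for a x
    using submodule.smult_closed[OF assms that] .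
  show "x \<ominus>\<^bsub>M\<^esub> y \<in> N" if "x \<in> N" "y \<in> N" for x y
    using a[OF that(1)] subgroup.m_inv_closed[OF s that(2)] by (simp add: a_minus_def a_inv_def)
qed

end

text \<open>\<open>lam\<close> is the character by which \<open>L\<close> acts on a one-dimensional
  module. It vanishes on brackets because scalars commute, and \<open>lam_pow\<close> says that the
  module has p-character \<chi>.\<close>

locale env_character = restricted_lie_algebra p F L + reduced_env p F L \<chi>
  for p :: nat and F :: "('k, 'n) ring_scheme" (structure)
    and L :: "('k, 'l, 'm) rlie_scheme" (structure) and \<chi> :: "'l \<Rightarrow> 'k" +
  fixes lam :: "'l \<Rightarrow> 'k"
  assumes lam_closed: "x \<in> carrier L \<Longrightarrow> lam x \<in> carrier F"
    and lam_add: "\<lbrakk>x \<in> carrier L; y \<in> carrier L\<rbrakk> \<Longrightarrow> lam (x \<oplus>\<^bsub>L\<^esub> y) = lam x \<oplus> lam y"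
    and lam_smult: "\<lbrakk>a \<in> carrier F; x \<in> carrier L\<rbrakk> \<Longrightarrow> lam (a \<odot>\<^bsub>L\<^esub> x) = a \<otimes> lam x"
    and lam_bracket: "\<lbrakk>x \<in> carrier L; y \<in> carrier L\<rbrakk> \<Longrightarrow> lam (lie_bracket L x y) = \<zero>"
    and lam_pow: "x \<in> carrier L \<Longrightarrow> lam x [^] p = lam (pmap L x) \<oplus> \<chi> x [^] p"
begin

text \<open>The generator is shifted so as to act by zero on the one-dimensional module. The
  elements \<open>dif x\<close> satisfy the relations of u(L,0) inside u(L,\<chi>), which removes
  the p-character without forming a tensor product.\<close>

definition dif where "dif x = gen x \<ominus>\<^bsub>R\<^esub> scal (lam x)"

lemma dif_closed: "x \<in> carrier L \<Longrightarrow> dif x \<in> carrier R"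
  by (simp add: dif_def gen_closed scal_closed lam_closed)

lemma gen_eq_dif: "x \<in> carrier L \<Longrightarrow> gen x = dif x \<oplus>\<^bsub>R\<^esub> scal (lam x)"
  by (simp add: dif_def gen_closed scal_closed lam_closed a_minus_def R.a_assoc R.l_neg)

lemma dif_eqI:
  assumes "x \<in> carrier L" "r \<in> carrier R" "gen x = r \<oplus>\<^bsub>R\<^esub> scal (lam x)"
  shows "dif x = r"
  using assms by (simp add: dif_def scal_closed lam_closed a_minus_def R.a_assoc R.r_neg)

lemma dif_add:
  assumes "x \<in> carrier L" "y \<in> carrier L"
  shows "dif (x \<oplus>\<^bsub>L\<^esub> y) = dif x \<oplus>\<^bsub>R\<^esub> dif y"
  using assms
  by (intro dif_eqI) (simp_all add: dif_closed gen_add gen_eq_dif[of x] gen_eq_dif[of y] lam_add scal_add lam_closed scal_closed R.a_ac)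

lemma dif_smult:
  assumes "a \<in> carrier F" "x \<in> carrier L"
  shows "dif (a \<odot>\<^bsub>L\<^esub> x) = scal a \<otimes>\<^bsub>R\<^esub> dif x"
  using assms
  by (intro dif_eqI) (simp_all add: dif_closed gen_smult gen_eq_dif[of x] lam_smult scal_mult lam_closed
      scal_closed R.r_distr)

lemma dif_bracket:
  assumes "x \<in> carrier L" "y \<in> carrier L"
  shows "dif (lie_bracket L x y) = dif x \<otimes>\<^bsub>R\<^esub> dif y \<ominus>\<^bsub>R\<^esub> dif y \<otimes>\<^bsub>R\<^esub> dif x"
proof (rule dif_eqI)
  let ?a = "dif x" and ?b = "dif y" and ?s = "scal (lam x)" and ?t = "scal (lam y)"
  have c: "?a \<in> carrier R" "?b \<in> carrier R" "?s \<in> carrier R" "?t \<in> carrier R"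
    using assms by (simp_all add: dif_closed scal_closed lam_closed)
  \<comment> \<open>The three terms containing a scalar are the same in both products, since scalars
    are central, and cancel in the commutator.\<close>
  let ?X = "?a \<otimes>\<^bsub>R\<^esub> ?t \<oplus>\<^bsub>R\<^esub> ?s \<otimes>\<^bsub>R\<^esub> ?b \<oplus>\<^bsub>R\<^esub> ?s \<otimes>\<^bsub>R\<^esub> ?t"
  have X: "?X \<in> carrier R" using c by simp
  have "gen x \<otimes>\<^bsub>R\<^esub> gen y = ?a \<otimes>\<^bsub>R\<^esub> ?b \<oplus>\<^bsub>R\<^esub> ?X"
    using assms c by (simp add: gen_eq_dif R.l_distr R.r_distr R.a_ac)
  moreover have "gen y \<otimes>\<^bsub>R\<^esub> gen x = ?b \<otimes>\<^bsub>R\<^esub> ?a \<oplus>\<^bsub>R\<^esub> ?X"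
    using assms c scal_central[OF lam_closed[OF assms(1)], of ?b] scal_central[OF lam_closed[OF assms(2)], of ?a]
      scal_central[OF lam_closed[OF assms(2)], of ?s]
    by (simp add: gen_eq_dif R.l_distr R.r_distr R.a_ac)
  moreover have "(u \<oplus>\<^bsub>R\<^esub> ?X) \<ominus>\<^bsub>R\<^esub> (v \<oplus>\<^bsub>R\<^esub> ?X) = u \<ominus>\<^bsub>R\<^esub> v" if "u \<in> carrier R" "v \<in> carrier R" for u v
  proof -
    have "(u \<oplus>\<^bsub>R\<^esub> x) \<ominus>\<^bsub>R\<^esub> (v \<oplus>\<^bsub>R\<^esub> x) = u \<ominus>\<^bsub>R\<^esub> v" if "x \<in> carrier R" for x
      using that \<open>u \<in> carrier R\<close> \<open>v \<in> carrier R\<close>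
      by (simp add: a_minus_def R.minus_add R.a_comm[of v x] R.a_assoc R.r_neg2)
    then show ?thesis using X by blast
  qed
  ultimately have "gen (lie_bracket L x y) = ?a \<otimes>\<^bsub>R\<^esub> ?b \<ominus>\<^bsub>R\<^esub> ?b \<otimes>\<^bsub>R\<^esub> ?a"
    using assms c by (simp add: gen_bracket)
  then show "gen (lie_bracket L x y) = (?a \<otimes>\<^bsub>R\<^esub> ?b \<ominus>\<^bsub>R\<^esub> ?b \<otimes>\<^bsub>R\<^esub> ?a) \<oplus>\<^bsub>R\<^esub> scal (lam (lie_bracket L x y))"
    using assms c by (simp add: lam_bracket scal_zero)
qed (use assms in \<open>simp_all add: bracket_closed dif_closed\<close>)

lemma scal_of_nat: "add_pow R (n :: nat) \<one>\<^bsub>R\<^esub> = scal (add_pow F n \<one>)"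
proof (induction n)
  case (Suc n)
  have "add_pow F n \<one> \<in> carrier F" by simp
  then show ?case using Suc by (simp add: scal_add scal_one)
qed (simp add: scal_zero)

lemma scal_pow: "a \<in> carrier F \<Longrightarrow> scal a [^]\<^bsub>R\<^esub> (n :: nat) = scal (a [^] n)"
  by (induction n) (simp_all add: scal_one scal_mult)

text \<open>As lam(x) is a central scalar, the p-th power of \<open>gen x\<close> =
  \<open>dif x\<close> + lam(x) splits by the Frobenius identity. The term \<chi>(x)^p in
  \<open>gen_pow\<close> cancels against the one in \<open>lam_pow\<close>.\<close>

lemma dif_pow:
  assumes x: "x \<in> carrier L"
  shows "dif x [^]\<^bsub>R\<^esub> p = dif (pmap L x)"
proof (rule sym, rule dif_eqI)
  have c: "dif x \<in> carrier R" "scal (lam x) \<in> carrier R" using x by (simp_all add: dif_closed scal_closed lam_closed)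
  have "gen (pmap L x) \<oplus>\<^bsub>R\<^esub> scal (\<chi> x [^] p) = (dif x \<oplus>\<^bsub>R\<^esub> scal (lam x)) [^]\<^bsub>R\<^esub> p"
    using gen_pow[OF x] gen_eq_dif[OF x] by simp
  also have "\<dots> = dif x [^]\<^bsub>R\<^esub> p \<oplus>\<^bsub>R\<^esub> scal (lam x) [^]\<^bsub>R\<^esub> p"
    using c scal_central[OF lam_closed[OF x] c(1)] prime_p char_p
    by (intro R.frobenius_commuting) (simp_all add: scal_of_nat scal_zero)
  also have "\<dots> = (dif x [^]\<^bsub>R\<^esub> p \<oplus>\<^bsub>R\<^esub> scal (lam (pmap L x))) \<oplus>\<^bsub>R\<^esub> scal (\<chi> x [^] p)"
    using x c by (simp add: scal_pow lam_closed lam_pow scal_add pmap_closed chi_in scal_closed R.a_assoc)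
  finally show "gen (pmap L x) = dif x [^]\<^bsub>R\<^esub> p \<oplus>\<^bsub>R\<^esub> scal (lam (pmap L x))"
    using x c by (simp add: gen_closed pmap_closed scal_closed lam_closed chi_in)
qed (use x in \<open>simp_all add: pmap_closed dif_closed\<close>)

text \<open>The \<open>L\<close>-module \<open>M \<otimes> S\<^sup>*\<close> of trivial \<open>p\<close>-character.\<close>

definition twist :: "(('l list \<Rightarrow> 'k) set set, 'v, 'w) module_scheme \<Rightarrow> ('k, 'l, 'v) lie_mod"
  where "twist M = \<lparr>carrier = carrier M, monoid.mult = (\<otimes>\<^bsub>M\<^esub>), one = \<one>\<^bsub>M\<^esub>, zero = \<zero>\<^bsub>M\<^esub>, add = (\<oplus>\<^bsub>M\<^esub>),
    smult = (\<lambda>c m. scal c \<odot>\<^bsub>M\<^esub> m), act = (\<lambda>x m. dif x \<odot>\<^bsub>M\<^esub> m)\<rparr>"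

lemma twist_sel [simp]:
  "carrier (twist M) = carrier M" "zero (twist M) = zero M" "add (twist M) = add M"
  "c \<odot>\<^bsub>twist M\<^esub> m = scal c \<odot>\<^bsub>M\<^esub> m" "act (twist M) x m = dif x \<odot>\<^bsub>M\<^esub> m"
  by (simp_all add: twist_def)

lemma twist_uminus: "\<ominus>\<^bsub>twist M\<^esub> m = \<ominus>\<^bsub>M\<^esub> m"
  by (simp add: a_inv_def m_inv_def)

lemma twist_minus: "m \<ominus>\<^bsub>twist M\<^esub> n = m \<ominus>\<^bsub>M\<^esub> n"
  by (simp add: a_minus_def twist_uminus)

lemma twist_module:
  assumes M: "left_module R M"
  shows "module F (twist M)"
proof -
  interpret M: left_module R M by (rule M)
  show ?thesis
  proof (rule moduleI[OF is_cring])
    show "abelian_group (twist M)"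
      by (rule abelian_groupI) (auto simp: M.M.a_ac intro: M.M.l_neg bexI[of _ "\<ominus>\<^bsub>M\<^esub> _"])
  qed (simp_all add: scal_closed M.smult_closed scal_add M.smult_l_distr M.smult_r_distr scal_mult
      M.smult_assoc1 scal_one M.smult_one)
qed

lemma twist_lie_module:
  assumes M: "left_module R M"
  shows "lie_module F L (twist M)"
proof -
  interpret M: left_module R M by (rule M)
  interpret V: module F "twist M" by (rule twist_module[OF M])
  show ?thesis
  proof unfold_locales
    fix a x m assume "a \<in> carrier F" "x \<in> carrier L" "m \<in> carrier (twist M)"
    then show "act (twist M) x (a \<odot>\<^bsub>twist M\<^esub> m) = a \<odot>\<^bsub>twist M\<^esub> act (twist M) x m"
      using scal_central[of a "dif x"] by (simp add: dif_closed scal_closed flip: M.smult_assoc1)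
  next
    fix x y m assume "x \<in> carrier L" "y \<in> carrier L" "m \<in> carrier (twist M)"
    then show "act (twist M) (lie_bracket L x y) m =
        act (twist M) x (act (twist M) y m) \<ominus>\<^bsub>twist M\<^esub> act (twist M) y (act (twist M) x m)"
      by (simp add: dif_bracket twist_minus M.smult_l_diff M.smult_assoc1 dif_closed)
  qed (simp_all add: dif_closed scal_closed M.smult_closed dif_add dif_smult M.smult_l_distr M.smult_r_distr
      M.smult_assoc1)
qed

lemma twist_pow:
  assumes M: "left_module R M" and x: "x \<in> carrier L" and m: "m \<in> carrier M"
  shows "act (twist M) (pmap L x) m = (act (twist M) x ^^ p) m"
proof -
  have "act (twist M) x = (\<lambda>m. dif x \<odot>\<^bsub>M\<^esub> m)" by (simp add: fun_eq_iff)
  then show ?thesis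
    using left_module.smult_pow[OF M dif_closed[OF x] m, of p] x by (simp add: dif_pow)
qed

lemma submodule_twist:
  assumes M: "left_module R M" and N: "submodule N R M"
  shows "submodule N F (twist M)"
proof -
  interpret M: left_module R M by (rule M)
  interpret V: module F "twist M" by (rule twist_module[OF M])
  note D = M.lsubmoduleD[OF N]
  show ?thesis
    by (rule V.submoduleI) (use D M.M.minus_equality in \<open>auto simp: scal_closed twist_uminus\<close>,
        use D(5)[OF D(2)] D(1) in \<open>auto simp: a_minus_def subset_iff\<close>)
qed

text \<open>The elements \<open>dif x\<close> and the scalars generate u(L,\<chi>) just as the
  \<open>gen x\<close> and the scalars do, so the twist keeps the same submodules.\<close>

lemma stable_twist_iff:
  assumes M: "left_module R M"
  shows "lie_module.stable F L (twist M) N \<longleftrightarrow> submodule N R M"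
proof -
  interpret M: left_module R M by (rule M)
  interpret V: lie_module F L "twist M" by (rule twist_lie_module[OF M])
  show ?thesis
  proof
    assume N: "submodule N R M"
    show "V.stable N"
      unfolding V.stable_def
      using submodule_twist[OF M N] M.lsubmoduleD[OF N] by (simp add: dif_closed)
  next
    assume "V.stable N"
    then have N: "submodule N F (twist M)" and st: "\<And>x v. \<lbrakk>x \<in> carrier L; v \<in> N\<rbrakk> \<Longrightarrow> dif x \<odot>\<^bsub>M\<^esub> v \<in> N"
      by (auto simp: V.stable_def)
    note D = V.V.submoduleE[OF N, simplified]
    show "submodule N R M"
    proof (rule M.lsubmoduleI[OF D(1)])
      show z: "\<zero>\<^bsub>M\<^esub> \<in> N" using V.V.submodule_zero[OF N] by simp
      show "r \<odot>\<^bsub>M\<^esub> v \<in> N" if r: "r \<in> carrier R" and v: "v \<in> N" for r v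
        using r
      proof (induction r rule: red_env_induct)
        case (gen x r)
        have vc: "v \<in> carrier M" using v D(1) by blast
        have "(gen x \<otimes>\<^bsub>R\<^esub> r) \<odot>\<^bsub>M\<^esub> v = dif x \<odot>\<^bsub>M\<^esub> (r \<odot>\<^bsub>M\<^esub> v) \<oplus>\<^bsub>M\<^esub> scal (lam x) \<odot>\<^bsub>M\<^esub> (r \<odot>\<^bsub>M\<^esub> v)"
          using gen(1,2) vc
          by (simp add: gen_eq_dif M.smult_assoc1 M.smult_l_distr M.smult_closed dif_closed scal_closed lam_closed)
        then show ?case using D(5) st[OF gen(1,3)] D(4)[OF lam_closed[OF gen(1)] gen(3)] by simp
      qed (use v D z in \<open>auto simp: M.smult_l_null M.smult_one M.smult_l_distr M.smult_assoc1 scal_closed subset_iff\<close>)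
    qed (use D(5) in simp)
  qed
qed

text \<open>In a module \<open>I\<close> generated by \<open>i\<close>, the vector \<open>i\<close> being fixed by \<open>T\<close> up to \<open>lam\<close>, a
  submodule that is maximal subject to not containing \<open>i\<close> has a quotient on which \<open>L\<close> acts through \<open>lam\<close>;
  since \<open>I\<close> has only one such quotient, this submodule is the kernel of \<open>\<epsilon>\<close>.\<close>

lemma kernel_superfluous:
  assumes fd: "finite_dim F L" and solv: "lie_solvable F L" and T: "maximal_torus F L T"
    and I: "left_module R I" and i: "i \<in> carrier I"
    and generates: "\<And>v. v \<in> carrier I \<Longrightarrow> \<exists>r\<in>carrier R. v = r \<odot>\<^bsub>I\<^esub> i"
    and Ti: "\<And>t. t \<in> T \<Longrightarrow> dif t \<odot>\<^bsub>I\<^esub> i = \<zero>\<^bsub>I\<^esub>"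
    and S: "left_module R S" and triv: "\<And>x s. \<lbrakk>x \<in> carrier L; s \<in> carrier S\<rbrakk> \<Longrightarrow> dif x \<odot>\<^bsub>S\<^esub> s = \<zero>\<^bsub>S\<^esub>"
    and hom: "\<epsilon> \<in> lmod_hom R I S" and ei: "\<epsilon> i \<noteq> \<zero>\<^bsub>S\<^esub>"
    and N: "submodule N R I"
    and cover: "\<And>v. v \<in> carrier I \<Longrightarrow> \<exists>n\<in>N. \<exists>k\<in>carrier I. \<epsilon> k = \<zero>\<^bsub>S\<^esub> \<and> v = n \<oplus>\<^bsub>I\<^esub> k"
  shows "N = carrier I"
proof (rule ccontr)
  assume NI: "N \<noteq> carrier I"
  interpret I: left_module R I by (rule I)
  interpret S: left_module R S by (rule S)
  have gen_all: "M = carrier I" if M: "submodule M R I" "i \<in> M" for M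
  proof
    show "M \<subseteq> carrier I" using I.lsubmoduleD(1)[OF M(1)] .
    show "carrier I \<subseteq> M"
    proof
      fix v assume "v \<in> carrier I"
      then obtain r where "r \<in> carrier R" "v = r \<odot>\<^bsub>I\<^esub> i" using generates by blast
      then show "v \<in> M" using I.lsubmoduleD(4)[OF M(1) _ M(2)] by simp
    qed
  qed
  have iN: "i \<notin> N" using gen_all N NI by blast
  \<comment> \<open>The condition of avoiding i, unlike that of being proper, passes visibly to
    unions of chains. As i generates \<open>I\<close>, the two conditions agree for
    submodules.\<close>
  define C where "C = {M. submodule M R I \<and> N \<subseteq> M \<and> i \<notin> M}"
  have "\<exists>M\<in>C. \<forall>M'\<in>C. M \<subseteq> M' \<longrightarrow> M' = M"
  proof (rule subset_Zorn_nonempty)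
    show "C \<noteq> {}" using N iN by (auto simp: C_def)
    fix \<C> assume ne: "\<C> \<noteq> {}" and chain: "subset.chain C \<C>"
    have sub: "submodule M R I" "N \<subseteq> M" "i \<notin> M" if "M \<in> \<C>" for M
      using that chain by (auto simp: C_def subset.chain_def)
    have "submodule (\<Union>\<C>) R I"
    proof (rule I.lsubmoduleI)
      fix x y assume "x \<in> \<Union>\<C>" "y \<in> \<Union>\<C>"
      then obtain M1 M2 where M12: "M1 \<in> \<C>" "x \<in> M1" "M2 \<in> \<C>" "y \<in> M2" by blast
      then have "M1 \<subseteq> M2 \<or> M2 \<subseteq> M1" using chain subset_chain_def by metis
      then obtain M where "M \<in> \<C>" "x \<in> M" "y \<in> M" using M12 by blast
      then show "x \<oplus>\<^bsub>I\<^esub> y \<in> \<Union>\<C>" using I.lsubmoduleD(3)[OF sub(1)] by blast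
    next
      show "\<Union>\<C> \<subseteq> carrier I" using I.lsubmoduleD(1)[OF sub(1)] by blast
      show "\<zero>\<^bsub>I\<^esub> \<in> \<Union>\<C>" using ne I.lsubmoduleD(2)[OF sub(1)] by blast
      show "a \<odot>\<^bsub>I\<^esub> x \<in> \<Union>\<C>" if "a \<in> carrier R" "x \<in> \<Union>\<C>" for a x
        using that I.lsubmoduleD(4)[OF sub(1)] by blast
    qed
    moreover have "N \<subseteq> \<Union>\<C>" using ne sub(2) by blast
    moreover have "i \<notin> \<Union>\<C>" using sub(3) by blast
    ultimately show "\<Union>\<C> \<in> C" by (simp add: C_def)
  qed
  then obtain M where MC: "M \<in> C" and max: "\<And>M'. M' \<in> C \<Longrightarrow> M \<subseteq> M' \<Longrightarrow> M' = M" by blast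
  have M: "submodule M R I" "N \<subseteq> M" "i \<notin> M" using MC by (auto simp: C_def)
  note MD = I.lsubmoduleD[OF M(1)]
  have difM: "dif x \<odot>\<^bsub>I\<^esub> v \<in> M" if x: "x \<in> carrier L" and v: "v \<in> carrier I" for x v
  proof -
    have "act (twist I) x v \<in> M"
    proof (rule torus_fixed_vector_trivial_action[OF fd solv T twist_lie_module[OF I], where i = i])
      show "lie_module.stable F L (twist I) M" using stable_twist_iff[OF I] M(1) by simp
      show "M' = M \<or> M' = carrier (twist I)" if "lie_module.stable F L (twist I) M'" "M \<subseteq> M'" for M'
      proof -
        have M': "submodule M' R I" using that stable_twist_iff[OF I] by simp
        show ?thesis
        proof (cases "i \<in> M'")
          case True
          then show ?thesis using gen_all[OF M'] by simp
        next
          case False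
          then have "M' \<in> C" using M' that(2) M(2) by (auto simp: C_def)
          then show ?thesis using max that(2) by blast
        qed
      qed
    qed (use x v i M(3) Ti twist_pow[OF I] in simp_all)
    then show ?thesis by simp
  qed
  have e_closed: "\<epsilon> v \<in> carrier S" if "v \<in> carrier I" for v using hom that by (auto simp: lmod_hom_def)
  have e_add: "\<epsilon> (v \<oplus>\<^bsub>I\<^esub> w) = \<epsilon> v \<oplus>\<^bsub>S\<^esub> \<epsilon> w" if "v \<in> carrier I" "w \<in> carrier I" for v w
    using hom that by (auto simp: lmod_hom_def)
  have e_smult: "\<epsilon> (r \<odot>\<^bsub>I\<^esub> v) = r \<odot>\<^bsub>S\<^esub> \<epsilon> v" if "r \<in> carrier R" "v \<in> carrier I" for r v
    using hom that by (auto simp: lmod_hom_def)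
  have e_zero: "\<epsilon> \<zero>\<^bsub>I\<^esub> = \<zero>\<^bsub>S\<^esub>"
    using e_smult[of "\<zero>\<^bsub>R\<^esub>" "\<zero>\<^bsub>I\<^esub>"] e_closed[of "\<zero>\<^bsub>I\<^esub>"] by (simp add: I.smult_l_null S.smult_l_null)
  \<comment> \<open>\<open>L\<close> acts through \<open>lam\<close> modulo \<open>M\<close> and
    modulo the kernel of \<epsilon>, hence also modulo their intersection \<open>Y\<close>, which
    allows both quotients to be compared at once.\<close>
  define Y where "Y = {v \<in> M. \<epsilon> v = \<zero>\<^bsub>S\<^esub>}"
  have Y: "submodule Y R I"
    by (rule I.lsubmoduleI)
      (use MD e_zero in \<open>auto simp: Y_def e_add e_smult S.smult_r_null subset_iff\<close>)
  note YD = I.lsubmoduleD[OF Y]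
  \<comment> \<open>Modulo \<open>Y\<close> the vector i spans \<open>I\<close>, because
    \<open>gen x\<close> acts there as the scalar lam(x).\<close>
  have one_dim: "\<exists>c\<in>carrier F. r \<odot>\<^bsub>I\<^esub> i \<ominus>\<^bsub>I\<^esub> scal c \<odot>\<^bsub>I\<^esub> i \<in> Y" if "r \<in> carrier R" for r
    using that
  proof (induction r rule: red_env_induct)
    case zero
    show ?case
      using YD(5)[OF YD(2) YD(2)] i by (intro bexI[of _ \<zero>]) (simp_all add: scal_zero I.smult_l_null)
  next
    case one
    show ?case
      using YD(2) i by (intro bexI[of _ \<one>]) (simp_all add: scal_one I.smult_one a_minus_def I.M.r_neg)
  next
    case (add r s)
    then obtain a b where a: "a \<in> carrier F" "b \<in> carrier F"
      and Yab: "r \<odot>\<^bsub>I\<^esub> i \<ominus>\<^bsub>I\<^esub> scal a \<odot>\<^bsub>I\<^esub> i \<in> Y" "s \<odot>\<^bsub>I\<^esub> i \<ominus>\<^bsub>I\<^esub> scal b \<odot>\<^bsub>I\<^esub> i \<in> Y" by blast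
    have "(r \<oplus>\<^bsub>R\<^esub> s) \<odot>\<^bsub>I\<^esub> i \<ominus>\<^bsub>I\<^esub> scal (a \<oplus> b) \<odot>\<^bsub>I\<^esub> i =
        (r \<odot>\<^bsub>I\<^esub> i \<ominus>\<^bsub>I\<^esub> scal a \<odot>\<^bsub>I\<^esub> i) \<oplus>\<^bsub>I\<^esub> (s \<odot>\<^bsub>I\<^esub> i \<ominus>\<^bsub>I\<^esub> scal b \<odot>\<^bsub>I\<^esub> i)"
      using add(1,2) a i
      by (simp add: scal_add I.smult_l_distr scal_closed I.smult_closed a_minus_def I.M.minus_add I.M.a_ac)
    then show ?case using a YD(3)[OF Yab] by (intro bexI[of _ "a \<oplus> b"]) simp_all
  next
    case (smult c r)
    then obtain a where a: "a \<in> carrier F" and Ya: "r \<odot>\<^bsub>I\<^esub> i \<ominus>\<^bsub>I\<^esub> scal a \<odot>\<^bsub>I\<^esub> i \<in> Y" by blast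
    have "(scal c \<otimes>\<^bsub>R\<^esub> r) \<odot>\<^bsub>I\<^esub> i \<ominus>\<^bsub>I\<^esub> scal (c \<otimes> a) \<odot>\<^bsub>I\<^esub> i =
        scal c \<odot>\<^bsub>I\<^esub> (r \<odot>\<^bsub>I\<^esub> i \<ominus>\<^bsub>I\<^esub> scal a \<odot>\<^bsub>I\<^esub> i)"
      using smult(1,2) a i
      by (simp add: scal_mult I.smult_assoc1 scal_closed I.smult_closed I.smult_r_diff)
    then show ?case using a smult(1) YD(4)[OF scal_closed[OF smult(1)] Ya] by (intro bexI[of _ "c \<otimes> a"]) simp_all
  next
    case (gen x r)
    then obtain a where a: "a \<in> carrier F" and Ya: "r \<odot>\<^bsub>I\<^esub> i \<ominus>\<^bsub>I\<^esub> scal a \<odot>\<^bsub>I\<^esub> i \<in> Y" by blast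
    let ?l = "lam x"
    have l: "?l \<in> carrier F" using gen(1) lam_closed by blast
    have ri: "r \<odot>\<^bsub>I\<^esub> i \<in> carrier I" using gen(2) i I.smult_closed by blast
    have "dif x \<odot>\<^bsub>I\<^esub> (r \<odot>\<^bsub>I\<^esub> i) \<in> Y"
      using difM[OF gen(1) ri] e_smult[OF dif_closed[OF gen(1)] ri] triv[OF gen(1) e_closed[OF ri]]
      by (simp add: Y_def)
    moreover have "scal ?l \<odot>\<^bsub>I\<^esub> (r \<odot>\<^bsub>I\<^esub> i \<ominus>\<^bsub>I\<^esub> scal a \<odot>\<^bsub>I\<^esub> i) \<in> Y" using YD(4)[OF scal_closed[OF l] Ya] .
    moreover have "(gen x \<otimes>\<^bsub>R\<^esub> r) \<odot>\<^bsub>I\<^esub> i \<ominus>\<^bsub>I\<^esub> scal (?l \<otimes> a) \<odot>\<^bsub>I\<^esub> i =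
        dif x \<odot>\<^bsub>I\<^esub> (r \<odot>\<^bsub>I\<^esub> i) \<oplus>\<^bsub>I\<^esub> scal ?l \<odot>\<^bsub>I\<^esub> (r \<odot>\<^bsub>I\<^esub> i \<ominus>\<^bsub>I\<^esub> scal a \<odot>\<^bsub>I\<^esub> i)"
      using gen(1,2) a l i ri
      by (simp add: gen_eq_dif dif_closed scal_mult I.smult_assoc1 scal_closed I.smult_closed I.smult_r_distr
          I.smult_r_minus I.smult_l_distr a_minus_def I.M.a_assoc)
    ultimately show ?case using a l YD(3) by (intro bexI[of _ "?l \<otimes> a"]) simp_all
  qed
  \<comment> \<open>Write i = n + k with \<epsilon>(k) = 0, and k congruent to c i modulo
    \<open>Y\<close>. Applying \<epsilon> gives c \<epsilon>(i) = 0, so c = 0 and k lies in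
    \<open>M\<close>; then i lies in \<open>M\<close> as well.\<close>
  obtain n k where n: "n \<in> N" and k: "k \<in> carrier I" "\<epsilon> k = \<zero>\<^bsub>S\<^esub>" and ink: "i = n \<oplus>\<^bsub>I\<^esub> k"
    using cover[OF i] by blast
  obtain r where r: "r \<in> carrier R" "k = r \<odot>\<^bsub>I\<^esub> i" using generates[OF k(1)] by blast
  obtain c where c: "c \<in> carrier F" and Yc: "k \<ominus>\<^bsub>I\<^esub> scal c \<odot>\<^bsub>I\<^esub> i \<in> Y" using one_dim[OF r(1)] r(2) by blast
  have ci: "scal c \<odot>\<^bsub>I\<^esub> i \<in> carrier I" using scal_closed[OF c] i I.smult_closed by blast
  have "k \<ominus>\<^bsub>I\<^esub> scal c \<odot>\<^bsub>I\<^esub> i \<oplus>\<^bsub>I\<^esub> scal c \<odot>\<^bsub>I\<^esub> i = k"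
    using k(1) ci by (simp add: a_minus_def I.M.a_assoc I.M.l_neg)
  then have "\<epsilon> (k \<ominus>\<^bsub>I\<^esub> scal c \<odot>\<^bsub>I\<^esub> i) \<oplus>\<^bsub>S\<^esub> \<epsilon> (scal c \<odot>\<^bsub>I\<^esub> i) = \<epsilon> k"
    using e_add[of "k \<ominus>\<^bsub>I\<^esub> scal c \<odot>\<^bsub>I\<^esub> i" "scal c \<odot>\<^bsub>I\<^esub> i"] k(1) ci by simp
  then have ce: "scal c \<odot>\<^bsub>S\<^esub> \<epsilon> i = \<zero>\<^bsub>S\<^esub>"
    using Yc k(2) e_smult[OF scal_closed[OF c] i] e_closed[OF ci] by (simp add: Y_def)
  have "c = \<zero>"
  proof (rule ccontr)
    assume "c \<noteq> \<zero>"
    then have u: "c \<in> Units F" using c field_Units by auto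
    then have "scal (inv c) \<odot>\<^bsub>S\<^esub> (scal c \<odot>\<^bsub>S\<^esub> \<epsilon> i) = \<epsilon> i"
      using c e_closed[OF i]
      by (simp add: scal_closed scal_one S.smult_one flip: S.smult_assoc1 scal_mult)
    then show False using ce ei u by (simp add: scal_closed S.smult_r_null)
  qed
  then have ci0: "scal c \<odot>\<^bsub>I\<^esub> i = \<zero>\<^bsub>I\<^esub>" using i by (simp add: scal_zero I.smult_l_null)
  have "\<ominus>\<^bsub>I\<^esub> \<zero>\<^bsub>I\<^esub> = \<zero>\<^bsub>I\<^esub>" by (rule I.M.minus_equality) simp_all
  then have "k \<ominus>\<^bsub>I\<^esub> \<zero>\<^bsub>I\<^esub> = k" using k(1) by (simp only: a_minus_def I.M.r_zero)
  then have "k \<in> M" using Yc ci0 by (simp add: Y_def)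
  then have "i \<in> M" using ink n M(2) MD(3) by blast
  then show False using M(3) by blast
qed

end

section \<open>Projective covers\<close>

lemma lmod_hom_facts:
  assumes "left_module R M" "left_module R N" "h \<in> lmod_hom R M N"
  shows "\<And>x. x \<in> carrier M \<Longrightarrow> h x \<in> carrier N"
    and "\<And>x y. \<lbrakk>x \<in> carrier M; y \<in> carrier M\<rbrakk> \<Longrightarrow> h (x \<oplus>\<^bsub>M\<^esub> y) = h x \<oplus>\<^bsub>N\<^esub> h y"
    and "\<And>r x. \<lbrakk>r \<in> carrier R; x \<in> carrier M\<rbrakk> \<Longrightarrow> h (r \<odot>\<^bsub>M\<^esub> x) = r \<odot>\<^bsub>N\<^esub> h x"
    and "h \<zero>\<^bsub>M\<^esub> = \<zero>\<^bsub>N\<^esub>"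
    and "\<And>x y. \<lbrakk>x \<in> carrier M; y \<in> carrier M\<rbrakk> \<Longrightarrow> h (x \<ominus>\<^bsub>M\<^esub> y) = h x \<ominus>\<^bsub>N\<^esub> h y"
proof -
  interpret M: left_module R M by fact
  interpret N: left_module R N by fact
  show hc: "h x \<in> carrier N" if "x \<in> carrier M" for x using assms(3) that by (auto simp: lmod_hom_def)
  show ha: "h (x \<oplus>\<^bsub>M\<^esub> y) = h x \<oplus>\<^bsub>N\<^esub> h y" if "x \<in> carrier M" "y \<in> carrier M" for x y
    using assms(3) that by (auto simp: lmod_hom_def)
  show hs: "h (r \<odot>\<^bsub>M\<^esub> x) = r \<odot>\<^bsub>N\<^esub> h x" if "r \<in> carrier R" "x \<in> carrier M" for r x
    using assms(3) that by (auto simp: lmod_hom_def)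
  show "h \<zero>\<^bsub>M\<^esub> = \<zero>\<^bsub>N\<^esub>"
    using hs[of "\<zero>\<^bsub>R\<^esub>" "\<zero>\<^bsub>M\<^esub>"] hc by (simp add: M.smult_l_null N.smult_l_null)
  show "h (x \<ominus>\<^bsub>M\<^esub> y) = h x \<ominus>\<^bsub>N\<^esub> h y" if x: "x \<in> carrier M" and y: "y \<in> carrier M" for x y
  proof -
    have "\<ominus>\<^bsub>M\<^esub> y = (\<ominus>\<^bsub>R\<^esub> \<one>\<^bsub>R\<^esub>) \<odot>\<^bsub>M\<^esub> y" using y by (simp add: M.smult_l_minus M.smult_one)
    then have "h (\<ominus>\<^bsub>M\<^esub> y) = \<ominus>\<^bsub>N\<^esub> h y" using y hc by (simp add: hs N.smult_l_minus N.smult_one)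
    then show ?thesis using x y by (simp add: a_minus_def ha)
  qed
qed

lemma submodule_image:
  assumes M: "left_module R M" and N: "left_module R N" and h: "h \<in> lmod_hom R M N"
  shows "submodule (h ` carrier M) R N"
proof -
  interpret M: left_module R M by (rule M)
  interpret N: left_module R N by (rule N)
  note hf = lmod_hom_facts[OF M N h]
  show ?thesis
  proof (rule N.lsubmoduleI)
    show "\<zero>\<^bsub>N\<^esub> \<in> h ` carrier M" using hf(4) by (metis M.zero_closed image_eqI)
    show "x \<oplus>\<^bsub>N\<^esub> y \<in> h ` carrier M" if "x \<in> h ` carrier M" "y \<in> h ` carrier M" for x y
      using that by (auto simp flip: hf(2))
    show "a \<odot>\<^bsub>N\<^esub> x \<in> h ` carrier M" if "a \<in> carrier R" "x \<in> h ` carrier M" for a x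
      using that M.smult_closed by (auto simp flip: hf(3))
  qed (use hf(1) in auto)
qed

text \<open>Of the projectivity of \<open>I\<close> only the splitting of epimorphisms \<open>P \<rightarrow> I\<close> is needed.\<close>

lemma projective_cover_unique:
  assumes cover: "projective_cover R M P \<pi>"
    and I: "left_module R I" and eps: "\<epsilon> \<in> lmod_hom R I M" and eps_surj: "\<epsilon> ` carrier I = carrier M"
    and sup: "\<And>N. \<lbrakk>submodule N R I;
        \<And>v. v \<in> carrier I \<Longrightarrow> \<exists>n\<in>N. \<exists>k\<in>carrier I. \<epsilon> k = \<zero>\<^bsub>M\<^esub> \<and> v = n \<oplus>\<^bsub>I\<^esub> k\<rbrakk> \<Longrightarrow> N = carrier I"
    and split: "\<And>\<phi>. \<lbrakk>\<phi> \<in> lmod_hom R P I; \<phi> ` carrier P = carrier I\<rbrakk> \<Longrightarrow>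
      \<exists>\<sigma>\<in>lmod_hom R I P. \<forall>y\<in>carrier I. \<phi> (\<sigma> y) = y"
  shows "\<exists>\<phi>\<in>lmod_hom R P I. bij_betw \<phi> (carrier P) (carrier I)"
proof -
  have M: "left_module R M" and proj: "projective R P" and pi: "\<pi> \<in> lmod_hom R P M"
    and pi_surj: "\<pi> ` carrier P = carrier M" and supP: "superfluous R P (a_kernel P M \<pi>)"
    using cover by (auto simp: projective_cover_def)
  have P: "left_module R P" using proj by (simp add: projective_def)
  interpret M: left_module R M by (rule M)
  interpret P: left_module R P by (rule P)
  interpret I: left_module R I by (rule I)
  note pf = lmod_hom_facts[OF P M pi] and ef = lmod_hom_facts[OF I M eps]
  \<comment> \<open>Projectivity of \<open>P\<close> lifts \<pi> along \<epsilon>. The image of the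
    lift and the kernel of \<epsilon> together give all of \<open>I\<close>, so the lift is onto by
    \<open>sup\<close>.\<close>
  obtain \<phi> where phi: "\<phi> \<in> lmod_hom R P I" and phi_pi: "\<And>x. x \<in> carrier P \<Longrightarrow> \<epsilon> (\<phi> x) = \<pi> x"
    using projective_lift[OF proj I M eps eps_surj pi] by blast
  note phf = lmod_hom_facts[OF P I phi]
  have phi_surj: "\<phi> ` carrier P = carrier I"
  proof (rule sup[OF submodule_image[OF P I phi]])
    fix v assume v: "v \<in> carrier I"
    then have "\<epsilon> v \<in> \<pi> ` carrier P" using pi_surj ef(1) by blast
    then obtain x where x: "x \<in> carrier P" "\<epsilon> v = \<pi> x" by blast
    note px = phf(1)[OF x(1)]
    have "\<epsilon> (v \<ominus>\<^bsub>I\<^esub> \<phi> x) = \<zero>\<^bsub>M\<^esub>"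
      using x v px pf(1)[OF x(1)] by (simp add: ef(5) phi_pi a_minus_def[of M] M.M.r_neg)
    moreover have "v = \<phi> x \<oplus>\<^bsub>I\<^esub> (v \<ominus>\<^bsub>I\<^esub> \<phi> x)"
      using v px by (simp add: a_minus_def I.M.a_comm[of "\<phi> x"] I.M.a_assoc I.M.l_neg)
    moreover have "v \<ominus>\<^bsub>I\<^esub> \<phi> x \<in> carrier I" using v px by simp
    ultimately show "\<exists>n\<in>\<phi> ` carrier P. \<exists>k\<in>carrier I. \<epsilon> k = \<zero>\<^bsub>M\<^esub> \<and> v = n \<oplus>\<^bsub>I\<^esub> k" using x(1) by blast
  qed
  obtain \<sigma> where sigma: "\<sigma> \<in> lmod_hom R I P" and phi_sigma: "\<And>y. y \<in> carrier I \<Longrightarrow> \<phi> (\<sigma> y) = y"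
    using split[OF phi phi_surj] by blast
  note sf = lmod_hom_facts[OF I P sigma]
  have sub: "submodule (\<sigma> ` carrier I) R P" by (rule submodule_image[OF I P sigma])
  \<comment> \<open>The difference of x and \<sigma>(\<phi> x) lies in the kernel of \<pi>, because
    \<pi> = \<epsilon> \<phi> and \<phi> \<sigma> is the identity. Superfluity of this kernel makes
    \<sigma> onto, and then \<phi>, of which \<sigma> is a right inverse, is injective.\<close>
  have "a_kernel P M \<pi> <+>\<^bsub>P\<^esub> (\<sigma> ` carrier I) = carrier P"
  proof
    show "a_kernel P M \<pi> <+>\<^bsub>P\<^esub> (\<sigma> ` carrier I) \<subseteq> carrier P"
      using sf(1) by (auto simp: set_add_def' a_kernel_def')
    show "carrier P \<subseteq> a_kernel P M \<pi> <+>\<^bsub>P\<^esub> (\<sigma> ` carrier I)"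
    proof
      fix x assume x: "x \<in> carrier P"
      let ?y = "\<sigma> (\<phi> x)"
      have y: "?y \<in> carrier P" using sf(1) phf(1) x by blast
      have "\<pi> ?y = \<pi> x" using phi_pi[OF y] phi_pi[OF x] phi_sigma[OF phf(1)[OF x]] by simp
      then have "x \<ominus>\<^bsub>P\<^esub> ?y \<in> a_kernel P M \<pi>"
        using x y pf(1)[OF x] by (simp add: a_kernel_def' pf(5) a_minus_def[of M] M.M.r_neg)
      moreover have "x = (x \<ominus>\<^bsub>P\<^esub> ?y) \<oplus>\<^bsub>P\<^esub> ?y" using x y by (simp add: a_minus_def P.M.a_assoc P.M.l_neg)
      ultimately show "x \<in> a_kernel P M \<pi> <+>\<^bsub>P\<^esub> (\<sigma> ` carrier I)"
        using phf(1)[OF x] unfolding set_add_def' by blast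
    qed
  qed
  then have s_surj: "\<sigma> ` carrier I = carrier P" using supP sub by (auto simp: superfluous_def)
  have "inj_on \<phi> (carrier P)"
  proof (rule inj_onI)
    fix x x' assume "x \<in> carrier P" "x' \<in> carrier P" and eq: "\<phi> x = \<phi> x'"
    then obtain y y' where "y \<in> carrier I" "x = \<sigma> y" "y' \<in> carrier I" "x' = \<sigma> y'" using s_surj by blast
    then show "x = x'" using eq phi_sigma by simp
  qed
  then show ?thesis using phi phi_surj by (auto simp: bij_betw_def)
qed

section \<open>One-dimensional modules and their characters\<close>

context reduced_env_module
begin

lemma reduced_env_module_restrict:
  assumes H: "p_subalgebra F L H"
  shows "reduced_env_module p F (sub_rlie L H) (restrict \<chi> H) (restrict_module V H)"
proof -
  have H': "submodule H F L" "\<And>x y. \<lbrakk>x \<in> H; y \<in> H\<rbrakk> \<Longrightarrow> lie_bracket L x y \<in> H"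
      "\<And>x. x \<in> H \<Longrightarrow> pmap L x \<in> H"
    using H by (auto simp: p_subalgebra_def)
  have minus: "v \<ominus>\<^bsub>restrict_module V H\<^esub> w = v \<ominus>\<^bsub>V\<^esub> w" for v w
    by (simp add: restrict_module_def a_minus_def a_inv_def)
  have sel: "carrier (restrict_module V H) = carrier V" "smult (restrict_module V H) = smult V"
      "act (restrict_module V H) = restrict (act V) H"
    by (simp_all add: restrict_module_def)
  have "has_p_character p F (sub_rlie L H) (restrict \<chi> H) (restrict_module V H)"
    using p_char H'(3) submodule_carrier[OF H'(1)] unfolding has_p_character_def minus sel by simp
  then show ?thesis
    by (intro reduced_env_module.intro reduced_env_module_axioms.intro reduced_env_sub[OF H]
        lie_module_restrict[OF H'(1,2)])
qed

text \<open>Coordinates for a one-element basis are functions on {s}; their uniqueness is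
  cancellation of s. In particular s is nonzero, since otherwise 0 s = 1 s.\<close>

lemma one_dimensional_basis:
  assumes "has_dim F V 1"
  obtains s where "s \<in> carrier V" "s \<noteq> \<zero>\<^bsub>V\<^esub>"
    "\<And>v. v \<in> carrier V \<Longrightarrow> \<exists>c\<in>carrier F. v = c \<odot>\<^bsub>V\<^esub> s"
    "\<And>a b. \<lbrakk>a \<in> carrier F; b \<in> carrier F; a \<odot>\<^bsub>V\<^esub> s = b \<odot>\<^bsub>V\<^esub> s\<rbrakk> \<Longrightarrow> a = b"
proof -
  obtain B where "fin_basis F V B" "card B = 1" using assms by (auto simp: has_dim_def)
  then obtain s where "fin_basis F V {s}" by (metis card_1_singletonE)
  then have s: "s \<in> carrier V"
    and basis: "\<And>v. v \<in> carrier V \<Longrightarrow> \<exists>!c. c \<in> {s} \<rightarrow>\<^sub>E carrier F \<and> v = (\<Oplus>\<^bsub>V\<^esub>b\<in>{s}. c b \<odot>\<^bsub>V\<^esub> b)"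
    unfolding fin_basis_def by blast+
  have sum: "(\<Oplus>\<^bsub>V\<^esub>b\<in>{s}. c b \<odot>\<^bsub>V\<^esub> b) = c s \<odot>\<^bsub>V\<^esub> s" if "c \<in> {s} \<rightarrow>\<^sub>E carrier F" for c
  proof -
    have "c s \<odot>\<^bsub>V\<^esub> s \<in> carrier V" using that s by (auto intro!: V.smult_closed)
    then show ?thesis using V.M.finsum_insert[of "{}" s "\<lambda>b. c b \<odot>\<^bsub>V\<^esub> b"] by simp
  qed
  have span: "\<exists>c\<in>carrier F. v = c \<odot>\<^bsub>V\<^esub> s" if v: "v \<in> carrier V" for v
  proof -
    obtain c where c: "c \<in> {s} \<rightarrow>\<^sub>E carrier F" "v = (\<Oplus>\<^bsub>V\<^esub>b\<in>{s}. c b \<odot>\<^bsub>V\<^esub> b)"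
      using basis[OF v] by blast
    then show ?thesis using sum[OF c(1)] by auto
  qed
  have unique: "a = b" if a: "a \<in> carrier F" and b: "b \<in> carrier F" and eq: "a \<odot>\<^bsub>V\<^esub> s = b \<odot>\<^bsub>V\<^esub> s" for a b
  proof -
    let ?c = "\<lambda>a. restrict (\<lambda>_. a) {s}"
    have c: "?c a \<in> {s} \<rightarrow>\<^sub>E carrier F" "?c b \<in> {s} \<rightarrow>\<^sub>E carrier F" using a b by auto
    have v: "a \<odot>\<^bsub>V\<^esub> s \<in> carrier V" using a s by simp
    have "a \<odot>\<^bsub>V\<^esub> s = (\<Oplus>\<^bsub>V\<^esub>x\<in>{s}. ?c a x \<odot>\<^bsub>V\<^esub> x)" "a \<odot>\<^bsub>V\<^esub> s = (\<Oplus>\<^bsub>V\<^esub>x\<in>{s}. ?c b x \<odot>\<^bsub>V\<^esub> x)"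
      unfolding sum[OF c(1)] sum[OF c(2)] using eq by simp_all
    then have "?c a = ?c b" using ex1_implies_ex basis[OF v] c by blast
    then have "?c a s = ?c b s" by (rule fun_cong)
    then show ?thesis by simp
  qed
  moreover have "s \<noteq> \<zero>\<^bsub>V\<^esub>"
    using unique[of \<zero> \<one>] by auto
  ultimately show ?thesis using that s span by blast
qed

text \<open>\<open>lam x\<close> is the eigenvalue of x on the line. Its laws result from evaluating
  the module axioms and the p-character condition at s and comparing coefficients.\<close>

lemma one_dimensional_character:
  assumes res: "restricted_lie_algebra p F L" and s: "s \<in> carrier V"
    and span: "\<And>v. v \<in> carrier V \<Longrightarrow> \<exists>c\<in>carrier F. v = c \<odot>\<^bsub>V\<^esub> s"
    and unique: "\<And>a b. \<lbrakk>a \<in> carrier F; b \<in> carrier F; a \<odot>\<^bsub>V\<^esub> s = b \<odot>\<^bsub>V\<^esub> s\<rbrakk> \<Longrightarrow> a = b"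
  obtains lam where "env_character p F L \<chi> lam"
    "\<And>x v. \<lbrakk>x \<in> carrier L; v \<in> carrier V\<rbrakk> \<Longrightarrow> act V x v = lam x \<odot>\<^bsub>V\<^esub> v"
proof -
  define lam where "lam x = (SOME c. c \<in> carrier F \<and> act V x s = c \<odot>\<^bsub>V\<^esub> s)" for x
  have lam: "lam x \<in> carrier F" "act V x s = lam x \<odot>\<^bsub>V\<^esub> s" if "x \<in> carrier L" for x
    using someI_ex[of "\<lambda>c. c \<in> carrier F \<and> act V x s = c \<odot>\<^bsub>V\<^esub> s"] span[OF act_closed[OF that s]]
    unfolding lam_def by blast+
  have lam_act: "act V x v = lam x \<odot>\<^bsub>V\<^esub> v" if x: "x \<in> carrier L" and v: "v \<in> carrier V" for x v
  proof -
    obtain c where c: "c \<in> carrier F" "v = c \<odot>\<^bsub>V\<^esub> s" using span[OF v] by blast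
    then show ?thesis
      using lam[OF x] x s by (simp add: act_smult_right m_comm flip: V.smult_assoc1)
  qed
  have lamI: "lam x = c" if "x \<in> carrier L" "c \<in> carrier F" "act V x s = c \<odot>\<^bsub>V\<^esub> s" for x c
    using unique lam that by metis
  interpret res: restricted_lie_algebra p F L by (rule res)
  have "env_character p F L \<chi> lam"
  proof unfold_locales
    fix x y assume xy: "x \<in> carrier L" "y \<in> carrier L"
    show "lam (x \<oplus>\<^bsub>L\<^esub> y) = lam x \<oplus> lam y"
      using xy lam(1) lam(2)[OF xy(1)] lam(2)[OF xy(2)] s
      by (intro lamI) (simp_all add: act_add_left V.smult_l_distr)
    have "act V x (act V y s) = act V y (act V x s)"
      using xy lam s by (simp add: lam_act m_comm act_smult_right flip: V.smult_assoc1)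
    then show "lam (lie_bracket L x y) = \<zero>"
      using xy s by (intro lamI)
        (simp_all add: bracket_closed act_bracket act_closed a_minus_def V.M.r_neg)
  next
    fix x assume x: "x \<in> carrier L"
    have px: "pmap L x \<in> carrier L" using x pmap_in by blast
    have pow: "(act V x ^^ n) s = (lam x [^] n) \<odot>\<^bsub>V\<^esub> s" for n :: nat
    proof (induction n)
      case (Suc n)
      then show ?case
        using x s lam[OF x] by (simp add: lam_act m_comm flip: V.smult_assoc1)
    qed (use s in simp)
    have "(act V x ^^ p) s \<ominus>\<^bsub>V\<^esub> act V (pmap L x) s = (\<chi> x [^] p) \<odot>\<^bsub>V\<^esub> s"
      using p_char x s unfolding has_p_character_def by blast
    then have "(lam x [^] p) \<odot>\<^bsub>V\<^esub> s \<ominus>\<^bsub>V\<^esub> lam (pmap L x) \<odot>\<^bsub>V\<^esub> s = (\<chi> x [^] p) \<odot>\<^bsub>V\<^esub> s"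
      by (simp only: pow lam(2)[OF px])
    then have "(lam x [^] p) \<odot>\<^bsub>V\<^esub> s = (\<chi> x [^] p) \<odot>\<^bsub>V\<^esub> s \<oplus>\<^bsub>V\<^esub> lam (pmap L x) \<odot>\<^bsub>V\<^esub> s"
      using lam(1)[OF x] lam(1)[OF px] s
      by (metis V.M.add.inv_solve_right a_minus_def nat_pow_closed V.smult_closed chi_in x)
    also have "\<dots> = (lam (pmap L x) \<oplus> \<chi> x [^] p) \<odot>\<^bsub>V\<^esub> s"
      using lam(1)[OF px] s x by (simp add: V.smult_l_distr chi_in V.M.a_comm)
    finally have eq: "(lam x [^] p) \<odot>\<^bsub>V\<^esub> s = (lam (pmap L x) \<oplus> \<chi> x [^] p) \<odot>\<^bsub>V\<^esub> s" .
    show "lam x [^] p = lam (pmap L x) \<oplus> \<chi> x [^] p"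
      by (rule unique[OF _ _ eq]) (use lam(1)[OF x] lam(1)[OF px] x chi_in in simp_all)
  next
    fix a x assume ax: "a \<in> carrier F" "x \<in> carrier L"
    then show "lam (a \<odot>\<^bsub>L\<^esub> x) = a \<otimes> lam x"
      using lam[OF ax(2)] s by (intro lamI) (simp_all add: act_smult_left V.smult_assoc1)
  qed (simp add: lam)
  then show ?thesis using that lam_act by blast
qed

end

section \<open>Induction from a maximal torus\<close>

text \<open>\<open>H\<close> is an arbitrary p-subalgebra here; that it is a maximal torus enters in
  \<open>projective_cover_induced\<close>.\<close>

locale induced_one_dim = reduced_env_module p F L \<chi> V + env_character p F L \<chi> lam
  for p :: nat and F :: "('k, 'n) ring_scheme" (structure)
    and L :: "('k, 'l, 'm) rlie_scheme" (structure) and \<chi> :: "'l \<Rightarrow> 'k"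
    and V :: "('k, 'l, 'v, 'w) lie_mod_scheme" (structure) and lam :: "'l \<Rightarrow> 'k" +
  fixes s :: 'v and H :: "'l set"
  assumes s: "s \<in> carrier V" and span: "v \<in> carrier V \<Longrightarrow> \<exists>c\<in>carrier F. v = c \<odot>\<^bsub>V\<^esub> s"
    and unique: "\<lbrakk>a \<in> carrier F; b \<in> carrier F; a \<odot>\<^bsub>V\<^esub> s = b \<odot>\<^bsub>V\<^esub> s\<rbrakk> \<Longrightarrow> a = b"
    and act_lam: "\<lbrakk>x \<in> carrier L; v \<in> carrier V\<rbrakk> \<Longrightarrow> act V x v = lam x \<odot>\<^bsub>V\<^esub> v"
    and H: "p_subalgebra F L H"
begin

sublocale H: reduced_env_module p F "sub_rlie L H" "restrict \<chi> H" "restrict_module V H"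
  by (rule reduced_env_module_restrict[OF H])

lemma H_carrier: "x \<in> H \<Longrightarrow> x \<in> carrier L"
  using H submodule_carrier by (auto simp: p_subalgebra_def)

lemma H_sel [simp]: "carrier (restrict_module V H) = carrier V" "add (restrict_module V H) = add V"
  "zero (restrict_module V H) = zero V" "smult (restrict_module V H) = smult V"
  "x \<in> H \<Longrightarrow> act (restrict_module V H) x = act V x"
  by (simp_all add: restrict_module_def)

lemma map_H_cls: "f \<in> carrier (FA H) \<Longrightarrow> red_env_map p F L \<chi> H (H.cls f) = cls f"
  by (rule red_env_map_class[OF H])

lemma FA_H: "f \<in> carrier (FA H) \<Longrightarrow> f \<in> carrier A"
  by (rule free_algebra_mono[OF subsetI]) (rule H_carrier)

lemma H_red_class_surj:
  assumes r: "r \<in> carrier H.R"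
  obtains f where "f \<in> carrier (FA H)" "r = H.cls f"
proof -
  obtain f where "f \<in> carrier (FA (carrier (sub_rlie L H)))" "r = H.cls f" using H.red_class_surj[OF r] .
  then show ?thesis by (intro that) simp_all
qed

sublocale E: scalar_extension H.R R "red_env_map p F L \<chi> H" H.VR
proof unfold_locales
  fix r assume r: "r \<in> carrier H.R"
  obtain f where "f \<in> carrier (FA H)" "r = H.cls f" using H_red_class_surj[OF r] .
  then show "red_env_map p F L \<chi> H r \<in> carrier R" using map_H_cls FA_H by simp
next
  interpret VR: left_module H.R H.VR by (rule H.to_red_env_left_module)
  show "r \<odot>\<^bsub>H.VR\<^esub> n \<in> carrier H.VR" if "r \<in> carrier H.R" "n \<in> carrier H.VR" for r n
    using that by (rule VR.smult_closed)
qed simp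

abbreviation I where "I \<equiv> E.E"

lemma induced_eq: "induced p F L \<chi> H (restrict_module V H) = I"
  by (simp add: induced_def)

definition i0 where "i0 = E.tensor \<one>\<^bsub>R\<^esub> s"

lemma i0_closed: "i0 \<in> carrier I"
  unfolding i0_def using s by (intro E.tensor_closed) simp_all

text \<open>An element of u(H,\<chi>|H) moves across the tensor sign and becomes its image in
  u(L,\<chi>).\<close>

lemma smult_i0:
  assumes a: "a \<in> carrier R" and f: "f \<in> carrier (FA H)"
  shows "E.tensor a (H.cls f \<odot>\<^bsub>H.VR\<^esub> s) = (a \<otimes>\<^bsub>R\<^esub> cls f) \<odot>\<^bsub>I\<^esub> i0"
proof -
  have r: "H.cls f \<in> carrier H.R" using f H.cls.hom_closed[of f] by simp
  have "E.tensor a (H.cls f \<odot>\<^bsub>H.VR\<^esub> s) = E.tensor (a \<otimes>\<^bsub>R\<^esub> cls f) s"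
    using E.tensor_balanced[OF a r, of s] s map_H_cls[OF f] by simp
  also have "\<dots> = (a \<otimes>\<^bsub>R\<^esub> cls f) \<odot>\<^bsub>I\<^esub> i0"
    unfolding i0_def using a f s FA_H by (subst E.smult_tensor) simp_all
  finally show ?thesis .
qed

lemma tensor_eq:
  assumes a: "a \<in> carrier R" and c: "c \<in> carrier F"
  shows "E.tensor a (c \<odot>\<^bsub>V\<^esub> s) = (a \<otimes>\<^bsub>R\<^esub> scal c) \<odot>\<^bsub>I\<^esub> i0"
  using smult_i0[OF a free_scalar_closed[OF c]] H.smult_red_class[of "free_scalar F c" s]
    H.word_action_free_scalar[OF c, of s] s free_scalar_closed[OF c, of H] by simp

text \<open>As \<open>V\<close> is a line, every pure tensor has the form a \<otimes> c s and so
  equals a c applied to 1 \<otimes> s.\<close>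

lemma i0_generates:
  assumes "v \<in> carrier I"
  shows "\<exists>r\<in>carrier R. v = r \<odot>\<^bsub>I\<^esub> i0"
proof -
  interpret I: left_module R I by (rule E.left_module_E)
  have "(\<lambda>r. r \<odot>\<^bsub>I\<^esub> i0) ` carrier R = carrier I"
  proof (rule E.E_submodule_eqI)
    show "submodule ((\<lambda>r. r \<odot>\<^bsub>I\<^esub> i0) ` carrier R) R I"
    proof (rule I.lsubmoduleI)
      show "\<zero>\<^bsub>I\<^esub> \<in> (\<lambda>r. r \<odot>\<^bsub>I\<^esub> i0) ` carrier R"
        by (rule image_eqI[OF _ R.zero_closed]) (simp add: I.smult_l_null i0_closed)
      show "(\<lambda>r. r \<odot>\<^bsub>I\<^esub> i0) ` carrier R \<subseteq> carrier I" using I.smult_closed i0_closed by blast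
      fix x assume "x \<in> (\<lambda>r. r \<odot>\<^bsub>I\<^esub> i0) ` carrier R"
      then obtain r where r: "r \<in> carrier R" "x = r \<odot>\<^bsub>I\<^esub> i0" by blast
      show "a \<odot>\<^bsub>I\<^esub> x \<in> (\<lambda>r. r \<odot>\<^bsub>I\<^esub> i0) ` carrier R" if a: "a \<in> carrier R" for a
        by (rule image_eqI[OF _ R.m_closed[OF a r(1)]]) (simp add: r I.smult_assoc1 a i0_closed)
      fix y assume "y \<in> (\<lambda>r. r \<odot>\<^bsub>I\<^esub> i0) ` carrier R"
      then obtain q where q: "q \<in> carrier R" "y = q \<odot>\<^bsub>I\<^esub> i0" by blast
      show "x \<oplus>\<^bsub>I\<^esub> y \<in> (\<lambda>r. r \<odot>\<^bsub>I\<^esub> i0) ` carrier R"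
        by (rule image_eqI[OF _ R.a_closed[OF r(1) q(1)]]) (simp add: r q I.smult_l_distr i0_closed)
    qed
    fix a n assume a: "a \<in> carrier R" and "n \<in> carrier H.VR"
    then obtain c where c: "c \<in> carrier F" "n = c \<odot>\<^bsub>V\<^esub> s" using span by auto
    show "E.tensor a n \<in> (\<lambda>r. r \<odot>\<^bsub>I\<^esub> i0) ` carrier R"
      unfolding c tensor_eq[OF a c(1)] using a scal_closed[OF c(1)] by blast
  qed
  then show ?thesis using assms by blast
qed

lemma dif_i0:
  assumes t: "t \<in> H"
  shows "dif t \<odot>\<^bsub>I\<^esub> i0 = \<zero>\<^bsub>I\<^esub>"
proof -
  interpret I: left_module R I by (rule E.left_module_E)
  have tL: "t \<in> carrier L" using t H_carrier by blast
  have gt: "free_gen F t \<in> carrier (FA H)" using free_gen_closed[OF t] .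
  have "H.cls (free_gen F t) \<odot>\<^bsub>H.VR\<^esub> s = lam t \<odot>\<^bsub>V\<^esub> s"
    using H.smult_red_class[of "free_gen F t" s] H.word_action_gen[of t s] gt s t act_lam[OF tL s] by simp
  then have "gen t \<odot>\<^bsub>I\<^esub> i0 = scal (lam t) \<odot>\<^bsub>I\<^esub> i0"
    using smult_i0[OF R.one_closed gt] tensor_eq[OF R.one_closed lam_closed[OF tL]]
      gen_closed[OF tL] scal_closed[OF lam_closed[OF tL]] by simp
  then show ?thesis
    using gen_closed[OF tL] scal_closed[OF lam_closed[OF tL]] i0_closed
    by (simp add: dif_def I.smult_l_diff I.smult_closed a_minus_def[of I] I.M.r_neg)
qed

text \<open>Frobenius reciprocity: when \<open>H\<close> acts on v through \<open>lam\<close>, the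
  rule c s -> c v is an H-homomorphism from the line \<open>V\<close>, and it extends to the induced
  module.\<close>

lemma induced_universal:
  assumes M: "left_module R M" and v: "v \<in> carrier M" and Hv: "\<And>t. t \<in> H \<Longrightarrow> dif t \<odot>\<^bsub>M\<^esub> v = \<zero>\<^bsub>M\<^esub>"
  obtains h where "h \<in> lmod_hom R I M" "h i0 = v"
proof -
  interpret M: left_module R M by (rule M)
  define coef where "coef n = (SOME c. c \<in> carrier F \<and> n = c \<odot>\<^bsub>V\<^esub> s)" for n
  have coef: "coef n \<in> carrier F" "n = coef n \<odot>\<^bsub>V\<^esub> s" if "n \<in> carrier V" for n
    using someI_ex[of "\<lambda>c. c \<in> carrier F \<and> n = c \<odot>\<^bsub>V\<^esub> s"] span[OF that] unfolding coef_def by blast+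
  have coefI: "coef n = c" if "c \<in> carrier F" "n = c \<odot>\<^bsub>V\<^esub> s" for n c
    using unique coef s that by (metis V.smult_closed)
  define g where "g n = scal (coef n) \<odot>\<^bsub>M\<^esub> v" for n
  have g_closed: "g n \<in> carrier M" if "n \<in> carrier V" for n
    using coef(1)[OF that] v by (simp add: g_def M.smult_closed scal_closed)
  have g_add: "g (n \<oplus>\<^bsub>V\<^esub> m) = g n \<oplus>\<^bsub>M\<^esub> g m" if n: "n \<in> carrier V" and m: "m \<in> carrier V" for n m
  proof -
    have "coef (n \<oplus>\<^bsub>V\<^esub> m) = coef n \<oplus> coef m"
      using coef[OF n] coef[OF m] s by (intro coefI) (auto simp: V.smult_l_distr)
    then show ?thesis
      using coef(1)[OF n] coef(1)[OF m] v by (simp add: g_def scal_add M.smult_l_distr scal_closed)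
  qed
  have g_smult: "g (a \<odot>\<^bsub>V\<^esub> n) = scal a \<odot>\<^bsub>M\<^esub> g n" if a: "a \<in> carrier F" and n: "n \<in> carrier V" for a n
  proof -
    have "coef (a \<odot>\<^bsub>V\<^esub> n) = a \<otimes> coef n"
      using coef[OF n] s a by (intro coefI) (auto simp: V.smult_assoc1)
    then show ?thesis
      using coef(1)[OF n] a v by (simp add: g_def scal_mult M.smult_assoc1 scal_closed)
  qed
  have g_gen: "gen t \<odot>\<^bsub>M\<^esub> g n = scal (lam t) \<odot>\<^bsub>M\<^esub> g n" if t: "t \<in> H" and n: "n \<in> carrier V" for t n
  proof -
    have tL: "t \<in> carrier L" using t H_carrier by blast
    have "dif t \<odot>\<^bsub>M\<^esub> g n = scal (coef n) \<odot>\<^bsub>M\<^esub> (dif t \<odot>\<^bsub>M\<^esub> v)"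
      using scal_central[OF coef(1)[OF n] dif_closed[OF tL]] v coef(1)[OF n] tL
      by (simp add: g_def dif_closed scal_closed flip: M.smult_assoc1)
    then have "dif t \<odot>\<^bsub>M\<^esub> g n = \<zero>\<^bsub>M\<^esub>"
      using Hv[OF t] coef(1)[OF n] by (simp add: M.smult_r_null scal_closed)
    then show ?thesis
      using g_closed[OF n] tL
      by (simp add: gen_eq_dif M.smult_l_distr M.smult_closed dif_closed scal_closed lam_closed)
  qed
  have ops: "f \<oplus>\<^bsub>FA H\<^esub> f' = f \<oplus>\<^bsub>A\<^esub> f'" "f \<otimes>\<^bsub>FA H\<^esub> f' = f \<otimes>\<^bsub>A\<^esub> f'" "\<zero>\<^bsub>FA H\<^esub> = \<zero>\<^bsub>A\<^esub>" "\<one>\<^bsub>FA H\<^esub> = \<one>\<^bsub>A\<^esub>" for f f'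
    by (simp_all add: free_algebra_sel)
  let ?W = "restrict_module V H"
  note wa = H.word_action_closed H.word_action_zero H.word_action_one H.word_action_add
    H.word_action_scalar H.word_action_gen_mult
  note wa' = wa[simplified]
  \<comment> \<open>Linearity of g over u(H,\<chi>|H) is checked on representatives in the free
    algebra on \<open>H\<close>, one letter at a time.\<close>
  have word: "g (word_action F ?W f n) = cls f \<odot>\<^bsub>M\<^esub> g n" if f: "f \<in> carrier (FA H)" and n: "n \<in> carrier V" for f n
    using f
  proof (induction f rule: free_algebra_induct)
    case zero
    have "g \<zero>\<^bsub>V\<^esub> = \<zero>\<^bsub>M\<^esub>"
      using coefI[of \<zero> "\<zero>\<^bsub>V\<^esub>"] s v by (simp add: g_def scal_zero M.smult_l_null)
    moreover have "cls \<zero>\<^bsub>FA H\<^esub> = \<zero>\<^bsub>R\<^esub>" unfolding ops by simp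
    ultimately show ?case using g_closed[OF n] by (simp add: wa' M.smult_l_null)
  next
    case one
    have "cls \<one>\<^bsub>FA H\<^esub> = \<one>\<^bsub>R\<^esub>" unfolding ops by simp
    then show ?case using g_closed[OF n] n by (simp add: wa' M.smult_one)
  next
    case (add f f')
    have "cls (f \<oplus>\<^bsub>FA H\<^esub> f') = cls f \<oplus>\<^bsub>R\<^esub> cls f'" unfolding ops using add FA_H by simp
    then show ?case using add n g_closed[OF n] FA_H by (simp add: wa' g_add M.smult_l_distr)
  next
    case (smult c f)
    have "cls (free_scalar F c \<otimes>\<^bsub>FA H\<^esub> f) = scal c \<otimes>\<^bsub>R\<^esub> cls f"
      unfolding ops using smult FA_H by (simp add: free_scalar_closed)
    then show ?case using smult n g_closed[OF n] FA_H by (simp add: wa' g_smult M.smult_assoc1 scal_closed)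
  next
    case (gen t f)
    have tL: "t \<in> carrier L" using gen(1) H_carrier by blast
    let ?n = "word_action F ?W f n"
    have nc: "?n \<in> carrier V" using wa'(1) gen n by simp
    have "cls (free_gen F t \<otimes>\<^bsub>FA H\<^esub> f) = gen t \<otimes>\<^bsub>R\<^esub> cls f"
      unfolding ops using gen FA_H tL by (simp add: free_gen_closed)
    then show ?case
      using gen n nc g_closed[OF n] FA_H[OF gen(2)] tL g_gen[OF gen(1) nc] g_smult[OF lam_closed[OF tL] nc]
      by (simp add: wa' act_lam M.smult_assoc1 gen_closed)
  qed
  obtain h where h: "h \<in> lmod_hom R I M"
    "\<And>a n. \<lbrakk>a \<in> carrier R; n \<in> carrier H.VR\<rbrakk> \<Longrightarrow> h (E.tensor a n) = a \<odot>\<^bsub>M\<^esub> g n"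
  proof (rule E.E_universal[OF M, of g])
    fix r n assume r: "r \<in> carrier H.R" and n: "n \<in> carrier H.VR"
    obtain f where f: "f \<in> carrier (FA H)" "r = H.cls f" using H_red_class_surj[OF r] .
    show "g (r \<odot>\<^bsub>H.VR\<^esub> n) = red_env_map p F L \<chi> H r \<odot>\<^bsub>M\<^esub> g n"
      using word[OF f(1), of n] H.smult_red_class[of f n] n f map_H_cls by simp
  qed (use g_closed g_add in simp_all)
  have "g s = v" using coefI[of \<one> s] s v by (simp add: g_def scal_one M.smult_one)
  then have "h i0 = v" using h(2)[OF R.one_closed, of s] s v by (simp add: i0_def M.smult_one)
  then show ?thesis using that h(1) by blast
qed

lemma induced_hom_eqI:
  assumes M: "left_module R M" and h: "h \<in> lmod_hom R I M" "h' \<in> lmod_hom R I M" and eq: "h i0 = h' i0"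
    and y: "y \<in> carrier I"
  shows "h y = h' y"
proof -
  obtain r where "r \<in> carrier R" "y = r \<odot>\<^bsub>I\<^esub> i0" using i0_generates[OF y] by blast
  then show ?thesis
    using eq i0_closed lmod_hom_facts(3)[OF E.left_module_E M h(1)] lmod_hom_facts(3)[OF E.left_module_E M h(2)]
    by simp
qed

lemma dif_trivial:
  assumes x: "x \<in> carrier L" and v: "v \<in> carrier V"
  shows "dif x \<odot>\<^bsub>VR\<^esub> v = \<zero>\<^bsub>V\<^esub>"
proof -
  interpret VR: left_module R VR by (rule to_red_env_left_module)
  have "gen x \<odot>\<^bsub>VR\<^esub> v = scal (lam x) \<odot>\<^bsub>VR\<^esub> v"
    using x v lam_closed[OF x]
    by (simp add: smult_red_class free_gen_closed free_scalar_closed word_action_gen word_action_free_scalar act_lam)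
  moreover have "scal (lam x) \<odot>\<^bsub>VR\<^esub> v \<in> carrier V"
    using VR.smult_closed[OF scal_closed[OF lam_closed[OF x]], of v] v by simp
  ultimately show ?thesis
    using VR.smult_l_diff[OF gen_closed[OF x] scal_closed[OF lam_closed[OF x]], of v] v VR.M.r_neg
    by (simp add: dif_def a_minus_def)
qed

lemma projective_cover_induced:
  assumes fd: "finite_dim F L" and solv: "lie_solvable F L" and T: "maximal_torus F L H"
    and cover: "projective_cover R VR P \<pi>"
  shows "\<exists>\<phi>\<in>lmod_hom R P I. bij_betw \<phi> (carrier P) (carrier I)"
proof -
  have VR: "left_module R VR" by (rule to_red_env_left_module)
  have I: "left_module R I" by (rule E.left_module_E)
  have P: "left_module R P" using cover by (simp add: projective_cover_def projective_def)
  interpret I: left_module R I by (rule I)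
  interpret P: left_module R P by (rule P)
  have s0: "s \<noteq> \<zero>\<^bsub>V\<^esub>" using unique[of \<zero> \<one>] by auto
  obtain \<epsilon> where eps: "\<epsilon> \<in> lmod_hom R I VR" "\<epsilon> i0 = s"
    using induced_universal[OF VR, of s] s dif_trivial H_carrier by auto
  note ef = lmod_hom_facts[OF I VR eps(1)]
  show ?thesis
  proof (rule projective_cover_unique[OF cover I eps(1)])
    show "\<epsilon> ` carrier I = carrier VR"
    proof
      show "\<epsilon> ` carrier I \<subseteq> carrier VR" using ef(1) by blast
      show "carrier VR \<subseteq> \<epsilon> ` carrier I"
      proof
        fix v assume "v \<in> carrier VR"
        then obtain c where c: "c \<in> carrier F" "v = c \<odot>\<^bsub>V\<^esub> s" using span by auto
        have "\<epsilon> (scal c \<odot>\<^bsub>I\<^esub> i0) = v"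
          using ef(3)[OF scal_closed[OF c(1)] i0_closed] c s eps(2)
          by (simp add: smult_red_class free_scalar_closed word_action_free_scalar)
        then show "v \<in> \<epsilon> ` carrier I" using I.smult_closed[OF scal_closed[OF c(1)] i0_closed] by blast
      qed
    qed
  next
    fix N assume "submodule N R I"
      "\<And>v. v \<in> carrier I \<Longrightarrow> \<exists>n\<in>N. \<exists>k\<in>carrier I. \<epsilon> k = \<zero>\<^bsub>VR\<^esub> \<and> v = n \<oplus>\<^bsub>I\<^esub> k"
    then show "N = carrier I"
      using dif_trivial eps(2) s0
      by (intro kernel_superfluous[OF fd solv T I i0_closed i0_generates dif_i0 VR _ eps(1)]) auto
  next
    fix \<phi> assume phi: "\<phi> \<in> lmod_hom R P I" and surj: "\<phi> ` carrier P = carrier I"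
    note phf = lmod_hom_facts[OF P I phi]
    \<comment> \<open>A section of \<phi> is given by a preimage of \<open>i0\<close> killed by all
      \<open>dif t\<close> with t in \<open>H\<close>. For any preimage m the vectors
      \<open>dif t\<close> applied to m lie in the kernel of \<phi>, so m can be corrected within
      that kernel.\<close>
    have "i0 \<in> \<phi> ` carrier P" using surj i0_closed by simp
    then obtain m where m: "m \<in> carrier P" "\<phi> m = i0" by blast
    interpret tw: lie_module F L "twist P" by (rule twist_lie_module[OF P])
    obtain B where B: "finite B" "B \<subseteq> carrier L" "carrier L = lin_span F L B"
      using finite_dim_spanned[OF fd] .
    have tH: "torus F L H" using T by (simp add: maximal_torus_def)
    let ?N = "{x \<in> carrier P. \<phi> x = \<zero>\<^bsub>I\<^esub>}"
    have N: "submodule ?N R P"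
      by (rule P.lsubmoduleI) (auto simp: phf I.smult_r_null P.smult_closed)
    have "\<exists>n\<in>?N. \<forall>t\<in>H. act (twist P) t (m \<ominus>\<^bsub>twist P\<^esub> n) = \<zero>\<^bsub>twist P\<^esub>"
    proof (rule torus_fixed_lift[OF B tH twist_module[OF P], where N = ?N])
      show "submodule ?N F (twist P)" by (rule submodule_twist[OF P N])
      fix t v assume t: "t \<in> H" and "v \<in> ?N"
      then show "act (twist P) t v \<in> ?N" using P.lsubmoduleD(4)[OF N dif_closed[OF H_carrier[OF t]]] by simp
    next
      fix t assume t: "t \<in> H"
      then show "act (twist P) t m \<in> ?N"
        using m phf(3)[OF dif_closed[OF H_carrier[OF t]] m(1)] dif_i0[OF t]
          P.smult_closed[OF dif_closed[OF H_carrier[OF t]] m(1)] by simp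
    next
      fix t u v assume "t \<in> H" "u \<in> H" "v \<in> carrier (twist P)"
      moreover from this have "lie_bracket L t u = \<zero>\<^bsub>L\<^esub>" using tH by (simp add: torus_def)
      ultimately show "act (twist P) t (act (twist P) u v) = act (twist P) u (act (twist P) t v)"
        using tw.act_swap[of t u v] H_carrier tw.act_zero_left[of v] tw.act_closed
        by (simp del: twist_sel)
    next
      fix t v assume "t \<in> H" "v \<in> carrier (twist P)"
      then show "act (twist P) (pmap L t) v = (act (twist P) t ^^ p) v"
        using twist_pow[OF P] H_carrier by simp
    qed (use m H_carrier tw.act_closed tw.act_add_right tw.act_smult_right tw.act_add_left tw.act_smult_left
        in \<open>simp_all del: twist_sel add: twist_sel(1)\<close>)
    then obtain n where n: "n \<in> carrier P" "\<phi> n = \<zero>\<^bsub>I\<^esub>"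
      and fixed: "\<And>t. t \<in> H \<Longrightarrow> dif t \<odot>\<^bsub>P\<^esub> (m \<ominus>\<^bsub>P\<^esub> n) = \<zero>\<^bsub>P\<^esub>" by (auto simp: twist_minus)
    obtain \<sigma> where sigma: "\<sigma> \<in> lmod_hom R I P" "\<sigma> i0 = m \<ominus>\<^bsub>P\<^esub> n"
      using induced_universal[OF P _ fixed] m n by auto
    note sf = lmod_hom_facts[OF I P sigma(1)]
    have "\<phi> (\<sigma> i0) = i0"
    proof -
      have "\<phi> (\<sigma> i0) \<oplus>\<^bsub>I\<^esub> \<phi> n = \<phi> m"
        using phf(2)[of "m \<ominus>\<^bsub>P\<^esub> n" n] m(1) n(1) sigma(2) by (simp add: a_minus_def P.M.a_assoc P.M.l_neg)
      then show ?thesis using n m phf(1) sf(1)[OF i0_closed] by simp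
    qed
    \<comment> \<open>Both endomorphisms of \<open>I\<close> agree at the generator
      \<open>i0\<close>, hence everywhere.\<close>
    moreover have "(\<lambda>y. \<phi> (\<sigma> y)) \<in> lmod_hom R I I" "(\<lambda>y. y) \<in> lmod_hom R I I"
      using phf sf by (auto simp: lmod_hom_def)
    ultimately have "\<phi> (\<sigma> y) = y" if "y \<in> carrier I" for y
      using induced_hom_eqI[OF I _ _ _ that] by blast
    then show "\<exists>\<sigma>\<in>lmod_hom R I P. \<forall>y\<in>carrier I. \<phi> (\<sigma> y) = y" using sigma(1) by blast
  qed
qed

end

theorem corollary2p3:
  fixes p :: nat
    and F :: "('k, 'n) ring_scheme"
    and L :: "('k, 'l, 'm) rlie_scheme"
    and \<chi> :: "'l \<Rightarrow> 'k"
    and S :: "('k, 'l, 's, 'w) lie_mod_scheme"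
    and T :: "'l set"
    and P :: "(('l list \<Rightarrow> 'k) set set, 'p, 'q) module_scheme"
    and \<pi> :: "'p \<Rightarrow> 's"
  assumes "restricted_lie_algebra p F L"
    and "finite_dim F L"
    and "lie_solvable F L"
    and "linear_form F L \<chi>"
    and "lie_module F L S"
    and "has_p_character p F L \<chi> S"
    and "has_dim F S 1"
    and "maximal_torus F L T"
    and "projective_cover (red_env p F L \<chi>) (to_red_env_module p F L \<chi> S) P \<pi>"
  shows "lie_module_isomorphic F L (to_lie_module p F L \<chi> P)
    (to_lie_module p F L \<chi> (induced p F L \<chi> T (restrict_module S T)))"
proof -
  interpret restricted_lie_algebra p F L by fact
  have "reduced_env F L \<chi>"
    using assms(4) pmap_closed
    by (intro reduced_env.intro reduced_env_axioms.intro lie_algebra_axioms) (auto simp: linear_form_def)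
  then interpret S: reduced_env_module p F L \<chi> S
    using assms(5,6) by (simp add: reduced_env_module_def reduced_env_module_axioms_def)
  obtain s where s: "s \<in> carrier S" and span: "\<And>v. v \<in> carrier S \<Longrightarrow> \<exists>c\<in>carrier F. v = c \<odot>\<^bsub>S\<^esub> s"
    and unique: "\<And>a b. \<lbrakk>a \<in> carrier F; b \<in> carrier F; a \<odot>\<^bsub>S\<^esub> s = b \<odot>\<^bsub>S\<^esub> s\<rbrakk> \<Longrightarrow> a = b"
    using S.one_dimensional_basis[OF assms(7)] by metis
  obtain lam where lam: "env_character p F L \<chi> lam"
    and act_lam: "\<And>x v. \<lbrakk>x \<in> carrier L; v \<in> carrier S\<rbrakk> \<Longrightarrow> act S x v = lam x \<odot>\<^bsub>S\<^esub> v"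
    using S.one_dimensional_character[OF assms(1) s span unique] by metis
  have pT: "p_subalgebra F L T" using assms(8) by (simp add: maximal_torus_def torus_def)
  interpret S: induced_one_dim p F L \<chi> S lam s T
    using s span unique act_lam pT
    by (intro induced_one_dim.intro induced_one_dim_axioms.intro S.reduced_env_module_axioms lam) auto
  obtain \<phi> where phi: "\<phi> \<in> lmod_hom (red_env p F L \<chi>) P (induced p F L \<chi> T (restrict_module S T))"
    and bij: "bij_betw \<phi> (carrier P) (carrier (induced p F L \<chi> T (restrict_module S T)))"
    using S.projective_cover_induced[OF assms(2,3,8,9)] S.induced_eq by metis
  \<comment> \<open>On both sides scalars and elements of \<open>L\<close> act through their classes
    in u(L,\<chi>), so a bijective u(L,\<chi>)-homomorphism is an isomorphism of L-modules.\<close>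
  show ?thesis
    unfolding lie_module_isomorphic_def to_lie_module_def
    using phi bij S.scal_closed S.gen_closed by (intro exI[of _ \<phi>]) (auto simp: lmod_hom_def)
qed

end
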